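(* Let $X, X_1, X_2, \dots$ be independent and identically distributed, non-normal real-valued random variables with $\mathbb{E}X^4<\infty$, distribution function $F$, and continuously differentiable density $p$ satisfying $\sup_{s\in\mathbb{R}}|s\,p(s)|\le K_1\in(0,\infty)$ and $\sup_{s\in\mathbb{R}}|p'(s)|\le K_2\in(0,\infty)$ and (without loss of generality, by affine invariance of the statistic) $\mathbb{E}X=0$, $\mathbb{V}(X)=1$. Then, as $n\to\infty$, $$\sqrt{n}\left(\frac{G_n^{(1)}}{n}-\Delta^{(1)}\right)\stackrel{\mathcal{D}}{\longrightarrow}\mathcal{N}\big(0,\tau_{(1)}^2\big),$$ where $$\tau_{(1)}^2=4\int_{\mathbb{R}}\int_{\mathbb{R}}\mathcal{C}^{(1)}(s,t)\big(F^X(s)-F(s)\big)\big(F^X(t)-F(t)\big)\,\omega(s)\,\omega(t)\,\mathrm{d}s\,\mathrm{d}t$$ with $\mathcal{C}^{(1)}(s,t)=\mathbb{E}\big[C^{(1)}(s)\,C^{(1)}(t)\big]$, $s,t\in\mathbb{R}$, and $$\begin{aligned}C^{(1)}(s)=\;&X(X-s)\mathds{1}\{X\le s\}-X\,\mathbb{E}\big[(X-s)\mathds{1}\{X\le s\}\big]-X^2F^X(s)\\&-\mathds{1}\{X\le s\}+F(s)-\Big(\tfrac12(1-X^2)\cdot s-X\Big)\big(d^X(s)-p(s)\big),\quad s\in\mathbb{R}.\end{aligned}$$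
   Context: $\omega:\mathbb{R}\to\mathbb{R}$ is a positive continuous weight function with $\int_{\mathbb{R}}t^4\,\omega(t)\,\mathrm{d}t<\infty$. The zero-bias distribution of $X$ has density $d^X(t)=\mathbb{E}[X\mathds{1}\{X>t\}]=-\mathbb{E}[X\mathds{1}\{X\le t\}]$ and distribution function $F^X(t)=\mathbb{E}[X(X-t)\mathds{1}\{X\le t\}]$. The sample mean and variance are $\overline{X}_n=n^{-1}\sum_{k=1}^n X_k$ and $S_n^2=n^{-1}\sum_{k=1}^n(X_k-\overline{X}_n)^2$, and $Y_{n,j}=(X_j-\overline{X}_n)/S_n$, $j=1,\dots,n$. The test statistic is $$G_n^{(1)}=n\int_{\mathbb{R}}\Big(\frac1n\sum_{j=1}^nY_{n,j}(Y_{n,j}-t)\mathds{1}\{Y_{n,j}\le t\}-\frac1n\sum_{j=1}^n\mathds{1}\{Y_{n,j}\le t\}\Big)^2\omega(t)\,\mathrm{d}t,$$ and $\Delta^{(1)}=\int_{\mathbb{R}}(F^X(s)-F(s))^2\,\omega(s)\,\mathrm{d}s$. $\stackrel{\mathcal{D}}{\longrightarrow}$ denotes convergence in distribution. *)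

theory Defs
  imports "HOL-Probability.Probability"
begin

section \<open>Zero-bias distribution\<close>

definition zb_density :: "'a measure \<Rightarrow> ('a \<Rightarrow> real) \<Rightarrow> real \<Rightarrow> real" where
  "zb_density M X t = (LINT x|M. X x * indicator {t<..} (X x))"

definition zb_cdf :: "'a measure \<Rightarrow> ('a \<Rightarrow> real) \<Rightarrow> real \<Rightarrow> real" where
  "zb_cdf M X t = (LINT x|M. X x * (X x - t) * indicator {..t} (X x))"

section \<open>The test statistic\<close>

text \<open>A sample of size \<open>n\<close> consists of the entries \<open>x 1, \<dots>, x n\<close> of a sequence \<open>x\<close>.
  For a sample of variance zero, the scaled residuals are \<open>0\<close> by the convention \<open>a / 0 = 0\<close>;
  for \<open>n \<ge> 2\<close> and a law with a density this is a null event.\<close>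

definition sample_mean :: "nat \<Rightarrow> (nat \<Rightarrow> real) \<Rightarrow> real" where
  "sample_mean n x = (\<Sum>k=1..n. x k) / real n"

definition sample_var :: "nat \<Rightarrow> (nat \<Rightarrow> real) \<Rightarrow> real" where
  "sample_var n x = (\<Sum>k=1..n. (x k - sample_mean n x)\<^sup>2) / real n"

definition scaled_residual :: "nat \<Rightarrow> (nat \<Rightarrow> real) \<Rightarrow> nat \<Rightarrow> real" where
  "scaled_residual n x j = (x j - sample_mean n x) / sqrt (sample_var n x)"

definition G1 :: "(real \<Rightarrow> real) \<Rightarrow> nat \<Rightarrow> (nat \<Rightarrow> real) \<Rightarrow> real" where
  "G1 \<omega> n x = real n * (LINT t|lborel.
     ((\<Sum>j=1..n. scaled_residual n x j * (scaled_residual n x j - t)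
                 * indicator {..t} (scaled_residual n x j)) / real n
      - (\<Sum>j=1..n. indicator {..t} (scaled_residual n x j)) / real n)\<^sup>2 * \<omega> t)"

section \<open>The limit\<close>

definition Delta1 :: "(real \<Rightarrow> real) \<Rightarrow> 'a measure \<Rightarrow> ('a \<Rightarrow> real) \<Rightarrow> real" where
  "Delta1 \<omega> M X = (LINT s|lborel. (zb_cdf M X s - cdf (distr M borel X) s)\<^sup>2 * \<omega> s)"

definition C1 :: "'a measure \<Rightarrow> ('a \<Rightarrow> real) \<Rightarrow> (real \<Rightarrow> real) \<Rightarrow> real \<Rightarrow> 'a \<Rightarrow> real" where
  "C1 M X p s x =
     X x * (X x - s) * indicator {..s} (X x)
     - X x * (LINT y|M. (X y - s) * indicator {..s} (X y))
     - (X x)\<^sup>2 * zb_cdf M X s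
     - indicator {..s} (X x) + cdf (distr M borel X) s
     - (1/2 * (1 - (X x)\<^sup>2) * s - X x) * (zb_density M X s - p s)"

definition cov_kernel1 ::
    "'a measure \<Rightarrow> ('a \<Rightarrow> real) \<Rightarrow> (real \<Rightarrow> real) \<Rightarrow> real \<Rightarrow> real \<Rightarrow> real" where
  "cov_kernel1 M X p s t = (LINT x|M. C1 M X p s x * C1 M X p t x)"

definition tau1_sq ::
    "(real \<Rightarrow> real) \<Rightarrow> 'a measure \<Rightarrow> ('a \<Rightarrow> real) \<Rightarrow> (real \<Rightarrow> real) \<Rightarrow> real" where
  "tau1_sq \<omega> M X p = 4 * (LINT s|lborel. (LINT t|lborel.
     cov_kernel1 M X p s t
     * (zb_cdf M X s - cdf (distr M borel X) s)
     * (zb_cdf M X t - cdf (distr M borel X) t) * \<omega> s * \<omega> t))"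

text \<open>The second argument is the variance. The case of variance zero is the point mass at the mean;
  it needs its own clause since \<^term>\<open>normal_density \<mu> 0\<close> is the zero function.\<close>

definition normal_law :: "real \<Rightarrow> real \<Rightarrow> real measure" where
  "normal_law \<mu> v =
     (if v = 0 then return borel \<mu> else density lborel (normal_density \<mu> (sqrt v)))"

end

theory Submission
  imports Defs "HOL-Real_Asymp.Real_Asymp"
begin

text \<open>
  With \<open>u = mean + S t\<close>, the integrand $D_n(t)$ of the statistic is a combination of empirical means
  of \<open>x (x - u) 1{x \<le> u}\<close>, \<open>(u - x) 1{x \<le> u}\<close> and \<open>1{x \<le> u}\<close>. The first two kernels are Lipschitz
  in \<open>u\<close> and can be expanded around \<open>t\<close>; for the third, monotonicity in \<open>u\<close> reduces the random
  point \<open>u\<close> to finitely many fixed points of a grid around \<open>t\<close>. On the event that the first two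
  sample moments are close to their expectations, this bounds the error of the linearisation
  $D_n - D \approx n^{-1} \sum_j C(X_j)$ by centred empirical means of fixed functions, so second
  moments alone show that \<open>sqrt n\<close> times the error vanishes in $L^2(\omega)$. Hence
  $\sqrt n (\int D_n^2 \omega - \int D^2 \omega)$ equals
  $n^{-1/2} \sum_j 2 \int C(X_j) D \omega$ up to a negligible term, and the central limit theorem
  applies. Negligible terms are discarded by comparing characteristic functions.
\<close>

section \<open>The test statistic at a sample\<close>

text \<open>The indicator jumps, so its empirical mean at the random point \<open>u\<close> has no
  expansion sample by sample, unlike the two Lipschitz kernels. The accuracy needed is
  \<open>n * E (int r^2 omega) --> 0\<close> for the linearisation error \<open>r\<close>, because
  \<open>r\<close> meets \<open>D\<close> in the cross term
  \<open>2 * sqrt n * (int r D omega)\<close>. The restriction to close sample moments keeps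
  \<open>1 / S^2\<close> bounded and \<open>u\<close> within \<open>2 * k * (1 + |t|)\<close> of
  \<open>t\<close>, where \<open>k\<close> is the allowed deviation. The quadratic error of the
  expansion is then of order \<open>k^2 * (1 + |t|)^2\<close>; its square is integrable exactly on
  the scale of the fourth moment of the weight. The fourth moment of \<open>X\<close> is what second
  moments of kernels quadratic in \<open>x\<close> require. Integrating against \<open>D\<close>
  before passing to the limit leaves a real-valued average, so a scalar central limit theorem is
  enough.\<close>

definition avg :: "nat \<Rightarrow> (real \<Rightarrow> real) \<Rightarrow> (nat \<Rightarrow> real) \<Rightarrow> real" where
  "avg n f xs = (\<Sum>k=1..n. f (xs k)) / real n"

text \<open>Threshold and point are both ordinary arguments, so joint measurability in the pair,
  needed for every exchange of integrals, is a single rule.\<close>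

definition ind :: "real \<Rightarrow> real \<Rightarrow> real" where
  "ind t x = (if x \<le> t then 1 else 0)"

lemma indicator_atMost_eq_ind: "indicator {..t} x = ind t x"
  by (simp add: ind_def indicator_def)

lemma ind_measurable [measurable]:
  assumes [measurable]: "f \<in> borel_measurable M" "g \<in> borel_measurable M"
  shows "(\<lambda>x. ind (f x) (g x)) \<in> borel_measurable M"
  unfolding ind_def by measurable

lemma avg_measurable [measurable]:
  assumes [measurable]: "\<And>k. k \<in> {1..n} \<Longrightarrow> (\<lambda>x. f x (xs x k)) \<in> borel_measurable M"
  shows "(\<lambda>x. avg n (f x) (xs x)) \<in> borel_measurable M"
  unfolding avg_def by measurable

lemma avg_add: "avg n (\<lambda>x. f x + g x) xs = avg n f xs + avg n g xs"
  by (simp add: avg_def sum.distrib add_divide_distrib)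

lemma avg_diff: "avg n (\<lambda>x. f x - g x) xs = avg n f xs - avg n g xs"
  by (simp add: avg_def sum_subtractf diff_divide_distrib)

lemma avg_cmult: "avg n (\<lambda>x. c * f x) xs = c * avg n f xs"
  by (simp add: avg_def sum_distrib_left)

lemma avg_const: "n > 0 \<Longrightarrow> avg n (\<lambda>_. c) xs = c"
  by (simp add: avg_def)

lemma avg_mono: "(\<And>x. f x \<le> g x) \<Longrightarrow> avg n f xs \<le> avg n g xs"
  by (auto simp: avg_def intro!: divide_right_mono sum_mono)

lemma abs_avg_le: "(\<And>x. \<bar>f x\<bar> \<le> g x) \<Longrightarrow> \<bar>avg n f xs\<bar> \<le> avg n g xs"
proof -
  assume "\<And>x. \<bar>f x\<bar> \<le> g x"
  then have "\<bar>\<Sum>k=1..n. f (xs k)\<bar> \<le> (\<Sum>k=1..n. g (xs k))"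
    by (intro order_trans[OF sum_abs] sum_mono)
  then show ?thesis by (simp add: avg_def divide_right_mono)
qed

lemma sample_mean_eq_avg: "sample_mean n xs = avg n (\<lambda>x. x) xs"
  by (simp add: sample_mean_def avg_def)

lemma sample_var_eq_avg:
  assumes "n > 0"
  shows "sample_var n xs = avg n (\<lambda>x. x\<^sup>2) xs - (avg n (\<lambda>x. x) xs)\<^sup>2"
proof -
  let ?m = "avg n (\<lambda>x. x) xs"
  have "sample_var n xs = avg n (\<lambda>x. (x\<^sup>2 - (2 * ?m) * x) + ?m\<^sup>2) xs"
    by (simp add: sample_var_def sample_mean_eq_avg avg_def power2_eq_square algebra_simps)
  also have "\<dots> = avg n (\<lambda>x. x\<^sup>2) xs - (2 * ?m) * ?m + ?m\<^sup>2"
    using assms by (simp only: avg_add avg_diff avg_cmult avg_const)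
  finally show ?thesis by (simp add: power2_eq_square)
qed

text \<open>The expression squared in \<open>G1\<close>: the empirical zero-bias distribution
  function of the scaled residuals minus their empirical distribution function.\<close>

definition dn :: "nat \<Rightarrow> (nat \<Rightarrow> real) \<Rightarrow> real \<Rightarrow> real" where
  "dn n xs t = (\<Sum>j=1..n. scaled_residual n xs j * (scaled_residual n xs j - t)
                 * indicator {..t} (scaled_residual n xs j)) / real n
      - (\<Sum>j=1..n. indicator {..t} (scaled_residual n xs j)) / real n"

text \<open>For \<open>S > 0\<close> the condition \<open>Y <= t\<close> is \<open>x <= u\<close>,
  and \<open>Y * (Y - t) = (x - m) * (x - u) / S^2\<close>. Splitting off
  \<open>- m * (x - u)\<close> leaves averages of kernels indexed by \<open>u\<close> alone; the
  sample enters otherwise only through the scalars \<open>m\<close> and \<open>S\<close>.\<close>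

lemma dn_eq_avg:
  assumes "sample_var n xs > 0"
    and m: "m = avg n (\<lambda>x. x) xs" and S: "S = sqrt (sample_var n xs)" and u: "u = m + S * t"
  shows "dn n xs t = (avg n (\<lambda>x. x * (x - u) * ind u x) xs
           + m * avg n (\<lambda>x. (u - x) * ind u x) xs) / S\<^sup>2 - avg n (ind u) xs"
proof -
  have S0: "S > 0" using assms by simp
  let ?y = "scaled_residual n xs"
  have y: "?y j = (xs j - m) / S" for j
    by (simp add: scaled_residual_def sample_mean_eq_avg m S)
  have i: "indicator {..t} (?y j) = ind u (xs j)" for j
    using S0 by (auto simp: y ind_def u indicator_def field_simps)
  have t: "?y j * (?y j - t) * ind u (xs j) =
      (xs j * (xs j - u) * ind u (xs j) + m * ((u - xs j) * ind u (xs j))) / S\<^sup>2" for j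
    using S0 by (simp add: y u field_simps power2_eq_square)
  have "avg n (\<lambda>x. x * (x - u) * ind u x) xs + m * avg n (\<lambda>x. (u - x) * ind u x) xs
      = avg n (\<lambda>x. x * (x - u) * ind u x + m * ((u - x) * ind u x)) xs"
    by (simp only: avg_add avg_cmult)
  then show ?thesis unfolding dn_def i t avg_def
    by (simp add: sum_divide_distrib mult.commute)
qed

text \<open>The constant depends on the sample, which may even have variance zero. This only serves
  to make the integrals over \<open>t\<close> exist for each sample.\<close>

lemma dn_linear_growth: "\<exists>a. \<forall>t. \<bar>dn n xs t\<bar> \<le> a * (1 + \<bar>t\<bar>)"
proof -
  let ?y = "scaled_residual n xs"
  let ?i = "\<lambda>t j. indicator {..t} (?y j) :: real"
  define a where "a = (\<Sum>j=1..n. (?y j)\<^sup>2 + \<bar>?y j\<bar> + 1) / n"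
  have "\<bar>dn n xs t\<bar> \<le> a * (1 + \<bar>t\<bar>)" for t
  proof -
    have "\<bar>?y j * (?y j - t) * ?i t j - ?i t j\<bar> \<le> ((?y j)\<^sup>2 + \<bar>?y j\<bar> + 1) * (1 + \<bar>t\<bar>)" for j
    proof -
      have "\<bar>?y j * (?y j - t) * ?i t j - ?i t j\<bar> = \<bar>?y j * (?y j - t) - 1\<bar> * ?i t j"
        by (simp add: indicator_def)
      also have "\<dots> \<le> \<bar>?y j * (?y j - t) - 1\<bar>" by (simp add: indicator_def)
      also have "\<dots> \<le> (?y j)\<^sup>2 + \<bar>?y j\<bar> * \<bar>t\<bar> + 1"
      proof -
        have e: "?y j * (?y j - t) = (?y j)\<^sup>2 - ?y j * t" by (simp add: power2_eq_square algebra_simps)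
        show ?thesis unfolding e abs_mult[symmetric] by (smt (verit) zero_le_power2)
      qed
      also have "\<dots> \<le> ((?y j)\<^sup>2 + \<bar>?y j\<bar> + 1) * (1 + \<bar>t\<bar>)"
        by (simp add: algebra_simps)
      finally show ?thesis .
    qed
    then have "\<bar>\<Sum>j=1..n. ?y j * (?y j - t) * ?i t j - ?i t j\<bar>
       \<le> (\<Sum>j=1..n. ((?y j)\<^sup>2 + \<bar>?y j\<bar> + 1) * (1 + \<bar>t\<bar>))"
      by (intro order_trans[OF sum_abs] sum_mono)
    then have "\<bar>(\<Sum>j=1..n. ?y j * (?y j - t) * ?i t j - ?i t j) / n\<bar>
       \<le> (\<Sum>j=1..n. ((?y j)\<^sup>2 + \<bar>?y j\<bar> + 1) * (1 + \<bar>t\<bar>)) / n"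
      unfolding abs_divide by (simp only: abs_of_nat divide_right_mono of_nat_0_le_iff)
    then show ?thesis
      by (simp only: dn_def a_def sum_subtractf diff_divide_distrib sum_distrib_right[symmetric]
        times_divide_eq_left)
  qed
  then show ?thesis by blast
qed

text \<open>Here \<open>m\<close> and \<open>Q\<close> are the first two sample moments, so
  \<open>S\<close> is the sample standard deviation. To first order \<open>S\<close> is
  \<open>1 + (Q - 1) / 2\<close> and \<open>1 / S^2\<close> is \<open>1 - (Q - 1)\<close>; the term
  \<open>m^2\<close> is already of second order. The bound \<open>k <= 1/4\<close> keeps
  \<open>S^2\<close> above \<open>1/2\<close>.\<close>

lemma scale_expansion:
  fixes Q m k S :: real
  assumes k: "0 \<le> k" "k \<le> 1/4" and m: "\<bar>m\<bar> \<le> k" and Q: "\<bar>Q - 1\<bar> \<le> k" and S: "S = sqrt (Q - m\<^sup>2)"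
  shows "Q - m\<^sup>2 > 0" "\<bar>S - 1\<bar> \<le> 2 * k" "\<bar>1 / S\<^sup>2 - 1\<bar> \<le> 4 * k" "\<bar>1 / S\<^sup>2\<bar> \<le> 2"
    "\<bar>S - 1 - (Q - 1) / 2\<bar> \<le> 3 * k\<^sup>2" "\<bar>1 / S\<^sup>2 - 1 - (1 - Q)\<bar> \<le> 9 * k\<^sup>2"
proof -
  define s where "s = Q - m\<^sup>2"
  have m2: "m\<^sup>2 \<le> k\<^sup>2" using m k by (simp add: abs_le_square_iff[symmetric])
  have m20: "0 \<le> m\<^sup>2" by simp
  have kk: "k\<^sup>2 \<le> k / 4" using k mult_left_mono[of k "1/4" k] by (simp add: power2_eq_square)
  have s1: "\<bar>s - 1\<bar> \<le> 2 * k" using Q m2 m20 kk k unfolding s_def abs_le_iff by linarith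
  have s0: "s \<ge> 1/2" using s1 k by linarith
  show "Q - m\<^sup>2 > 0" using s0 by (simp add: s_def)
  have S0: "S \<ge> 0" and Ss: "S\<^sup>2 = s" using s0 by (simp_all add: S s_def[symmetric])
  have fac: "(S - 1) * (S + 1) = s - 1" by (simp add: Ss[symmetric] power2_eq_square algebra_simps)
  have "\<bar>S - 1\<bar> * 1 \<le> \<bar>S - 1\<bar> * \<bar>S + 1\<bar>" by (rule mult_left_mono) (use S0 in auto)
  also have "\<dots> = \<bar>s - 1\<bar>" by (simp add: abs_mult[symmetric] fac)
  finally show S1: "\<bar>S - 1\<bar> \<le> 2 * k" using s1 by simp
  have e1: "1 / s - 1 = (1 - s) / s" using s0 by (simp add: field_simps)
  have "\<bar>1 - s\<bar> / s \<le> \<bar>1 - s\<bar> / (1/2)" by (rule divide_left_mono) (use s0 in auto)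
  then show r1: "\<bar>1 / S\<^sup>2 - 1\<bar> \<le> 4 * k" unfolding Ss e1 using s1 s0 abs_minus_commute[of s 1] by (simp add: abs_divide)
  show "\<bar>1 / S\<^sup>2\<bar> \<le> 2" unfolding Ss using s0 by (simp add: field_simps)
  have sq: "(S - 1)\<^sup>2 \<le> 4 * k\<^sup>2"
  proof -
    have "(S - 1)\<^sup>2 \<le> (2 * k)\<^sup>2" unfolding abs_le_square_iff[symmetric] using S1 k by simp
    then show ?thesis by (simp add: power_mult_distrib)
  qed
  have aux: "\<bar>- (a + b) / 2\<bar> \<le> 3 * c" if "0 \<le> a" "a \<le> 4 * c" "b \<le> c" "0 \<le> b" for a b c :: real
    using that by (simp add: abs_le_iff)
  \<comment> \<open>An exact identity replaces a Taylor remainder: with \<open>Q = S^2 + m^2\<close>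
    the error of the square root is minus half a sum of two squares.\<close>
  have e2: "S - 1 - (Q - 1) / 2 = - ((S - 1)\<^sup>2 + m\<^sup>2) / 2"
  proof -
    have "Q = S\<^sup>2 + m\<^sup>2" by (simp add: Ss s_def)
    then show ?thesis by (simp add: power2_eq_square algebra_simps diff_divide_distrib add_divide_distrib)
  qed
  have "(S - 1)\<^sup>2 \<ge> 0" by simp
  then show "\<bar>S - 1 - (Q - 1) / 2\<bar> \<le> 3 * k\<^sup>2" unfolding e2 using sq m2 m20 by (intro aux)
  have e3: "1 / s - 1 - (1 - Q) = (1 - s)\<^sup>2 / s + m\<^sup>2"
  proof -
    have "Q = s + m\<^sup>2" by (simp add: s_def)
    then show ?thesis using s0 by (simp add: field_simps power2_eq_square)
  qed
  have "(1 - s)\<^sup>2 \<le> (2 * k)\<^sup>2" unfolding abs_le_square_iff[symmetric] using s1 k by simp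
  then have "(1 - s)\<^sup>2 \<le> 4 * k\<^sup>2" by (simp add: power_mult_distrib)
  moreover have "(1 - s)\<^sup>2 / s \<le> (1 - s)\<^sup>2 / (1/2)" by (rule divide_left_mono) (use s0 in auto)
  moreover have "(1 - s)\<^sup>2 / s \<ge> 0" using s0 by simp
  ultimately show "\<bar>1 / S\<^sup>2 - 1 - (1 - Q)\<bar> \<le> 9 * k\<^sup>2" unfolding Ss e3
    using m2 m20 by (simp add: abs_le_iff)
qed

lemma abs_mult_mono: "\<bar>a\<bar> \<le> a' \<Longrightarrow> \<bar>b\<bar> \<le> b' \<Longrightarrow> \<bar>a * b\<bar> \<le> a' * b'" for a b a' b' :: real
  unfolding abs_mult by (rule mult_mono) auto

lemma abs_add_mono: "\<bar>a\<bar> \<le> a' \<Longrightarrow> \<bar>b\<bar> \<le> b' \<Longrightarrow> \<bar>a + b\<bar> \<le> a' + b'" for a b a' b' :: real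
  by linarith

lemma abs_diff_mono: "\<bar>a\<bar> \<le> a' \<Longrightarrow> \<bar>b\<bar> \<le> b' \<Longrightarrow> \<bar>a - b\<bar> \<le> a' + b'" for a b a' b' :: real
  by linarith

text \<open>Pure algebra behind the linearisation. \<open>r\<close> stands for
  \<open>1 / S^2\<close>, \<open>v\<close> for \<open>u - t\<close>, \<open>w\<close> for its linear
  part, \<open>T\<close> for \<open>1 + |t|\<close>; \<open>Bu\<close>, \<open>Iu\<close>,
  \<open>Au\<close> are the empirical means at \<open>u\<close>, \<open>Bt\<close>,
  \<open>It\<close>, \<open>At\<close> those at \<open>t\<close>, and \<open>B\<close>,
  \<open>I\<close>, \<open>A\<close> the expectations at \<open>t\<close>. The slopes of the
  expectations \<open>B\<close> and \<open>A\<close> in \<open>t\<close> are \<open>d\<close> and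
  \<open>p\<close>.\<close>

lemma remainder_bound:
  fixes r Bu Bt B d w v m Iu It I Au At A p Q k T g P Z :: real
  assumes k: "0 \<le> k" "k \<le> 1/4" and T: "1 \<le> T" and P: "0 \<le> P" and g: "0 \<le> g"
    and r: "\<bar>r\<bar> \<le> 2" "\<bar>r - 1\<bar> \<le> 4 * k" "\<bar>r - 1 - (1 - Q)\<bar> \<le> 9 * k\<^sup>2"
    and v: "\<bar>v\<bar> \<le> 2 * k * T" "\<bar>v - w\<bar> \<le> 3 * k\<^sup>2 * T"
    and m: "\<bar>m\<bar> \<le> k" and d: "\<bar>d\<bar> \<le> 1" and B: "\<bar>B\<bar> \<le> T" and I: "\<bar>I\<bar> \<le> T" and p: "\<bar>p\<bar> \<le> P"
    and Bu: "\<bar>Bu - Bt - d * v\<bar> \<le> 2 * k * T * g"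
    and Iu: "\<bar>Iu - It\<bar> \<le> 2 * k * T"
    and Z: "\<bar>Au - At - p * v\<bar> \<le> Z"
  shows "\<bar>(r * (Bu + m * Iu) - Au) - (B - A) - (Bt - Q * B + m * I - At + A + w * (d - p))\<bar>
    \<le> 4 * k * T * (g + \<bar>Bt - B\<bar> + \<bar>It - I\<bar>) + (30 + 3 * P) * k\<^sup>2 * T + Z"
proof -
  let ?b = "\<bar>Bt - B\<bar>" and ?i = "\<bar>It - I\<bar>"
  \<comment> \<open>Ten summands: each is a product of two small quantities, or contains an error
    controlled by \<open>g\<close>, \<open>Z\<close> or a second-order estimate.\<close>
  have e: "(r * (Bu + m * Iu) - Au) - (B - A) - (Bt - Q * B + m * I - At + A + w * (d - p))
    = r * (Bu - Bt - d * v) + (r - 1) * (d * v) + d * (v - w) + (r - 1) * (Bt - B)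
      + (r - 1 - (1 - Q)) * B + ((r - 1) * m) * Iu + m * (Iu - It) + m * (It - I)
      - (Au - At - p * v) - p * (v - w)"
    by (simp add: algebra_simps)
  have kT: "k * T \<le> T / 4" using k T by simp
  have iu: "\<bar>Iu\<bar> \<le> ?i + 2 * T" using Iu I kT T by linarith
  have 1: "\<bar>r * (Bu - Bt - d * v)\<bar> \<le> 2 * (2 * k * T * g)" by (rule abs_mult_mono[OF r(1) Bu])
  have 2: "\<bar>(r - 1) * (d * v)\<bar> \<le> (4 * k) * (1 * (2 * k * T))"
    by (intro abs_mult_mono r d v)
  have 3: "\<bar>d * (v - w)\<bar> \<le> 1 * (3 * k\<^sup>2 * T)" by (intro abs_mult_mono r d v)
  have 4: "\<bar>(r - 1) * (Bt - B)\<bar> \<le> (4 * k) * ?b" by (intro abs_mult_mono r order_refl)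
  have 5: "\<bar>(r - 1 - (1 - Q)) * B\<bar> \<le> (9 * k\<^sup>2) * T" by (intro abs_mult_mono r B)
  have 6: "\<bar>((r - 1) * m) * Iu\<bar> \<le> (4 * k * k) * (?i + 2 * T)" by (intro abs_mult_mono r m iu)
  have 7: "\<bar>m * (Iu - It)\<bar> \<le> k * (2 * k * T)" by (intro abs_mult_mono m Iu)
  have 8: "\<bar>m * (It - I)\<bar> \<le> k * ?i" by (intro abs_mult_mono m order_refl)
  have 9: "\<bar>p * (v - w)\<bar> \<le> P * (3 * k\<^sup>2 * T)" by (intro abs_mult_mono p v)
  have a: "(4 * k * k) * ?i \<le> k * ?i"
    by (rule mult_right_mono) (use k mult_left_mono[of k "1/4" k] in auto)
  have ki: "k * ?i \<le> k * T * ?i" and kb: "k * ?b \<le> k * T * ?b" and i0: "0 \<le> k * T * ?i"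
    using k T g mult_left_mono[of 1 T k] by (auto intro!: mult_right_mono)
  have tri: "\<bar>(r * (Bu + m * Iu) - Au) - (B - A) - (Bt - Q * B + m * I - At + A + w * (d - p))\<bar>
    \<le> 2 * (2 * k * T * g) + (4 * k) * (1 * (2 * k * T)) + 1 * (3 * k\<^sup>2 * T) + (4 * k) * ?b
      + (9 * k\<^sup>2) * T + (4 * k * k) * (?i + 2 * T) + k * (2 * k * T) + k * ?i + Z
      + P * (3 * k\<^sup>2 * T)"
    unfolding e by (intro abs_add_mono abs_diff_mono 1 2 3 4 5 6 7 8 9 Z)
  \<comment> \<open>The constant is \<open>30 = 8 + 3 + 9 + 8 + 2\<close>, from the facts
    \<open>2\<close>, \<open>3\<close>, \<open>5\<close>, \<open>6\<close>, \<open>7\<close>; the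
    part \<open>3 * P\<close> comes from \<open>9\<close>.\<close>
  also have "\<dots> = 4 * (k * T * g) + 4 * (k * ?b) + (4 * k * k) * ?i + k * ?i
      + (30 + 3 * P) * k\<^sup>2 * T + Z"
    by (simp add: algebra_simps power2_eq_square)
  also have "\<dots> \<le> 4 * (k * T * g) + 4 * (k * T * ?b) + 4 * (k * T * ?i)
      + (30 + 3 * P) * k\<^sup>2 * T + Z"
    using a ki kb i0 by linarith
  also have "\<dots> = 4 * k * T * (g + ?b + ?i) + (30 + 3 * P) * k\<^sup>2 * T + Z"
    by (simp add: algebra_simps)
  finally show ?thesis .
qed

text \<open>Monotonicity turns the oscillation of \<open>f - F\<close> over an interval into its increments at finitely
  many non-random points, up to the oscillation of \<open>F\<close> between neighbouring points.\<close>

lemma grid_oscillation: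
  fixes f F :: "real \<Rightarrow> real"
  assumes f: "mono f" and F: "\<And>a b. a \<le> b \<Longrightarrow> \<bar>F b - F a\<bar> \<le> P * (b - a)"
    and u: "\<bar>u - t\<bar> \<le> h" and N: "N > 0" and P: "P \<ge> 0"
  defines "g \<equiv> \<lambda>i. t + (2 * real i / real N - 1) * h"
  shows "\<bar>(f u - F u) - (f t - F t)\<bar>
    \<le> (\<Sum>i\<le>N. \<bar>(f (g i) - F (g i)) - (f t - F t)\<bar>) + P * (2 * h / real N)"
proof (cases "h > 0")
  case False
  then have "u = t" "h = 0" using u by auto
  then show ?thesis by (simp add: sum_nonneg)
next
  case h: True
  let ?e = "\<lambda>x. (f x - F x) - (f t - F t)"
  \<comment> \<open>The position of \<open>u\<close> in the window, measured in grid cells from the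
    left end.\<close>
  define z where "z = (u - t + h) * N / (2 * h)"
  have z0: "0 \<le> z" using u h by (auto simp: z_def abs_le_iff)
  have "(u - t + h) * N \<le> (2 * h) * N" by (rule mult_right_mono) (use u in auto)
  then have zN: "z \<le> N" using h by (simp add: z_def divide_le_eq mult.commute)
  \<comment> \<open>The cell is the floor of \<open>z\<close>, except when \<open>u\<close> is the
    right end of the window: the floor would be \<open>N\<close>, which starts no cell, and the last
    cell \<open>N - 1\<close> is taken.\<close>
  obtain i where i: "i < N" "real i \<le> z" "z \<le> real (i + 1)"
  proof (cases "z = N")
    case True
    show ?thesis by (rule that[of "N - 1"]) (use N True in auto)
  next
    case False
    have "z < N" using False zN by simp
    show ?thesis
      by (rule that[of "nat \<lfloor>z\<rfloor>"]) (use z0 \<open>z < N\<close> in linarith)+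
  qed
  have gi: "g j = t - h + 2 * h / N * real j" for j by (simp add: g_def algebra_simps)
  have u': "u = t - h + 2 * h / N * z" using h N by (simp add: z_def field_simps)
  have c: "2 * h / N \<ge> 0" using h by simp
  have lo: "g i \<le> u" and hi: "u \<le> g (i + 1)"
    unfolding gi u' using mult_left_mono[OF i(2) c] mult_left_mono[OF i(3) c] by linarith+
  have gap: "g (i + 1) - g i = 2 * h / N" by (simp add: gi algebra_simps add_divide_distrib)
  have "\<bar>F (g (i + 1)) - F u\<bar> \<le> P * (g (i + 1) - u)" by (rule F[OF hi])
  also have "\<dots> \<le> P * (2 * h / N)" by (rule mult_left_mono) (use lo gap P in auto)
  finally have F1: "\<bar>F (g (i + 1)) - F u\<bar> \<le> P * (2 * h / N)" .
  have "\<bar>F u - F (g i)\<bar> \<le> P * (u - g i)" by (rule F[OF lo])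
  also have "\<dots> \<le> P * (2 * h / N)" by (rule mult_left_mono) (use hi gap P in auto)
  finally have F2: "\<bar>F u - F (g i)\<bar> \<le> P * (2 * h / N)" .
  have f1: "f u \<le> f (g (i + 1))" and f2: "f (g i) \<le> f u" using f lo hi by (auto dest: monoD)
  have le: "\<bar>?e (g j)\<bar> \<le> (\<Sum>i\<le>N. \<bar>?e (g i)\<bar>)" if "j \<le> N" for j
    by (rule member_le_sum) (use that in auto)
  have le1: "?e (g (i + 1)) \<le> (\<Sum>i\<le>N. \<bar>?e (g i)\<bar>)"
    by (rule order_trans[OF abs_ge_self le]) (use i(1) in simp)
  have le2: "- ?e (g i) \<le> (\<Sum>i\<le>N. \<bar>?e (g i)\<bar>)"
    by (rule order_trans[OF abs_ge_minus_self le]) (use i(1) in simp)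
  show ?thesis
  proof (rule abs_leI)
    \<comment> \<open>From above, \<open>f u\<close> is compared with the right end of the cell,
      from below with the left end; \<open>F\<close> changes by at most one mesh width times
      \<open>P\<close>.\<close>
    have "?e u \<le> ?e (g (i + 1)) + P * (2 * h / N)" using abs_le_D1[OF F1] f1 by linarith
    then show "?e u \<le> (\<Sum>i\<le>N. \<bar>?e (g i)\<bar>) + P * (2 * h / N)"
      by (rule order_trans) (intro add_right_mono le1)
    have "- ?e u \<le> - ?e (g i) + P * (2 * h / N)" using abs_le_D1[OF F2] f2 by linarith
    then show "- ?e u \<le> (\<Sum>i\<le>N. \<bar>?e (g i)\<bar>) + P * (2 * h / N)"
      by (rule order_trans) (intro add_right_mono le2)
  qed
qed

text \<open>The kernel \<open>x (x - t) 1{x \<le> t}\<close> is continuous in \<open>t\<close>, with derivative \<open>- x 1{x \<le> t}\<close> except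
  at \<open>t = x\<close>.\<close>

lemma zb_kernel_expansion:
  assumes "\<bar>u - t\<bar> \<le> h"
  shows "\<bar>x * (x - u) * ind u x - x * (x - t) * ind t x + (u - t) * (x * ind t x)\<bar>
    \<le> h * (\<bar>x\<bar> * (if \<bar>x - t\<bar> \<le> h then 1 else 0))"
proof (cases "(x \<le> u) = (x \<le> t)")
  case True
  then have "x * (x - u) * ind u x - x * (x - t) * ind t x + (u - t) * (x * ind t x) = 0"
    by (auto simp: ind_def algebra_simps)
  then show ?thesis using assms by auto
next
  case False
  \<comment> \<open>The point \<open>x\<close> lies between \<open>t\<close> and \<open>u\<close>,
    so it is within \<open>h\<close> of both, and the expression collapses to
    \<open>x * (x - u)\<close> up to sign.\<close>
  then have *: "\<bar>x - t\<bar> \<le> h" "\<bar>x - u\<bar> \<le> h" using assms by auto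
  have "x * (x - u) * ind u x - x * (x - t) * ind t x + (u - t) * (x * ind t x)
    = x * (x - u) \<or> x * (x - u) * ind u x - x * (x - t) * ind t x + (u - t) * (x * ind t x)
    = x * (u - x)"
    using False by (auto simp: ind_def algebra_simps)
  then show ?thesis using * by (auto simp: abs_mult mult.commute[of h] abs_minus_commute intro!: mult_left_mono)
qed

lemma abs_tent_diff_le: "\<bar>(u - x) * ind u x - (t - x) * ind t x\<bar> \<le> \<bar>u - t\<bar>"
  by (auto simp: ind_def)

section \<open>Second moments of centred empirical means\<close>

lemma abs_integral_le:
  fixes f g :: "'a \<Rightarrow> real"
  assumes g: "integrable M g" and f [measurable]: "f \<in> borel_measurable M" and fg: "\<And>x. \<bar>f x\<bar> \<le> g x"
  shows "\<bar>integral\<^sup>L M f\<bar> \<le> integral\<^sup>L M g"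
proof -
  have "integrable M f"
    by (rule Bochner_Integration.integrable_bound[OF g f])
      (auto intro: order_trans[OF fg abs_ge_self])
  then have "integral\<^sup>L M (\<lambda>x. \<bar>f x\<bar>) \<le> integral\<^sup>L M g"
    by (intro integral_mono g fg) auto
  then show ?thesis using integral_abs_bound[of M f] by linarith
qed

text \<open>\<open>X\<close> only carries the common law and may itself be one of the
  \<open>Xs\<close>. Averages run over the indices \<open>1..n\<close>, so \<open>Xs 0\<close> never
  enters one.\<close>

locale iid_sample = prob_space M for M :: "'a measure" +
  fixes X :: "'a \<Rightarrow> real" and Xs :: "nat \<Rightarrow> 'a \<Rightarrow> real"
  assumes X_rv [measurable]: "random_variable borel X"
    and indep: "indep_vars (\<lambda>_. borel) Xs UNIV"
    and ident: "\<And>k. distr M borel (Xs k) = distr M borel X"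
begin

definition dev :: "nat \<Rightarrow> (real \<Rightarrow> real) \<Rightarrow> (nat \<Rightarrow> real) \<Rightarrow> real" where
  "dev n f xs = avg n f xs - expectation (\<lambda>x. f (X x))"

lemma Xs_rv [measurable]: "random_variable borel (Xs k)"
  using indep unfolding indep_vars_def by simp

lemma integrable_sample_iff:
  fixes f :: "real \<Rightarrow> real"
  assumes "f \<in> borel_measurable borel"
  shows "integrable M (\<lambda>x. f (Xs k x)) \<longleftrightarrow> integrable M (\<lambda>x. f (X x))"
  using assms integrable_distr_eq[of "Xs k" M borel f] integrable_distr_eq[of X M borel f]
  by (simp add: ident)

lemma expectation_sample:
  fixes f :: "real \<Rightarrow> real"
  assumes "f \<in> borel_measurable borel"
  shows "expectation (\<lambda>x. f (Xs k x)) = expectation (\<lambda>x. f (X x))"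
  using assms integral_distr[of "Xs k" M borel f] integral_distr[of X M borel f]
  by (simp add: ident)

text \<open>Independence and centring kill the off-diagonal products; the diagonal leaves the
  variance of \<open>f (X x)\<close> divided by \<open>n\<close>. The variance is enlarged to the
  raw second moment, for which bounds explicit in \<open>t\<close> are at hand.\<close>

lemma dev_second_moment:
  assumes [measurable]: "f \<in> borel_measurable borel"
    and sq: "integrable M (\<lambda>x. (f (X x))\<^sup>2)" and n: "n > 0"
  shows "integrable M (\<lambda>x. (dev n f (\<lambda>k. Xs k x))\<^sup>2)"
    and "expectation (\<lambda>x. (dev n f (\<lambda>k. Xs k x))\<^sup>2) \<le> expectation (\<lambda>x. (f (X x))\<^sup>2) / n"
proof -
  define m where "m = expectation (\<lambda>x. f (X x))"
  define g where "g k x = f (Xs k x) - m" for k x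
  have fi: "integrable M (\<lambda>x. f (X x))" by (rule square_integrable_imp_integrable[OF _ sq]) simp
  have gi: "integrable M (g k)" for k
    unfolding g_def using fi by (auto simp: integrable_sample_iff)
  have g0: "expectation (g k) = 0" for k
    unfolding g_def using fi expectation_sample[of f k]
    by (simp add: integrable_sample_iff prob_space m_def)
  have gv: "expectation (\<lambda>x. (g k x)\<^sup>2) = expectation (\<lambda>x. (f (X x) - m)\<^sup>2)" for k
    unfolding g_def by (rule expectation_sample[of "\<lambda>y. (f y - m)\<^sup>2"]) simp
  have gs: "integrable M (\<lambda>x. (g k x)\<^sup>2)" for k
    unfolding g_def using integrable_sample_iff[of "\<lambda>y. (f y - m)\<^sup>2" k] fi sq
    by (simp add: power2_diff)
  have ind: "indep_vars (\<lambda>_. borel) g UNIV"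
    unfolding g_def by (rule indep_vars_compose2[OF indep, where Y="\<lambda>_ y. f y - m"]) simp
  have cross: "integrable M (\<lambda>x. g i x * g j x) \<and>
      expectation (\<lambda>x. g i x * g j x) = (if i = j then expectation (\<lambda>x. (f (X x) - m)\<^sup>2) else 0)" for i j
  proof (cases "i = j")
    case True
    then show ?thesis using gs[of j] gv[of j] by (simp add: power2_eq_square)
  next
    case False
    have iv: "indep_vars (\<lambda>_. borel) g {i, j}" by (rule indep_vars_subset[OF ind]) simp
    show ?thesis
      using indep_vars_integrable[OF _ iv gi] indep_vars_lebesgue_integral[OF _ iv gi] g0 False by simp
  qed
  have dev: "(dev n f (\<lambda>k. Xs k x))\<^sup>2 = (\<Sum>i=1..n. \<Sum>j=1..n. g i x * g j x) / n\<^sup>2" for x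
  proof -
    have "dev n f (\<lambda>k. Xs k x) = (\<Sum>i=1..n. g i x) / n"
      using n by (simp add: dev_def avg_def g_def m_def sum_subtractf field_simps)
    then show ?thesis by (simp add: power_divide power2_eq_square[of "sum _ _"] sum_product)
  qed
  show "integrable M (\<lambda>x. (dev n f (\<lambda>k. Xs k x))\<^sup>2)"
    unfolding dev using cross by (intro integrable_divide_zero Bochner_Integration.integrable_sum) auto
  have "expectation (\<lambda>x. (dev n f (\<lambda>k. Xs k x))\<^sup>2)
     = (\<Sum>i=1..n. \<Sum>j=1..n. if i = j then expectation (\<lambda>x. (f (X x) - m)\<^sup>2) else 0) / n\<^sup>2"
    unfolding dev using cross
    by (simp add: Bochner_Integration.integral_sum)
  also have "\<dots> = expectation (\<lambda>x. (f (X x) - m)\<^sup>2) / n"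
    using n by (simp add: sum.delta power2_eq_square[of "real n"])
  also have "expectation (\<lambda>x. (f (X x) - m)\<^sup>2) = expectation (\<lambda>x. (f (X x))\<^sup>2) - m\<^sup>2"
    unfolding m_def by (rule variance_eq[OF fi sq])
  also have "\<dots> / n \<le> expectation (\<lambda>x. (f (X x))\<^sup>2) / n"
    by (rule divide_right_mono) auto
  finally show "expectation (\<lambda>x. (dev n f (\<lambda>k. Xs k x))\<^sup>2) \<le> expectation (\<lambda>x. (f (X x))\<^sup>2) / n" .
qed

lemma nn_dev_second_moment:
  assumes [measurable]: "f \<in> borel_measurable borel"
    and sq: "integrable M (\<lambda>x. (f (X x))\<^sup>2)" and n: "n > 0"
    and c: "expectation (\<lambda>x. (f (X x))\<^sup>2) \<le> c"
  shows "(\<integral>\<^sup>+x. ennreal ((dev n f (\<lambda>k. Xs k x))\<^sup>2) \<partial>M) \<le> ennreal (c / n)"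
proof -
  have "(\<integral>\<^sup>+x. ennreal ((dev n f (\<lambda>k. Xs k x))\<^sup>2) \<partial>M) = ennreal (expectation (\<lambda>x. (dev n f (\<lambda>k. Xs k x))\<^sup>2))"
    by (rule nn_integral_eq_integral) (use dev_second_moment[OF assms(1-3)] in auto)
  also have "\<dots> \<le> ennreal (c / n)"
    by (intro ennreal_leI order_trans[OF dev_second_moment(2)[OF assms(1-3)]] divide_right_mono c) simp
  finally show ?thesis .
qed

lemma dev_measurable [measurable]:
  assumes [measurable]: "(\<lambda>(t, y). f t y) \<in> borel_measurable (N \<Otimes>\<^sub>M borel)"
  shows "(\<lambda>(x, t). dev n (f t) (\<lambda>k. Xs k x)) \<in> borel_measurable (M \<Otimes>\<^sub>M N)"
proof -
  have "(\<lambda>t. expectation (\<lambda>x. f t (X x))) \<in> borel_measurable N"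
    by (rule borel_measurable_lebesgue_integral) measurable
  then show ?thesis unfolding dev_def avg_def by measurable
qed

end

text \<open>The measure \<open>\<nu>\<close> plays the role of \<open>\<omega>(t) dt\<close>.\<close>

locale zero_bias_sample = iid_sample M X Xs for M :: "'a measure" and X Xs +
  fixes p :: "real \<Rightarrow> real" and P K1 K2 :: real and \<nu> :: "real measure"
  assumes density: "distributed M lborel X p"
    and p_nonneg: "\<And>s. 0 \<le> p s" and p_meas [measurable]: "p \<in> borel_measurable borel"
    and p_le: "\<And>s. p s \<le> P" and sp_le: "\<And>s. \<bar>s * p s\<bar> \<le> K1"
    and p_lipschitz: "\<And>s t. \<bar>p s - p t\<bar> \<le> K2 * \<bar>s - t\<bar>"
    and X_mean: "expectation X = 0" and X_sq: "expectation (\<lambda>x. (X x)\<^sup>2) = 1"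
    and X4_int: "integrable M (\<lambda>x. (X x) ^ 4)"
    and \<nu>_finite: "finite_measure \<nu>" and sets_\<nu> [measurable_cong]: "sets \<nu> = sets borel"
    and \<nu>_int: "integrable \<nu> (\<lambda>t. t ^ 4)"
begin

section \<open>Moments, density bounds and expansions of the population functions\<close>

lemma X2_int: "integrable M (\<lambda>x. (X x)\<^sup>2)"
  by (rule square_integrable_imp_integrable) (use X4_int in auto)

lemma X_int: "integrable M X"
  by (rule square_integrable_imp_integrable) (use X2_int in auto)

lemma integrable_quadratic_growth:
  assumes [measurable]: "f \<in> borel_measurable borel" and "\<And>y. \<bar>f y\<bar> \<le> a * (1 + y\<^sup>2)"
  shows "integrable M (\<lambda>x. f (X x))"
proof (rule Bochner_Integration.integrable_bound)
  show "integrable M (\<lambda>x. a * (1 + (X x)\<^sup>2))" using X2_int by simp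
  show "AE x in M. norm (f (X x)) \<le> norm (a * (1 + (X x)\<^sup>2))"
    using assms(2) by (intro always_eventually allI) (auto intro: order_trans[OF _ abs_ge_self])
qed simp

text \<open>Squaring quadratic growth gives exactly the order four of the available moment. All
  kernels of the argument, for fixed \<open>t\<close>, are in this class.\<close>

lemma square_integrable_quadratic_growth:
  assumes [measurable]: "f \<in> borel_measurable borel" and f: "\<And>y. \<bar>f y\<bar> \<le> a * (1 + y\<^sup>2)"
  shows "integrable M (\<lambda>x. (f (X x))\<^sup>2)"
proof (rule Bochner_Integration.integrable_bound)
  show "integrable M (\<lambda>x. a\<^sup>2 * (1 + 2 * (X x)\<^sup>2 + (X x) ^ 4))" using X2_int X4_int by simp
  have "(f y)\<^sup>2 \<le> a\<^sup>2 * (1 + 2 * y\<^sup>2 + y ^ 4)" for y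
  proof -
    have "(f y)\<^sup>2 \<le> (a * (1 + y\<^sup>2))\<^sup>2"
      using power_mono[OF f[of y] abs_ge_zero, of 2] by simp
    also have "\<dots> = a\<^sup>2 * (1 + 2 * y\<^sup>2 + y ^ 4)"
      by (simp add: power_mult_distrib power2_sum power_mult[symmetric])
    finally show ?thesis .
  qed
  then show "AE x in M. norm ((f (X x))\<^sup>2) \<le> norm (a\<^sup>2 * (1 + 2 * (X x)\<^sup>2 + (X x) ^ 4))"
    by (intro always_eventually allI) (simp add: order_trans[OF _ abs_ge_self])
qed simp

lemma expectation_density:
  fixes f :: "real \<Rightarrow> real"
  assumes "f \<in> borel_measurable borel"
  shows "expectation (\<lambda>x. f (X x)) = (LBINT s. p s * f s)"
  using distributed_integral[OF density] assms p_nonneg by simp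

lemma P_nonneg: "0 \<le> P" using p_nonneg[of 0] p_le[of 0] by simp

text \<open>\<open>Fm\<close> is $F$, \<open>Bm\<close> is $F^X$, and \<open>Dm\<close> below is $F^X - F$.\<close>

definition Fm :: "real \<Rightarrow> real" where "Fm t = expectation (\<lambda>x. ind t (X x))"
definition Bm :: "real \<Rightarrow> real" where "Bm t = expectation (\<lambda>x. X x * (X x - t) * ind t (X x))"
text \<open>The mean of the positive part of \<open>t - X\<close>; up to sign it is the coefficient
  of the linear term \<open>X\<close> in \<open>C1\<close>.\<close>

definition Im :: "real \<Rightarrow> real" where "Im t = expectation (\<lambda>x. (t - X x) * ind t (X x))"

text \<open>The bound is on \<open>p * f\<close> rather than on \<open>p\<close>: with
  \<open>f\<close> an indicator increment \<open>c\<close> is \<open>P\<close>, and with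
  \<open>f\<close> of size \<open>|y|\<close> it is \<open>K1\<close>, so windows far from the
  origin cost nothing extra.\<close>

lemma density_mass_le:
  assumes [measurable]: "f \<in> borel_measurable borel" "A \<in> sets borel"
    and f: "\<And>s. \<bar>p s * f s\<bar> \<le> c * indicator {a..b} s" and ab: "a \<le> b"
  shows "\<bar>expectation (\<lambda>x. f (X x))\<bar> \<le> c * (b - a)"
proof -
  have i: "integrable lborel (\<lambda>s. c * indicator {a..b} s)"
    by (intro integrable_mult_right integrable_real_indicator) (auto simp: emeasure_lborel_Icc_eq)
  have "\<bar>expectation (\<lambda>x. f (X x))\<bar> = \<bar>LBINT s. p s * f s\<bar>" by (simp add: expectation_density)
  also have "\<dots> \<le> (LBINT s. c * indicator {a..b} s)"
    by (rule abs_integral_le[OF i _ f]) simp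
  also have "\<dots> = c * (b - a)" using ab by simp
  finally show ?thesis .
qed

text \<open>An indicator increment over distance \<open>h\<close> has second moment of order
  \<open>h\<close>, not \<open>h^2\<close>. This smallness has to pay for the sum over the grid
  points.\<close>

lemma expectation_ind_diff_le:
  assumes "\<bar>s - t\<bar> \<le> h"
  shows "expectation (\<lambda>x. (ind s (X x) - ind t (X x))\<^sup>2) \<le> P * h"
proof -
  have "\<bar>p y * (ind s y - ind t y)\<^sup>2\<bar> \<le> P * indicator {min s t..max s t} y" for y
    using p_nonneg[of y] p_le[of y] by (auto simp: ind_def indicator_def)
  then have "\<bar>expectation (\<lambda>x. (ind s (X x) - ind t (X x))\<^sup>2)\<bar> \<le> P * (max s t - min s t)"
    by (intro density_mass_le[of "\<lambda>y. (ind s y - ind t y)\<^sup>2"]) auto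
  also have "\<dots> \<le> P * h" using assms P_nonneg by (intro mult_left_mono) auto
  finally show ?thesis by simp
qed

lemma ind_int: "integrable M (\<lambda>x. ind t (X x))"
  by (rule integrable_const_bound[of _ 1]) (auto simp: ind_def)

lemma Fm_lipschitz:
  assumes "a \<le> b"
  shows "\<bar>Fm b - Fm a\<bar> \<le> P * (b - a)"
proof -
  have "\<bar>p y * (ind b y - ind a y)\<bar> \<le> P * indicator {a..b} y" for y
    using p_nonneg[of y] p_le[of y] assms by (auto simp: ind_def indicator_def)
  then have "\<bar>expectation (\<lambda>x. ind b (X x) - ind a (X x))\<bar> \<le> P * (b - a)"
    by (intro density_mass_le[of "\<lambda>y. ind b y - ind a y"]) (use assms in auto)
  then show ?thesis by (simp add: Fm_def ind_int)
qed

text \<open>The error is the integral of \<open>p s - p t\<close> over the interval between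
  \<open>t\<close> and \<open>u\<close>, where the Lipschitz condition bounds the integrand by
  \<open>K2\<close> times the length.\<close>

lemma Fm_expansion: "\<bar>Fm u - Fm t - p t * (u - t)\<bar> \<le> K2 * (u - t)\<^sup>2"
proof -
  \<comment> \<open>The base point \<open>c\<close> may be either endpoint, since \<open>u\<close>
    can lie on either side of \<open>t\<close>.\<close>
  have main: "\<bar>Fm b - Fm a - p c * (b - a)\<bar> \<le> K2 * (b - a)\<^sup>2"
    if ab: "a \<le> b" and c: "c = a \<or> c = b" for a b c
  proof -
    have K2: "K2 \<ge> 0" using p_lipschitz[of 1 0] by simp
    have pi: "integrable lborel p"
    proof -
      have "prob_space (density lborel (\<lambda>s. ennreal (p s)))"
        unfolding distributed_distr_eq_density[OF density, symmetric] by (rule prob_space_distr) simp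
      then have "emeasure (density lborel (\<lambda>s. ennreal (p s))) UNIV = 1"
        using prob_space.emeasure_space_1 by fastforce
      then have "(\<integral>\<^sup>+s. ennreal (p s) \<partial>lborel) = 1" by (simp add: emeasure_density)
      then show ?thesis using p_nonneg by (intro integrableI_nonneg) auto
    qed
    have "Fm b - Fm a = expectation (\<lambda>x. indicator {a<..b} (X x))"
    proof -
      have "indicator {a<..b} y = ind b y - ind a y" for y
        using ab by (auto simp: ind_def indicator_def)
      then show ?thesis by (simp add: Fm_def ind_int)
    qed
    also have "\<dots> = (LBINT s. p s * indicator {a<..b} s)" by (simp add: expectation_density)
    finally have F: "Fm b - Fm a = (LBINT s. p s * indicator {a<..b} s)" .
    have i1: "integrable lborel (\<lambda>s. p s * indicator {a<..b} s)"
      by (rule integrable_real_mult_indicator) (use pi in auto)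
    have i0: "integrable lborel (indicator {a<..b} :: real \<Rightarrow> real)"
      by (intro integrable_real_indicator) (auto simp: emeasure_lborel_Ioc ab)
    then have i2: "integrable lborel (\<lambda>s. p c * indicator {a<..b} s)" by simp
    have "(LBINT s. p c * indicator {a<..b} s) = p c * (b - a)" using ab by simp
    then have "Fm b - Fm a - p c * (b - a) = (LBINT s. p s * indicator {a<..b} s - p c * indicator {a<..b} s)"
      unfolding F using i1 i2 ab by simp
    also have "\<bar>\<dots>\<bar> \<le> (LBINT s. K2 * (b - a) * indicator {a<..b} s)"
    proof (rule abs_integral_le)
      show "integrable lborel (\<lambda>s. K2 * (b - a) * indicator {a<..b} s)" using i0 by simp
      fix s :: real
      have "s \<in> {a<..b} \<Longrightarrow> \<bar>p s - p c\<bar> \<le> K2 * (b - a)"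
        by (rule order_trans[OF p_lipschitz]) (use c K2 in \<open>auto intro!: mult_left_mono\<close>)
      then show "\<bar>p s * indicator {a<..b} s - p c * indicator {a<..b} s\<bar> \<le> K2 * (b - a) * indicator {a<..b} s"
        by (auto simp: indicator_def)
    qed simp
    also have "\<dots> = K2 * (b - a)\<^sup>2" using ab by (simp add: power2_eq_square)
    finally show ?thesis .
  qed
  show ?thesis
  proof (cases "t \<le> u")
    case True
    then show ?thesis using main[of t u t] by simp
  next
    case False
    then have "\<bar>Fm t - Fm u - p t * (t - u)\<bar> \<le> K2 * (t - u)\<^sup>2" using main[of u t t] by simp
    then show ?thesis by (simp add: power2_commute[of t u] algebra_simps abs_if split: if_splits)
  qed
qed

text \<open>The bound on \<open>s * p s\<close> makes this uniform in \<open>t\<close>, although the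
  kernel is of size \<open>|t|\<close> on the window.\<close>

lemma expectation_window_le:
  assumes "0 \<le> h"
  shows "expectation (\<lambda>x. \<bar>X x\<bar> * (if \<bar>X x - t\<bar> \<le> h then 1 else 0)) \<le> 2 * h * K1"
proof -
  have "\<bar>p y * (\<bar>y\<bar> * (if \<bar>y - t\<bar> \<le> h then 1 else 0))\<bar> \<le> K1 * indicator {t-h..t+h} y" for y
    using sp_le[of y] by (auto simp: indicator_def abs_mult mult.commute)
  then have "\<bar>expectation (\<lambda>x. \<bar>X x\<bar> * (if \<bar>X x - t\<bar> \<le> h then 1 else 0))\<bar> \<le> K1 * ((t+h) - (t-h))"
    by (intro density_mass_le[of "\<lambda>y. \<bar>y\<bar> * (if \<bar>y - t\<bar> \<le> h then 1 else 0)"]) (use assms in auto)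
  then show ?thesis by (simp add: mult.commute)
qed

lemma abs_moment_le: "expectation (\<lambda>x. \<bar>X x\<bar>) \<le> 1"
proof -
  have "expectation (\<lambda>x. \<bar>X x\<bar>) \<le> expectation (\<lambda>x. (1 + (X x)\<^sup>2) / 2)"
  proof (rule integral_mono)
    fix x
    have "0 \<le> (\<bar>X x\<bar> - 1)\<^sup>2" by simp
    then show "\<bar>X x\<bar> \<le> (1 + (X x)\<^sup>2) / 2" by (simp add: power2_diff)
  qed (use X_int X2_int in auto)
  then show ?thesis using X2_int by (simp add: X_sq prob_space)
qed

text \<open>Mean zero turns the upper tail into the lower one. In this form it is the mean of
  \<open>- x * ind t x\<close>, the derivative in \<open>t\<close> of the zero-bias kernel.\<close>

lemma zb_density_eq: "zb_density M X t = - expectation (\<lambda>x. X x * ind t (X x))"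
proof -
  have i: "integrable M (\<lambda>x. X x * ind t (X x))"
    by (rule Bochner_Integration.integrable_bound[OF X_int]) (auto simp: ind_def)
  have "zb_density M X t = expectation (\<lambda>x. X x - X x * ind t (X x))"
    unfolding zb_density_def by (rule Bochner_Integration.integral_cong) (auto simp: ind_def indicator_def)
  then show ?thesis using i X_int by (simp add: X_mean)
qed

lemma zb_density_le: "\<bar>zb_density M X t\<bar> \<le> 1"
proof -
  have "\<bar>zb_density M X t\<bar> \<le> expectation (\<lambda>x. \<bar>X x\<bar>)"
    unfolding zb_density_def
    by (rule abs_integral_le) (use X_int in \<open>auto simp: indicator_def\<close>)
  then show ?thesis using abs_moment_le by simp
qed

lemma zb_cdf_eq: "zb_cdf M X t = Bm t"
  by (simp add: zb_cdf_def Bm_def indicator_atMost_eq_ind)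

lemma cdf_eq: "cdf (distr M borel X) t = Fm t"
proof -
  have "cdf (distr M borel X) t = expectation (\<lambda>x. indicator {..t} (X x))"
    unfolding cdf_def by (subst measure_distr) (auto simp: indicator_vimage[symmetric] simp flip: indicator_vimage)
  then show ?thesis by (simp add: Fm_def indicator_atMost_eq_ind)
qed

lemma zb_kernel_growth: "\<bar>y * (y - t) * ind t y\<bar> \<le> (2 + \<bar>t\<bar>) * (1 + y\<^sup>2)"
proof -
  have "0 \<le> (\<bar>y\<bar> - 1)\<^sup>2" by simp
  then have y: "\<bar>y\<bar> \<le> 1 + y\<^sup>2" unfolding power2_diff by simp
  have "\<bar>y * (y - t) * ind t y\<bar> \<le> \<bar>y\<bar> * \<bar>y - t\<bar>" by (auto simp: ind_def abs_mult)
  also have "\<dots> \<le> \<bar>y\<bar> * (\<bar>y\<bar> + \<bar>t\<bar>)" by (intro mult_left_mono) auto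
  also have "\<dots> = y\<^sup>2 + \<bar>t\<bar> * \<bar>y\<bar>" by (simp add: power2_eq_square algebra_simps)
  also have "\<dots> \<le> y\<^sup>2 + \<bar>t\<bar> * (1 + y\<^sup>2)" using y by (intro add_left_mono mult_left_mono) auto
  also have "\<dots> \<le> (2 + \<bar>t\<bar>) * (1 + y\<^sup>2)" by (simp add: algebra_simps)
  finally show ?thesis .
qed

lemma zb_kernel_int: "integrable M (\<lambda>x. X x * (X x - t) * ind t (X x))"
  by (rule integrable_quadratic_growth[of "\<lambda>y. y * (y - t) * ind t y", OF _ zb_kernel_growth]) simp

lemma Bm_le: "\<bar>Bm t\<bar> \<le> 1 + \<bar>t\<bar>"
proof -
  have "\<bar>Bm t\<bar> \<le> expectation (\<lambda>x. (X x)\<^sup>2 + \<bar>t\<bar> * \<bar>X x\<bar>)"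
    unfolding Bm_def
  proof (rule abs_integral_le)
    fix x
    have "\<bar>X x * (X x - t) * ind t (X x)\<bar> \<le> \<bar>X x\<bar> * \<bar>X x - t\<bar>" by (auto simp: ind_def abs_mult)
    also have "\<dots> \<le> \<bar>X x\<bar> * (\<bar>X x\<bar> + \<bar>t\<bar>)" by (intro mult_left_mono) auto
    also have "\<dots> = (X x)\<^sup>2 + \<bar>t\<bar> * \<bar>X x\<bar>" by (simp add: power2_eq_square algebra_simps)
    finally show "\<bar>X x * (X x - t) * ind t (X x)\<bar> \<le> (X x)\<^sup>2 + \<bar>t\<bar> * \<bar>X x\<bar>" .
  qed (use X_int X2_int zb_kernel_int in auto)
  also have "\<dots> = 1 + \<bar>t\<bar> * expectation (\<lambda>x. \<bar>X x\<bar>)"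
    using X_int X2_int by (simp add: X_sq)
  also have "\<dots> \<le> 1 + \<bar>t\<bar>" using abs_moment_le by (simp add: mult_left_le)
  finally show ?thesis .
qed

lemma Im_le: "\<bar>Im t\<bar> \<le> 1 + \<bar>t\<bar>"
proof -
  have "\<bar>Im t\<bar> \<le> expectation (\<lambda>x. \<bar>t\<bar> + \<bar>X x\<bar>)"
    unfolding Im_def
    by (rule abs_integral_le) (use X_int in \<open>auto simp: ind_def\<close>)
  also have "\<dots> \<le> 1 + \<bar>t\<bar>" using X_int abs_moment_le by (simp add: prob_space)
  finally show ?thesis .
qed

lemma Fm_le: "0 \<le> Fm t" "Fm t \<le> 1"
proof -
  show "0 \<le> Fm t" unfolding Fm_def by (auto simp: ind_def)
  have "Fm t \<le> expectation (\<lambda>_. 1)" unfolding Fm_def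
    by (rule integral_mono[OF ind_int]) (auto simp: ind_def)
  then show "Fm t \<le> 1" by (simp add: prob_space)
qed

end

section \<open>Linearisation of the integrand\<close>

lemma power2_sum4_le: "(a + b + c + d)\<^sup>2 \<le> 4 * (a\<^sup>2 + b\<^sup>2 + c\<^sup>2 + d\<^sup>2)" for a b c d :: real
proof -
  have "0 \<le> (a-b)\<^sup>2 + (a-c)\<^sup>2 + (a-d)\<^sup>2 + (b-c)\<^sup>2 + (b-d)\<^sup>2 + (c-d)\<^sup>2" by simp
  then show ?thesis by (simp add: power2_eq_square algebra_simps)
qed

text \<open>The error kernel of \<open>zb_kernel_expansion\<close> without its outer factor
  \<open>h\<close>.\<close>

definition win :: "real \<Rightarrow> real \<Rightarrow> real \<Rightarrow> real" where
  "win h t y = \<bar>y\<bar> * (if \<bar>y - t\<bar> \<le> h then 1 else 0)"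

text \<open>The points of \<open>grid_oscillation\<close> with the parameters made explicit:
  \<open>i = 0\<close> is \<open>t - h\<close> and \<open>i = N\<close> is
  \<open>t + h\<close>.\<close>

definition gridpt :: "nat \<Rightarrow> real \<Rightarrow> real \<Rightarrow> nat \<Rightarrow> real" where
  "gridpt N h t i = t + (2 * real i / real N - 1) * h"

lemma gridpt_dist:
  assumes "i \<le> N" "N > 0" "0 \<le> h"
  shows "\<bar>gridpt N h t i - t\<bar> \<le> h"
proof -
  have "0 \<le> real i / N" "real i / N \<le> 1" using assms by auto
  then have "\<bar>2 * real i / real N - 1\<bar> \<le> 1" by (simp add: abs_le_iff)
  then have "\<bar>2 * real i / real N - 1\<bar> * h \<le> 1 * h" by (rule mult_right_mono) (use assms in auto)
  then show ?thesis using assms by (simp add: gridpt_def abs_mult)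
qed

context zero_bias_sample
begin

text \<open>\<open>C1\<close> as a kernel on the real line, so that it can be evaluated at each
  \<open>Xs k\<close> and not only at \<open>X\<close>.\<close>

definition c1 :: "real \<Rightarrow> real \<Rightarrow> real" where
  "c1 t y = y * (y - t) * ind t y - y * expectation (\<lambda>x. (X x - t) * ind t (X x)) - y\<^sup>2 * Bm t
     - ind t y + Fm t - (1/2 * (1 - y\<^sup>2) * t - y) * (zb_density M X t - p t)"

lemma C1_eq: "C1 M X p s x = c1 s (X x)"
  by (simp add: C1_def c1_def indicator_atMost_eq_ind zb_cdf_eq cdf_eq)

text \<open>This brings the average into the linear form subtracted in
  \<open>remainder_bound\<close>; the factor of the density difference is the first-order part of
  \<open>u - t\<close>.\<close>

lemma avg_c1:
  assumes "n > 0"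
  shows "avg n (c1 t) xs = avg n (\<lambda>y. y * (y - t) * ind t y) xs - avg n (\<lambda>y. y\<^sup>2) xs * Bm t
     + avg n (\<lambda>y. y) xs * Im t - avg n (ind t) xs + Fm t
     + (avg n (\<lambda>y. y) xs + (avg n (\<lambda>y. y\<^sup>2) xs - 1) / 2 * t) * (zb_density M X t - p t)"
proof -
  have E: "expectation (\<lambda>x. (X x - t) * ind t (X x)) = - Im t"
    unfolding Im_def integral_minus[symmetric] by (simp add: algebra_simps)
  let ?g = "zb_density M X t - p t"
  have c: "c1 t = (\<lambda>y. y * (y - t) * ind t y - Bm t * y\<^sup>2 + Im t * y - ind t y + Fm t
     + (?g * y + (?g * t / 2) * y\<^sup>2 - ?g * t / 2))"
    unfolding c1_def E by (rule ext) (simp add: algebra_simps add_divide_distrib diff_divide_distrib)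
  have "avg n (c1 t) xs = avg n (\<lambda>y. y * (y - t) * ind t y) xs - Bm t * avg n (\<lambda>y. y\<^sup>2) xs
     + Im t * avg n (\<lambda>y. y) xs - avg n (\<lambda>y. ind t y) xs + Fm t
     + (?g * avg n (\<lambda>y. y) xs + (?g * t / 2) * avg n (\<lambda>y. y\<^sup>2) xs - ?g * t / 2)"
    unfolding c using assms by (simp only: avg_add avg_diff avg_cmult avg_const)
  then show ?thesis
    by (simp add: algebra_simps add_divide_distrib diff_divide_distrib)
qed

text \<open>\<open>30 + 3 * P\<close> is inherited from \<open>remainder_bound\<close>. With
  \<open>h = 2 * k * T\<close>, the expected window mass contributes
  \<open>4 * k * T * (2 * h * K1)\<close>, hence \<open>16 * K1\<close>, and the expansion of
  \<open>Fm\<close> contributes \<open>K2 * h^2\<close>, hence \<open>4 * K2\<close>.\<close>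

definition remainder_const :: real where "remainder_const = 30 + 3 * P + 16 * K1 + 4 * K2"

text \<open>The sample is fixed here. The point is that every \<open>dev\<close> on the right has a
  kernel chosen without knowledge of the sample: the random \<open>u\<close> has been replaced by
  the window radius \<open>h\<close> and the grid around \<open>t\<close>. Second moments therefore
  apply afterwards.\<close>

lemma remainder_pointwise:
  fixes xs :: "nat \<Rightarrow> real" and t :: real
  assumes n: "n > 0" and N: "N > 0" and k: "0 \<le> k" "k \<le> 1/4"
    and m: "\<bar>avg n (\<lambda>y. y) xs\<bar> \<le> k" and Q: "\<bar>avg n (\<lambda>y. y\<^sup>2) xs - 1\<bar> \<le> k"
  defines "T \<equiv> 1 + \<bar>t\<bar>" and "h \<equiv> 2 * k * (1 + \<bar>t\<bar>)"
  shows "\<bar>dn n xs t - (Bm t - Fm t) - avg n (c1 t) xs\<bar>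
    \<le> 4 * k * T * (\<bar>dev n (win h t) xs\<bar> + \<bar>dev n (\<lambda>y. y * ind t y) xs\<bar>
          + \<bar>dev n (\<lambda>y. y * (y - t) * ind t y) xs\<bar> + \<bar>dev n (\<lambda>y. (t - y) * ind t y) xs\<bar>)
      + remainder_const * k\<^sup>2 * T\<^sup>2 + (\<Sum>i\<le>N. \<bar>dev n (\<lambda>y. ind (gridpt N h t i) y - ind t y) xs\<bar>)
      + 4 * P * k * T / N"
proof -
  let ?m = "avg n (\<lambda>y. y) xs" and ?Q = "avg n (\<lambda>y. y\<^sup>2) xs"
  define S where "S = sqrt (?Q - ?m\<^sup>2)"
  define u where "u = ?m + S * t"
  define v where "v = u - t"
  note sc = scale_expansion[OF k m Q S_def]
  have T: "1 \<le> T" by (simp add: T_def)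
  have h: "h = 2 * k * T" "0 \<le> h" using k by (auto simp: h_def T_def)
  have sv: "sample_var n xs = ?Q - ?m\<^sup>2" by (rule sample_var_eq_avg[OF n])
  have dn: "dn n xs t = 1 / S\<^sup>2 * (avg n (\<lambda>x. x * (x - u) * ind u x) xs
           + ?m * avg n (\<lambda>x. (u - x) * ind u x) xs) - avg n (ind u) xs"
    using dn_eq_avg[of n xs ?m S u t] sc(1) by (simp add: sv S_def u_def)
  have v_eq: "v = ?m + (S - 1) * t" by (simp add: v_def u_def algebra_simps)
  have "\<bar>v\<bar> \<le> k + 2 * k * \<bar>t\<bar>" unfolding v_eq
    by (intro abs_add_mono m abs_mult_mono sc order_refl)
  also have "\<dots> \<le> 2 * k * T" using k by (simp add: T_def algebra_simps)
  finally have v: "\<bar>v\<bar> \<le> 2 * k * T" .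
  have "v - (?m + (?Q - 1) / 2 * t) = (S - 1 - (?Q - 1) / 2) * t"
    by (simp add: v_eq algebra_simps)
  also have "\<bar>\<dots>\<bar> \<le> 3 * k\<^sup>2 * T"
    by (intro abs_mult_mono sc) (simp add: T_def)
  finally have vw: "\<bar>v - (?m + (?Q - 1) / 2 * t)\<bar> \<le> 3 * k\<^sup>2 * T" .
  have uh: "\<bar>u - t\<bar> \<le> h" using v by (simp add: h v_def)
  let ?w = "\<bar>dev n (win h t) xs\<bar>" and ?a = "\<bar>dev n (\<lambda>y. y * ind t y) xs\<bar>"
  \<comment> \<open>A bound for the empirical window mass, split into deviation and expectation,
    plus the deviation of the empirical slope.\<close>
  define g where "g = ?w + 2 * h * K1 + ?a"
  have K1: "K1 \<ge> 0" using sp_le[of 0] by simp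
  have K2: "K2 \<ge> 0" using p_lipschitz[of 1 0] by simp
  have g: "0 \<le> g" using K1 h by (simp add: g_def)
  have win: "avg n (win h t) xs \<le> ?w + 2 * h * K1"
    using expectation_window_le[OF h(2), of t] unfolding dev_def win_def[symmetric] by linarith
  have Bu: "\<bar>avg n (\<lambda>x. x * (x - u) * ind u x) xs - avg n (\<lambda>y. y * (y - t) * ind t y) xs
      - zb_density M X t * v\<bar> \<le> 2 * k * T * g"
  proof -
    have e: "avg n (\<lambda>x. x * (x - u) * ind u x) xs - avg n (\<lambda>y. y * (y - t) * ind t y) xs
        - zb_density M X t * v
      = avg n (\<lambda>x. x * (x - u) * ind u x - x * (x - t) * ind t x + v * (x * ind t x)) xs
        - v * dev n (\<lambda>y. y * ind t y) xs"
      by (simp only: avg_add avg_diff avg_cmult dev_def zb_density_eq) (simp add: algebra_simps)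
    have "\<bar>avg n (\<lambda>x. x * (x - u) * ind u x - x * (x - t) * ind t x + v * (x * ind t x)) xs\<bar>
        \<le> avg n (\<lambda>x. h * win h t x) xs"
      unfolding v_def win_def by (rule abs_avg_le) (rule zb_kernel_expansion[OF uh])
    also have "\<dots> = h * avg n (win h t) xs" by (rule avg_cmult)
    also have "\<dots> \<le> h * (?w + 2 * h * K1)" by (intro mult_left_mono win h)
    finally have 1: "\<bar>avg n (\<lambda>x. x * (x - u) * ind u x - x * (x - t) * ind t x + v * (x * ind t x)) xs\<bar>
        \<le> h * (?w + 2 * h * K1)" .
    have "\<bar>v * dev n (\<lambda>y. y * ind t y) xs\<bar> \<le> h * ?a"
      by (intro abs_mult_mono order_refl) (use v h in simp)
    with 1 show ?thesis unfolding e
      by (rule order_trans[OF abs_diff_mono]) (simp add: g_def h algebra_simps)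
  qed
  have Iu: "\<bar>avg n (\<lambda>x. (u - x) * ind u x) xs - avg n (\<lambda>y. (t - y) * ind t y) xs\<bar> \<le> 2 * k * T"
  proof -
    have "\<bar>avg n (\<lambda>x. (u - x) * ind u x - (t - x) * ind t x) xs\<bar> \<le> avg n (\<lambda>_. \<bar>u - t\<bar>) xs"
      by (rule abs_avg_le) (rule abs_tent_diff_le)
    then show ?thesis using uh n by (simp add: avg_diff avg_const h)
  qed
  let ?e = "\<Sum>i\<le>N. \<bar>dev n (\<lambda>y. ind (gridpt N h t i) y - ind t y) xs\<bar>"
  \<comment> \<open>The increment of the empirical distribution function is its centred oscillation,
    handled by the grid, plus the increment of \<open>Fm\<close>, handled by its expansion.\<close>
  have Z: "\<bar>avg n (ind u) xs - avg n (ind t) xs - p t * v\<bar> \<le> ?e + P * (2 * h / N) + K2 * h\<^sup>2"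
  proof -
    have mono: "mono (\<lambda>v. avg n (ind v) xs)"
      by (intro monoI avg_mono) (auto simp: ind_def)
    have dd: "dev n (\<lambda>y. ind s y - ind t y) xs
       = (avg n (ind s) xs - Fm s) - (avg n (ind t) xs - Fm t)" for s
      by (simp add: dev_def avg_diff Fm_def ind_int)
    have 1: "\<bar>(avg n (ind u) xs - Fm u) - (avg n (ind t) xs - Fm t)\<bar> \<le> ?e + P * (2 * h / N)"
      unfolding dd gridpt_def
      by (rule grid_oscillation[OF mono Fm_lipschitz uh N P_nonneg])
    have "\<bar>Fm u - Fm t - p t * v\<bar> \<le> K2 * v\<^sup>2" unfolding v_def by (rule Fm_expansion)
    also have "\<dots> \<le> K2 * h\<^sup>2"
      by (intro mult_left_mono K2) (use uh h in \<open>simp add: v_def abs_le_square_iff[symmetric]\<close>)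
    finally have 2: "\<bar>Fm u - Fm t - p t * v\<bar> \<le> K2 * h\<^sup>2" .
    have e: "avg n (ind u) xs - avg n (ind t) xs - p t * v
      = ((avg n (ind u) xs - Fm u) - (avg n (ind t) xs - Fm t)) + (Fm u - Fm t - p t * v)" by simp
    show ?thesis unfolding e by (rule abs_add_mono[OF 1 2])
  qed
  have pt: "\<bar>p t\<bar> \<le> P" using p_le p_nonneg by simp
  note R = remainder_bound[OF k T P_nonneg g sc(4) sc(3) sc(6) v vw m zb_density_le
      Bm_le[of t, folded T_def] Im_le[of t, folded T_def] pt Bu Iu Z, of "Fm t"]
  have "\<bar>dn n xs t - (Bm t - Fm t) - avg n (c1 t) xs\<bar>
     \<le> 4 * k * T * (g + \<bar>avg n (\<lambda>y. y * (y - t) * ind t y) xs - Bm t\<bar>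
          + \<bar>avg n (\<lambda>y. (t - y) * ind t y) xs - Im t\<bar>)
       + (30 + 3 * P) * k\<^sup>2 * T + (?e + P * (2 * h / N) + K2 * h\<^sup>2)"
    unfolding dn avg_c1[OF n] by (rule R)
  also have "(30 + 3 * P) * k\<^sup>2 * T \<le> (30 + 3 * P) * k\<^sup>2 * T\<^sup>2"
    using T P_nonneg by (intro mult_left_mono) (auto simp: power2_eq_square)
  finally have "\<bar>dn n xs t - (Bm t - Fm t) - avg n (c1 t) xs\<bar>
     \<le> 4 * k * T * (g + \<bar>avg n (\<lambda>y. y * (y - t) * ind t y) xs - Bm t\<bar>
          + \<bar>avg n (\<lambda>y. (t - y) * ind t y) xs - Im t\<bar>)
       + (30 + 3 * P) * k\<^sup>2 * T\<^sup>2 + (?e + P * (2 * h / N) + K2 * h\<^sup>2)" by simp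
  also have "\<dots> = 4 * k * T * (?w + ?a + \<bar>avg n (\<lambda>y. y * (y - t) * ind t y) xs - Bm t\<bar>
          + \<bar>avg n (\<lambda>y. (t - y) * ind t y) xs - Im t\<bar>)
      + remainder_const * k\<^sup>2 * T\<^sup>2 + ?e + 4 * P * k * T / N"
    by (simp add: g_def h remainder_const_def power2_eq_square algebra_simps)
  finally show ?thesis by (simp add: dev_def Bm_def Im_def)
qed

section \<open>A majorant for the squared linearisation error\<close>

definition fourth_moment :: real where "fourth_moment = expectation (\<lambda>x. (X x) ^ 4)"

text \<open>Here \<open>k\<close> bounds the deviations of the first two sample moments, and \<open>N\<close> is the number of
  intervals of the grid.\<close>

definition majorant :: "nat \<Rightarrow> nat \<Rightarrow> real \<Rightarrow> real \<Rightarrow> (nat \<Rightarrow> real) \<Rightarrow> real" where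
  "majorant n N k t xs = 4 * (64 * k\<^sup>2 * (1 + \<bar>t\<bar>)\<^sup>2 * ((dev n (win (2 * k * (1 + \<bar>t\<bar>)) t) xs)\<^sup>2
      + (dev n (\<lambda>y. y * ind t y) xs)\<^sup>2
      + (dev n (\<lambda>y. y * (y - t) * ind t y) xs)\<^sup>2 + (dev n (\<lambda>y. (t - y) * ind t y) xs)\<^sup>2)
    + (remainder_const * k\<^sup>2 * (1 + \<bar>t\<bar>)\<^sup>2)\<^sup>2
    + (real N + 1) * (\<Sum>i\<le>N. (dev n (\<lambda>y. ind (gridpt N (2 * k * (1 + \<bar>t\<bar>)) t i) y - ind t y) xs)\<^sup>2)
    + (4 * P * k * (1 + \<bar>t\<bar>) / N)\<^sup>2)"

text \<open>Two uses of \<open>power2_sum4_le\<close>: the outer one gives the leading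
  \<open>4\<close>, the inner one turns \<open>(4 * k * T)^2\<close> into
  \<open>64 * k^2 * T^2\<close>. Cauchy-Schwarz over the \<open>N + 1\<close> grid points gives the
  factor \<open>real N + 1\<close>.\<close>

lemma remainder_sq_le_majorant:
  assumes "n > 0" "N > 0" "0 \<le> k" "k \<le> 1/4"
    "\<bar>avg n (\<lambda>y. y) xs\<bar> \<le> k" "\<bar>avg n (\<lambda>y. y\<^sup>2) xs - 1\<bar> \<le> k"
  shows "(dn n xs t - (Bm t - Fm t) - avg n (c1 t) xs)\<^sup>2 \<le> majorant n N k t xs"
proof -
  let ?T = "1 + \<bar>t\<bar>" let ?h = "2 * k * ?T"
  let ?w = "\<bar>dev n (win ?h t) xs\<bar>" and ?a = "\<bar>dev n (\<lambda>y. y * ind t y) xs\<bar>"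
    and ?b = "\<bar>dev n (\<lambda>y. y * (y - t) * ind t y) xs\<bar>" and ?i = "\<bar>dev n (\<lambda>y. (t - y) * ind t y) xs\<bar>"
  let ?e = "\<lambda>i. dev n (\<lambda>y. ind (gridpt N ?h t i) y - ind t y) xs"
  have "(dn n xs t - (Bm t - Fm t) - avg n (c1 t) xs)\<^sup>2
    \<le> (4 * k * ?T * (?w + ?a + ?b + ?i) + remainder_const * k\<^sup>2 * ?T\<^sup>2 + (\<Sum>i\<le>N. \<bar>?e i\<bar>) + 4 * P * k * ?T / N)\<^sup>2"
    using power_mono[OF remainder_pointwise[OF assms, of t] abs_ge_zero, of 2] by simp
  also have "\<dots> \<le> 4 * ((4 * k * ?T * (?w + ?a + ?b + ?i))\<^sup>2 + (remainder_const * k\<^sup>2 * ?T\<^sup>2)\<^sup>2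
      + (\<Sum>i\<le>N. \<bar>?e i\<bar>)\<^sup>2 + (4 * P * k * ?T / N)\<^sup>2)"
    by (rule power2_sum4_le)
  also have "\<dots> \<le> 4 * (64 * k\<^sup>2 * ?T\<^sup>2 * (?w\<^sup>2 + ?a\<^sup>2 + ?b\<^sup>2 + ?i\<^sup>2) + (remainder_const * k\<^sup>2 * ?T\<^sup>2)\<^sup>2
      + (real N + 1) * (\<Sum>i\<le>N. (?e i)\<^sup>2) + (4 * P * k * ?T / N)\<^sup>2)"
  proof (intro mult_left_mono add_mono order_refl)
    have "(4 * k * ?T * (?w + ?a + ?b + ?i))\<^sup>2 \<le> (4 * k * ?T)\<^sup>2 * (4 * (?w\<^sup>2 + ?a\<^sup>2 + ?b\<^sup>2 + ?i\<^sup>2))"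
      unfolding power_mult_distrib[of "4 * k * ?T"] by (intro mult_left_mono power2_sum4_le) simp
    also have "\<dots> = 64 * k\<^sup>2 * ?T\<^sup>2 * (?w\<^sup>2 + ?a\<^sup>2 + ?b\<^sup>2 + ?i\<^sup>2)"
      by (simp only: power_mult_distrib) simp
    finally show "(4 * k * ?T * (?w + ?a + ?b + ?i))\<^sup>2 \<le> 64 * k\<^sup>2 * ?T\<^sup>2 * (?w\<^sup>2 + ?a\<^sup>2 + ?b\<^sup>2 + ?i\<^sup>2)" .
    show "(\<Sum>i\<le>N. \<bar>?e i\<bar>)\<^sup>2 \<le> (real N + 1) * (\<Sum>i\<le>N. (?e i)\<^sup>2)"
      using sum_squared_le_sum_of_squares[of "\<lambda>i. \<bar>?e i\<bar>" "{..N}"] by (simp add: algebra_simps)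
  qed simp
  finally show ?thesis
    unfolding majorant_def by (simp only: power2_abs)
qed

lemma majorant_measurable [measurable]: "(\<lambda>(x, t). majorant n N k t (\<lambda>j. Xs j x)) \<in> borel_measurable (M \<Otimes>\<^sub>M borel)"
  unfolding majorant_def win_def gridpt_def by measurable

text \<open>The four summands come from the deviations at \<open>t\<close>, the quadratic error, the
  grid increments and the mesh. \<open>2 * fourth_moment + 5\<close> adds up \<open>1\<close>,
  \<open>1\<close>, \<open>2 * (fourth_moment + 1)\<close> and \<open>1\<close> from
  \<open>moment_bounds\<close>. One factor \<open>N + 1\<close> in the third summand counts grid
  points, the other is the Cauchy-Schwarz factor.\<close>

definition majorant_rate :: "nat \<Rightarrow> nat \<Rightarrow> real \<Rightarrow> real" where
  "majorant_rate n N k = 4 * (64 * k\<^sup>2 * (2 * fourth_moment + 5) / n + remainder_const\<^sup>2 * k ^ 4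
     + 2 * P * (real N + 1)\<^sup>2 * k / n + 16 * P\<^sup>2 * k\<^sup>2 / (real N)\<^sup>2)"

lemma moment_bounds:
  shows "expectation (\<lambda>x. (win h t (X x))\<^sup>2) \<le> 1"
    and "expectation (\<lambda>x. (X x * ind t (X x))\<^sup>2) \<le> 1"
    and "expectation (\<lambda>x. (X x * (X x - t) * ind t (X x))\<^sup>2) \<le> 2 * (fourth_moment + 1) * (1 + \<bar>t\<bar>)\<^sup>2"
    and "expectation (\<lambda>x. ((t - X x) * ind t (X x))\<^sup>2) \<le> (1 + \<bar>t\<bar>)\<^sup>2"
proof -
  have "\<bar>expectation (\<lambda>x. (win h t (X x))\<^sup>2)\<bar> \<le> expectation (\<lambda>x. (X x)\<^sup>2)"
    by (rule abs_integral_le[OF X2_int]) (auto simp: win_def)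
  then show "expectation (\<lambda>x. (win h t (X x))\<^sup>2) \<le> 1" by (simp add: X_sq)
  have "\<bar>expectation (\<lambda>x. (X x * ind t (X x))\<^sup>2)\<bar> \<le> expectation (\<lambda>x. (X x)\<^sup>2)"
    by (rule abs_integral_le[OF X2_int]) (auto simp: ind_def)
  then show "expectation (\<lambda>x. (X x * ind t (X x))\<^sup>2) \<le> 1" by (simp add: X_sq)
  have T2: "(1 + \<bar>t\<bar>)\<^sup>2 = 1 + 2 * \<bar>t\<bar> + t\<^sup>2" by (simp add: power2_sum)
  have fourth_moment: "fourth_moment \<ge> 0" unfolding fourth_moment_def by simp
  have "\<bar>expectation (\<lambda>x. (X x * (X x - t) * ind t (X x))\<^sup>2)\<bar>
      \<le> expectation (\<lambda>x. 2 * (X x) ^ 4 + 2 * t\<^sup>2 * (X x)\<^sup>2)"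
  proof (rule abs_integral_le)
    fix x
    let ?y = "X x"
    have "(?y * (?y - t) * ind t ?y)\<^sup>2 \<le> ?y\<^sup>2 * (?y - t)\<^sup>2" by (auto simp: ind_def power_mult_distrib)
    also have "(?y - t)\<^sup>2 \<le> 2 * ?y\<^sup>2 + 2 * t\<^sup>2"
      using zero_le_power2[of "?y + t"] by (simp add: power2_eq_square algebra_simps)
    finally have "(?y * (?y - t) * ind t ?y)\<^sup>2 \<le> ?y\<^sup>2 * (2 * ?y\<^sup>2 + 2 * t\<^sup>2)" by (simp add: mult_left_mono)
    also have "\<dots> = 2 * ?y ^ 4 + 2 * t\<^sup>2 * ?y\<^sup>2"
      by (simp add: algebra_simps power4_eq_xxxx power2_eq_square)
    finally show "\<bar>(?y * (?y - t) * ind t ?y)\<^sup>2\<bar> \<le> 2 * ?y ^ 4 + 2 * t\<^sup>2 * ?y\<^sup>2"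
      by (simp only: abs_of_nonneg[OF zero_le_power2])
  qed (use X4_int X2_int in auto)
  also have "\<dots> = 2 * fourth_moment + 2 * t\<^sup>2" using X4_int X2_int by (simp add: fourth_moment_def X_sq)
  also have "\<dots> \<le> 2 * (fourth_moment + 1) * (1 + \<bar>t\<bar>)\<^sup>2" unfolding T2 using fourth_moment by (simp add: algebra_simps)
  finally show "expectation (\<lambda>x. (X x * (X x - t) * ind t (X x))\<^sup>2) \<le> 2 * (fourth_moment + 1) * (1 + \<bar>t\<bar>)\<^sup>2" by simp
  have "\<bar>expectation (\<lambda>x. ((t - X x) * ind t (X x))\<^sup>2)\<bar> \<le> expectation (\<lambda>x. t\<^sup>2 - 2 * t * X x + (X x)\<^sup>2)"
  proof (rule abs_integral_le)
    fix x
    show "\<bar>((t - X x) * ind t (X x))\<^sup>2\<bar> \<le> t\<^sup>2 - 2 * t * X x + (X x)\<^sup>2"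
    proof -
      have "t\<^sup>2 - 2 * t * X x + (X x)\<^sup>2 = (t - X x)\<^sup>2" by (simp add: power2_diff)
      then show ?thesis by (simp add: ind_def)
    qed
  qed (use X_int X2_int in auto)
  also have "\<dots> = t\<^sup>2 + 1" using X_int X2_int by (simp add: X_sq X_mean prob_space)
  also have "\<dots> \<le> (1 + \<bar>t\<bar>)\<^sup>2" unfolding T2 by simp
  finally show "expectation (\<lambda>x. ((t - X x) * ind t (X x))\<^sup>2) \<le> (1 + \<bar>t\<bar>)\<^sup>2" by simp
qed

lemma moment_integrable:
  shows "integrable M (\<lambda>x. (win h t (X x))\<^sup>2)"
    and "integrable M (\<lambda>x. (X x * ind t (X x))\<^sup>2)"
    and "integrable M (\<lambda>x. (X x * (X x - t) * ind t (X x))\<^sup>2)"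
    and "integrable M (\<lambda>x. ((t - X x) * ind t (X x))\<^sup>2)"
    and "integrable M (\<lambda>x. (ind s (X x) - ind t (X x))\<^sup>2)"
proof -
  have y: "\<bar>y\<bar> \<le> 1 + y\<^sup>2" for y :: real
  proof -
    have "0 \<le> (\<bar>y\<bar> - 1)\<^sup>2" by simp
    then show ?thesis unfolding power2_diff by simp
  qed
  show "integrable M (\<lambda>x. (win h t (X x))\<^sup>2)"
    by (rule square_integrable_quadratic_growth[where a=1]) (auto simp: win_def y[simplified])
  show "integrable M (\<lambda>x. (X x * ind t (X x))\<^sup>2)"
    by (rule square_integrable_quadratic_growth[of "\<lambda>y. y * ind t y" 1]) (auto simp: ind_def y[simplified])
  show "integrable M (\<lambda>x. (X x * (X x - t) * ind t (X x))\<^sup>2)"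
    by (rule square_integrable_quadratic_growth[of "\<lambda>y. y * (y - t) * ind t y", OF _ zb_kernel_growth]) simp
  have "\<bar>(t - y) * ind t y\<bar> \<le> (1 + \<bar>t\<bar>) * (1 + y\<^sup>2)" for y
  proof -
    have "\<bar>(t - y) * ind t y\<bar> \<le> \<bar>t\<bar> * 1 + 1 * \<bar>y\<bar>" by (auto simp: ind_def)
    also have "\<dots> \<le> \<bar>t\<bar> * (1 + y\<^sup>2) + 1 * (1 + y\<^sup>2)" by (intro add_mono mult_left_mono y) auto
    finally show ?thesis by (simp add: algebra_simps)
  qed
  then show "integrable M (\<lambda>x. ((t - X x) * ind t (X x))\<^sup>2)"
    by (rule square_integrable_quadratic_growth[of "\<lambda>y. (t - y) * ind t y", rotated]) simp
  show "integrable M (\<lambda>x. (ind s (X x) - ind t (X x))\<^sup>2)"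
    by (rule integrable_const_bound[of _ 1]) (auto simp: ind_def)
qed

text \<open>Since \<open>1 + |t|\<close> is at least \<open>1\<close>, the lower powers can be
  raised to the fourth, and a single rate multiplies one function that the weight
  integrates.\<close>

lemma expectation_majorant:
  assumes n: "n > 0" and N: "N > 0" and k: "0 \<le> k"
  shows "integrable M (\<lambda>x. majorant n N k t (\<lambda>j. Xs j x))"
    and "expectation (\<lambda>x. majorant n N k t (\<lambda>j. Xs j x)) \<le> majorant_rate n N k * (1 + \<bar>t\<bar>) ^ 4"
proof -
  define T where "T = 1 + \<bar>t\<bar>"
  define h where "h = 2 * k * T"
  have T: "1 \<le> T" by (simp add: T_def)
  have h: "0 \<le> h" using k T by (simp add: h_def)
  have fourth_moment: "fourth_moment \<ge> 0" unfolding fourth_moment_def by simp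
  let ?d = "\<lambda>f. \<lambda>x. (dev n f (\<lambda>j. Xs j x))\<^sup>2"
  have wm: "win h t \<in> borel_measurable borel" unfolding win_def[abs_def] by measurable
  note d1 = dev_second_moment[OF wm moment_integrable(1) n]
  note d2 = dev_second_moment[of "\<lambda>y. y * ind t y", OF _ moment_integrable(2) n, simplified]
  note d3 = dev_second_moment[of "\<lambda>y. y * (y - t) * ind t y", OF _ moment_integrable(3) n, simplified]
  note d4 = dev_second_moment[of "\<lambda>y. (t - y) * ind t y", OF _ moment_integrable(4) n, simplified]
  note d5 = dev_second_moment[of "\<lambda>y. ind s y - ind t y" for s, OF _ moment_integrable(5) n, simplified]
  let ?e = "\<lambda>i. ?d (\<lambda>y. ind (gridpt N h t i) y - ind t y)"
  have Zeq: "majorant n N k t (\<lambda>j. Xs j x) = 4 * (64 * k\<^sup>2 * T\<^sup>2 * (?d (win h t) x + ?d (\<lambda>y. y * ind t y) x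
      + ?d (\<lambda>y. y * (y - t) * ind t y) x + ?d (\<lambda>y. (t - y) * ind t y) x)
      + (remainder_const * k\<^sup>2 * T\<^sup>2)\<^sup>2 + (real N + 1) * (\<Sum>i\<le>N. ?e i x) + (4 * P * k * T / N)\<^sup>2)" for x
    by (simp add: majorant_def T_def h_def)
  show "integrable M (\<lambda>x. majorant n N k t (\<lambda>j. Xs j x))"
    unfolding Zeq using d1(1) d2(1) d3(1) d4(1) d5(1) by simp
  have e: "expectation (\<lambda>x. ?e i x) \<le> P * h / n" if "i \<le> N" for i
    by (rule order_trans[OF d5(2)])
      (intro divide_right_mono expectation_ind_diff_le gridpt_dist that N h, simp)
  have e': "(\<Sum>i\<le>N. expectation (\<lambda>x. ?e i x)) \<le> (real N + 1) * (P * h / n)"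
    using sum_mono[of "{..N}" "\<lambda>i. expectation (\<lambda>x. ?e i x)" "\<lambda>_. P * h / n"] e
    by (simp add: algebra_simps)
  have T2: "1 \<le> T\<^sup>2" using T by simp
  have "expectation (?d (win h t)) + expectation (?d (\<lambda>y. y * ind t y))
      + expectation (?d (\<lambda>y. y * (y - t) * ind t y)) + expectation (?d (\<lambda>y. (t - y) * ind t y))
    \<le> 1 / n + 1 / n + 2 * (fourth_moment + 1) * T\<^sup>2 / n + T\<^sup>2 / n"
    by (intro add_mono order_trans[OF d1(2)] order_trans[OF d2(2)] order_trans[OF d3(2)]
          order_trans[OF d4(2)] divide_right_mono moment_bounds(1,2)
          moment_bounds(3,4)[where t=t, folded T_def]) simp_all
  also have "\<dots> \<le> T\<^sup>2 / n + T\<^sup>2 / n + 2 * (fourth_moment + 1) * T\<^sup>2 / n + T\<^sup>2 / n"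
    by (intro add_mono divide_right_mono T2) auto
  also have "\<dots> = (2 * fourth_moment + 5) * T\<^sup>2 / n" by (simp add: algebra_simps add_divide_distrib)
  finally have d: "expectation (?d (win h t)) + expectation (?d (\<lambda>y. y * ind t y))
      + expectation (?d (\<lambda>y. y * (y - t) * ind t y)) + expectation (?d (\<lambda>y. (t - y) * ind t y))
    \<le> (2 * fourth_moment + 5) * T\<^sup>2 / n" .
  have "expectation (\<lambda>x. majorant n N k t (\<lambda>j. Xs j x)) = 4 * (64 * k\<^sup>2 * T\<^sup>2 * (expectation (?d (win h t))
      + expectation (?d (\<lambda>y. y * ind t y))
      + expectation (?d (\<lambda>y. y * (y - t) * ind t y)) + expectation (?d (\<lambda>y. (t - y) * ind t y)))
      + (remainder_const * k\<^sup>2 * T\<^sup>2)\<^sup>2 + (real N + 1) * (\<Sum>i\<le>N. expectation (\<lambda>x. ?e i x)) + (4 * P * k * T / N)\<^sup>2)"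
    unfolding Zeq using d1(1) d2(1) d3(1) d4(1) d5(1) by (simp add: prob_space)
  also have "\<dots> \<le> 4 * (64 * k\<^sup>2 * T\<^sup>2 * ((2 * fourth_moment + 5) * T\<^sup>2 / n)
      + (remainder_const * k\<^sup>2 * T\<^sup>2)\<^sup>2 + (real N + 1) * ((real N + 1) * (P * h / n)) + (4 * P * k * T / N)\<^sup>2)"
    by (intro mult_left_mono add_mono order_refl d e') auto
  also have "\<dots> \<le> 4 * (64 * k\<^sup>2 * (2 * fourth_moment + 5) / n * T ^ 4 + remainder_const\<^sup>2 * k ^ 4 * T ^ 4
     + 2 * P * (real N + 1)\<^sup>2 * k / n * T ^ 4 + 16 * P\<^sup>2 * k\<^sup>2 / (real N)\<^sup>2 * T ^ 4)"
  proof (intro mult_left_mono add_mono)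
    show "64 * k\<^sup>2 * T\<^sup>2 * ((2 * fourth_moment + 5) * T\<^sup>2 / n) \<le> 64 * k\<^sup>2 * (2 * fourth_moment + 5) / n * T ^ 4"
    proof -
      have "T ^ 4 = T\<^sup>2 * T\<^sup>2" by (simp add: power_add[symmetric])
      then show ?thesis by (simp add: ac_simps)
    qed
    show "(remainder_const * k\<^sup>2 * T\<^sup>2)\<^sup>2 \<le> remainder_const\<^sup>2 * k ^ 4 * T ^ 4"
      by (simp add: power_mult_distrib power_mult[symmetric])
    have "(real N + 1) * ((real N + 1) * (P * h / n)) = 2 * P * (real N + 1)\<^sup>2 * k / n * T"
      by (simp add: h_def power2_eq_square)
    also have "\<dots> \<le> 2 * P * (real N + 1)\<^sup>2 * k / n * T ^ 4"
      using T power_increasing[of 1 4 T] P_nonneg k by (intro mult_left_mono) auto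
    finally show "(real N + 1) * ((real N + 1) * (P * h / n)) \<le> 2 * P * (real N + 1)\<^sup>2 * k / n * T ^ 4" .
    have "(4 * P * k * T / N)\<^sup>2 = 16 * P\<^sup>2 * k\<^sup>2 / (real N)\<^sup>2 * T\<^sup>2"
      by (simp add: power_mult_distrib power_divide)
    also have "\<dots> \<le> 16 * P\<^sup>2 * k\<^sup>2 / (real N)\<^sup>2 * T ^ 4"
      using T power_increasing[of 2 4 T] by (intro mult_left_mono) auto
    finally show "(4 * P * k * T / N)\<^sup>2 \<le> 16 * P\<^sup>2 * k\<^sup>2 / (real N)\<^sup>2 * T ^ 4" .
  qed auto
  also have "\<dots> = majorant_rate n N k * (1 + \<bar>t\<bar>) ^ 4" by (simp add: majorant_rate_def T_def algebra_simps)
  finally show "expectation (\<lambda>x. majorant n N k t (\<lambda>j. Xs j x)) \<le> majorant_rate n N k * (1 + \<bar>t\<bar>) ^ 4" .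
qed

end

section \<open>Weak convergence\<close>

lemma integrable_nn_bound:
  fixes f :: "'a \<Rightarrow> real"
  assumes [measurable]: "f \<in> borel_measurable M" and "\<And>x. 0 \<le> f x"
    and b: "(\<integral>\<^sup>+x. ennreal (f x) \<partial>M) \<le> ennreal c" and "0 \<le> c"
  shows "integrable M f" "integral\<^sup>L M f \<le> c"
proof -
  have fin: "(\<integral>\<^sup>+x. ennreal (f x) \<partial>M) < \<infinity>" using b by (metis ennreal_less_top infinity_ennreal_def le_less_trans)
  show i: "integrable M f" by (rule integrableI_nonneg) (use assms fin in auto)
  have "ennreal (integral\<^sup>L M f) \<le> ennreal c"
    using b nn_integral_eq_integral[OF i] assms(2) by simp
  then show "integral\<^sup>L M f \<le> c" using assms(4) by (simp add: ennreal_le_iff)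
qed

lemma norm_iexp_diff_le: "norm (exp (\<i> * complex_of_real a) - exp (\<i> * complex_of_real b)) \<le> \<bar>a - b\<bar>"
proof -
  have "exp (\<i> * complex_of_real b) * exp (\<i> * complex_of_real (a - b)) = exp (\<i> * complex_of_real a)"
    by (subst exp_add[symmetric]) (simp add: algebra_simps)
  then have "exp (\<i> * complex_of_real a) - exp (\<i> * complex_of_real b)
    = exp (\<i> * complex_of_real b) * (exp (\<i> * complex_of_real (a - b)) - 1)"
    by (simp add: right_diff_distrib del: of_real_diff)
  also have "norm \<dots> = norm (exp (\<i> * complex_of_real (a - b)) - 1)" by (simp add: norm_mult)
  also have "\<dots> \<le> \<bar>a - b\<bar>" using iexp_approx1[of "a - b" 0] by simp
  finally show ?thesis .
qed

context prob_space
begin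

lemma char_distr:
  assumes [measurable]: "Y \<in> borel_measurable M"
  shows "char (distr M borel Y) t = (CLINT x|M. iexp (t * Y x))"
  unfolding char_def by (subst integral_distr) auto

text \<open>Needed for the shift by \<open>Suc\<close>: sample averages start at index
  \<open>1\<close>, the sums of the central limit theorem at \<open>0\<close>.\<close>

lemma indep_vars_reindex:
  assumes Y: "indep_vars (\<lambda>_. N) Y (g ` I)" and g: "inj_on g I"
  shows "indep_vars (\<lambda>_. N) (\<lambda>i. Y (g i)) I"
  unfolding indep_vars_def2 indep_sets_def
proof (intro conjI ballI allI impI)
  show "random_variable N (Y (g i))" if "i \<in> I" for i
    using Y that unfolding indep_vars_def2 by simp
  let ?F = "\<lambda>i. {Y i -` A \<inter> space M |A. A \<in> sets N}"
  have F: "indep_sets ?F (g ` I)" using Y unfolding indep_vars_def2 by simp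
  show "?F (g i) \<subseteq> events" if "i \<in> I" for i
    using F that unfolding indep_sets_def by blast
  fix J A assume J: "J \<subseteq> I" "J \<noteq> {}" "finite J" and A: "A \<in> (\<Pi> j\<in>J. ?F (g j))"
  have gJ: "inj_on g J" using g J(1) by (rule inj_on_subset)
  \<comment> \<open>The given independence concerns indices in the image of \<open>J\<close>, so the
    events are carried over along the inverse of \<open>g\<close>.\<close>
  define B where "B k = A (the_inv_into J g k)" for k
  have B: "B (g j) = A j" if "j \<in> J" for j
    using the_inv_into_f_f[OF gJ that] by (simp add: B_def)
  have "prob (\<Inter>k\<in>g ` J. B k) = (\<Prod>k\<in>g ` J. prob (B k))"
    by (rule indep_setsD[OF F]) (use J A B in \<open>auto simp: Pi_iff\<close>)
  then show "prob (\<Inter>j\<in>J. A j) = (\<Prod>j\<in>J. prob (A j))"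
    by (simp add: B prod.reindex[OF gJ] cong: INF_cong_simp)
qed

text \<open>A form of Slutsky's theorem for an error that is controlled in mean only on events of
  probability tending to one. Characteristic functions differ by at most \<open>|t|\<close> times
  the error on the event and by \<open>2\<close> off it. Integrability is demanded along with the
  bound because a non-integrable function has expectation \<open>0\<close> by convention.\<close>

lemma weak_conv_m_perturb:
  fixes U V :: "nat \<Rightarrow> 'a \<Rightarrow> real"
  assumes [measurable]: "\<And>n. U n \<in> borel_measurable M" "\<And>n. V n \<in> borel_measurable M"
    and A [measurable]: "\<And>n. A n \<in> events"
    and le: "\<forall>\<^sub>F n in sequentially. integrable M (\<lambda>x. indicator (A n) x * \<bar>U n x - V n x\<bar>)
      \<and> expectation (\<lambda>x. indicator (A n) x * \<bar>U n x - V n x\<bar>) \<le> w n"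
    and w: "w \<longlonglongrightarrow> 0"
    and A': "(\<lambda>n. prob (space M - A n)) \<longlonglongrightarrow> 0"
    and V: "weak_conv_m (\<lambda>n. distr M borel (V n)) \<mu>" and \<mu>: "real_distribution \<mu>"
  shows "weak_conv_m (\<lambda>n. distr M borel (U n)) \<mu>"
proof (rule levy_continuity)
  show rdU: "real_distribution (distr M borel (U n))" for n by (rule real_distribution_distr) simp
  show "real_distribution \<mu>" by fact
  fix t
  have cV: "(\<lambda>n. char (distr M borel (V n)) t) \<longlonglongrightarrow> char \<mu> t"
    by (rule levy_continuity1[OF _ \<mu> V]) (rule real_distribution_distr, simp)
  have b: "norm (char (distr M borel (U n)) t - char (distr M borel (V n)) t)
     \<le> \<bar>t\<bar> * expectation (\<lambda>x. indicator (A n) x * \<bar>U n x - V n x\<bar>) + 2 * prob (space M - A n)"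
    if int: "integrable M (\<lambda>x. indicator (A n) x * \<bar>U n x - V n x\<bar>)" for n
  proof -
    have i: "integrable M (\<lambda>x. iexp (t * Y x))" if [measurable]: "Y \<in> borel_measurable M" for Y
      by (rule integrable_iexp) auto
    have i3: "integrable M (\<lambda>x. 2 * indicator (space M - A n) x :: real)"
      by (rule integrable_const_bound[of _ 2]) (auto simp: indicator_def)
    have "char (distr M borel (U n)) t - char (distr M borel (V n)) t
      = (CLINT x|M. iexp (t * U n x) - iexp (t * V n x))"
      using i[of "U n"] i[of "V n"] by (simp add: char_distr)
    also have "norm \<dots> \<le> (\<integral>x. norm (iexp (t * U n x) - iexp (t * V n x)) \<partial>M)"
      by (rule integral_norm_bound)
    also have "\<dots> \<le> (\<integral>x. \<bar>t\<bar> * (indicator (A n) x * \<bar>U n x - V n x\<bar>) + 2 * indicator (space M - A n) x \<partial>M)"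
    proof (rule integral_mono)
      show "integrable M (\<lambda>x. norm (iexp (t * U n x) - iexp (t * V n x)))"
        by (intro integrable_norm Bochner_Integration.integrable_diff i) simp_all
      show "integrable M (\<lambda>x. \<bar>t\<bar> * (indicator (A n) x * \<bar>U n x - V n x\<bar>) + 2 * indicator (space M - A n) x)"
        by (intro Bochner_Integration.integrable_add integrable_mult_right int i3)
      fix x assume x: "x \<in> space M"
      have "norm (iexp (t * U n x) - iexp (t * V n x)) \<le> norm (iexp (t * U n x)) + norm (iexp (t * V n x))"
        by (rule norm_triangle_ineq4)
      then have "norm (iexp (t * U n x) - iexp (t * V n x)) \<le> 2" by (simp del: of_real_mult)
      moreover have "norm (iexp (t * U n x) - iexp (t * V n x)) \<le> \<bar>t\<bar> * \<bar>U n x - V n x\<bar>"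
        using norm_iexp_diff_le[of "t * U n x" "t * V n x"]
        by (simp add: right_diff_distrib[symmetric] abs_mult del: of_real_mult)
      ultimately show "norm (iexp (t * U n x) - iexp (t * V n x))
        \<le> \<bar>t\<bar> * (indicator (A n) x * \<bar>U n x - V n x\<bar>) + 2 * indicator (space M - A n) x"
        using x by (auto simp: indicator_def)
    qed
    also have "\<dots> = \<bar>t\<bar> * expectation (\<lambda>x. indicator (A n) x * \<bar>U n x - V n x\<bar>) + 2 * prob (space M - A n)"
      using int i3 by simp
    finally show ?thesis .
  qed
  have "(\<lambda>n. char (distr M borel (U n)) t - char (distr M borel (V n)) t) \<longlonglongrightarrow> 0"
  proof (rule Lim_null_comparison)
    show "\<forall>\<^sub>F n in sequentially. norm (char (distr M borel (U n)) t - char (distr M borel (V n)) t)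
       \<le> \<bar>t\<bar> * w n + 2 * prob (space M - A n)"
      using le by eventually_elim
        (auto intro!: order_trans[OF b] mult_left_mono)
    show "(\<lambda>n. \<bar>t\<bar> * w n + 2 * prob (space M - A n)) \<longlonglongrightarrow> 0"
      by (rule tendsto_eq_intros w A' | simp)+
  qed
  from tendsto_add[OF this cV] show "(\<lambda>n. char (distr M borel (U n)) t) \<longlonglongrightarrow> char \<mu> t" by simp
qed

lemma weak_conv_m_scale:
  fixes Y :: "nat \<Rightarrow> 'a \<Rightarrow> real"
  assumes [measurable]: "\<And>n. Y n \<in> borel_measurable M"
    and V: "weak_conv_m (\<lambda>n. distr M borel (Y n)) \<mu>" and \<mu>: "real_distribution \<mu>"
  shows "weak_conv_m (\<lambda>n. distr M borel (\<lambda>x. c * Y n x)) (distr \<mu> borel (\<lambda>x. c * x))"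
proof (rule levy_continuity)
  interpret \<mu>: real_distribution \<mu> by fact
  show "real_distribution (distr M borel (\<lambda>x. c * Y n x))" for n
    by (rule real_distribution_distr) simp
  show "real_distribution (distr \<mu> borel (\<lambda>x. c * x))" by (rule \<mu>.real_distribution_distr) simp
  fix t
  have "(\<lambda>n. char (distr M borel (Y n)) (t * c)) \<longlonglongrightarrow> char \<mu> (t * c)"
    by (rule levy_continuity1[OF _ \<mu> V]) (rule real_distribution_distr, simp)
  moreover have "char (distr \<mu> borel (\<lambda>x. c * x)) t = char \<mu> (t * c)"
    by (subst \<mu>.char_distr) (simp_all add: char_def mult.assoc)
  ultimately show "(\<lambda>n. char (distr M borel (\<lambda>x. c * Y n x)) t) \<longlonglongrightarrow> char (distr \<mu> borel (\<lambda>x. c * x)) t"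
    by (simp add: char_distr mult.assoc)
qed

end

lemma real_distribution_normal_law: "0 \<le> v \<Longrightarrow> real_distribution (normal_law m v)"
proof (cases "v = 0")
  case True
  interpret prob_space "return borel m" by (rule prob_space_return) simp
  show ?thesis using True
    by (simp add: normal_law_def real_distribution_def real_distribution_axioms_def prob_space_axioms)
next
  case False
  assume "0 \<le> v"
  then interpret prob_space "density lborel (normal_density m (sqrt v))"
    using False by (intro prob_space_normal_density) simp
  show ?thesis using False
    by (simp add: normal_law_def real_distribution_def real_distribution_axioms_def prob_space_axioms)
qed

context iid_sample
begin

lemma clt_normal_law:
  fixes f :: "real \<Rightarrow> real"
  assumes [measurable]: "f \<in> borel_measurable borel"
    and sq: "integrable M (\<lambda>x. (f (X x))\<^sup>2)" and mean: "expectation (\<lambda>x. f (X x)) = 0"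
  shows "weak_conv_m (\<lambda>n. distr M borel (\<lambda>x. sqrt n * avg n f (\<lambda>k. Xs k x)))
     (normal_law 0 (expectation (\<lambda>x. (f (X x))\<^sup>2)))"
proof -
  define v where "v = expectation (\<lambda>x. (f (X x))\<^sup>2)"
  have v0: "0 \<le> v" by (simp add: v_def)
  have sqk: "integrable M (\<lambda>x. (f (Xs k x))\<^sup>2)" "expectation (\<lambda>x. (f (Xs k x))\<^sup>2) = v" for k
    using sq integrable_sample_iff[of "\<lambda>y. (f y)\<^sup>2" k] expectation_sample[of "\<lambda>y. (f y)\<^sup>2" k]
    by (auto simp: v_def)
  show ?thesis
  proof (cases "v = 0")
    case True
    \<comment> \<open>In the degenerate case almost surely all summands vanish, and every law in the
      sequence is already the point mass at \<open>0\<close>.\<close>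
    have AE0: "AE x in M. f (Xs k x) = 0" for k
      using integral_nonneg_eq_0_iff_AE[OF sqk(1)[of k]] sqk(2)[of k] True by simp
    have "distr M borel (\<lambda>x. sqrt n * avg n f (\<lambda>k. Xs k x)) = return borel 0" for n
    proof -
      have "AE x in M. \<forall>k. f (Xs k x) = 0" using AE0 by (simp add: AE_all_countable)
      then have "AE x in M. sqrt n * avg n f (\<lambda>k. Xs k x) = 0" by eventually_elim (simp add: avg_def)
      then have "distr M borel (\<lambda>x. sqrt n * avg n f (\<lambda>k. Xs k x)) = distr M borel (\<lambda>_. 0)"
        by (intro distr_cong_AE) auto
      then show ?thesis by (simp add: distr_const)
    qed
    then show ?thesis
      using True by (simp add: v_def[symmetric] normal_law_def weak_conv_m_def weak_conv_def)
  next
    case False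
    define \<sigma> where "\<sigma> = sqrt v"
    have \<sigma>: "\<sigma> > 0" "\<sigma>\<^sup>2 = v" using False v0 by (auto simp: \<sigma>_def)
    \<comment> \<open>The shift aligns the averages over \<open>1..n\<close> with sums over
      \<open>i < n\<close>.\<close>
    define Y where "Y i x = f (Xs (Suc i) x)" for i x
    have "weak_conv_m (\<lambda>n. distr M borel (\<lambda>x. (\<Sum>i<n. Y i x) / sqrt (real n * \<sigma>\<^sup>2))) std_normal_distribution"
    proof (rule central_limit_theorem_zero_mean)
      show "indep_vars (\<lambda>_. borel) Y UNIV"
      proof -
        have "indep_vars (\<lambda>_. borel) (\<lambda>i x. f (Xs i x)) UNIV"
          by (rule indep_vars_compose2[OF indep]) simp
        then have "indep_vars (\<lambda>_. borel) (\<lambda>i x. f (Xs i x)) (range Suc)"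
          by (rule indep_vars_subset) simp
        then show ?thesis
          unfolding Y_def[abs_def] by (rule indep_vars_reindex) simp
      qed
      show "expectation (Y n) = 0" for n
        unfolding Y_def using expectation_sample[of f "Suc n"] mean by simp
      then show "variance (Y n) = \<sigma>\<^sup>2" for n by (simp add: Y_def sqk \<sigma>)
      show "0 < \<sigma>" by (rule \<sigma>)
      show "integrable M (\<lambda>x. (Y n x)\<^sup>2)" for n by (simp add: Y_def sqk)
      show "distr M borel (Y n) = distr M borel (\<lambda>x. f (X x))" for n
        unfolding Y_def using distr_distr[of f borel borel "Xs (Suc n)" M] distr_distr[of f borel borel X M]
        by (simp add: ident comp_def)
    qed
    \<comment> \<open>The central limit theorem normalises by the standard deviation; multiplying by
      it restores the variance \<open>v\<close>.\<close>
    then have "weak_conv_m (\<lambda>n. distr M borel (\<lambda>x. \<sigma> * ((\<Sum>i<n. Y i x) / sqrt (real n * \<sigma>\<^sup>2))))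
       (distr std_normal_distribution borel (\<lambda>x. \<sigma> * x))"
      by (intro weak_conv_m_scale) (auto simp: Y_def real_dist_normal_dist)
    moreover have "distr std_normal_distribution borel (\<lambda>x. \<sigma> * x) = normal_law 0 v"
    proof -
      have "prob_space std_normal_distribution" by (rule prob_space_normal_density) simp
      then have "distributed std_normal_distribution lborel (\<lambda>x. 0 + \<sigma> * x) (normal_density (0 + \<sigma> * 0) (\<bar>\<sigma>\<bar> * 1))"
        by (intro prob_space.normal_density_affine)
          (use \<sigma> in \<open>auto simp: distributed_def distr_id2\<close>)
      then have "distr std_normal_distribution lborel (\<lambda>x. \<sigma> * x) = density lborel (normal_density 0 \<sigma>)"
        using \<sigma> by (auto simp: distributed_def)
      moreover have "distr std_normal_distribution lborel (\<lambda>x. \<sigma> * x) = distr std_normal_distribution borel (\<lambda>x. \<sigma> * x)"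
        by (rule distr_cong) auto
      ultimately show ?thesis using False by (simp add: normal_law_def \<sigma>_def)
    qed
    moreover have "\<sigma> * ((\<Sum>i<n. Y i x) / sqrt (real n * \<sigma>\<^sup>2)) = sqrt n * avg n f (\<lambda>k. Xs k x)" for n x
    proof (cases "n = 0")
      case False
      have "(\<Sum>i<n. Y i x) = (\<Sum>k=1..n. f (Xs k x))"
        unfolding Y_def by (rule sum.reindex_bij_witness[of _ "\<lambda>k. k - 1" Suc]) auto
      moreover define q where "q = sqrt (real n)"
      moreover have "q > 0" "real n = q * q" using False by (auto simp: q_def)
      moreover have "sqrt (real n * \<sigma>\<^sup>2) = q * \<sigma>" using \<sigma>(1) by (simp add: real_sqrt_mult q_def)
      ultimately show ?thesis using \<sigma>(1) by (simp add: avg_def)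
    qed (simp add: avg_def)
    ultimately show ?thesis by (simp add: v_def)
  qed
qed

end

section \<open>The remainder in mean square\<close>

context zero_bias_sample
begin

lemma pair_sigma_finite_M_\<nu>: "pair_sigma_finite M \<nu>"
  unfolding pair_sigma_finite_def
  using sigma_finite_measure_axioms finite_measure.axioms(1)[OF \<nu>_finite] by simp

lemma \<nu>_T4: "integrable \<nu> (\<lambda>t. (1 + \<bar>t\<bar>) ^ 4)"
proof (rule Bochner_Integration.integrable_bound)
  show "integrable \<nu> (\<lambda>t. 8 + 8 * t ^ 4)"
    by (intro Bochner_Integration.integrable_add integrable_mult_right \<nu>_int
        finite_measure.integrable_const[OF \<nu>_finite])
  have "(1 + \<bar>t\<bar>) ^ 4 \<le> 8 + 8 * t ^ 4" for t :: real
  proof -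
    have s: "(x + y)\<^sup>2 \<le> 2 * x\<^sup>2 + 2 * y\<^sup>2" for x y :: real
      using zero_le_power2[of "x - y"] by (simp add: power2_eq_square algebra_simps)
    have "(1 + \<bar>t\<bar>) ^ 4 = ((1 + \<bar>t\<bar>)\<^sup>2)\<^sup>2" by simp
    also have "\<dots> \<le> (2 * 1\<^sup>2 + 2 * \<bar>t\<bar>\<^sup>2)\<^sup>2" by (intro power_mono s) auto
    also have "\<dots> \<le> 2 * (2 * 1\<^sup>2)\<^sup>2 + 2 * (2 * \<bar>t\<bar>\<^sup>2)\<^sup>2" by (rule s)
    also have "\<dots> = 8 + 8 * t ^ 4" by (simp add: power_mult_distrib)
    finally show ?thesis .
  qed
  then show "AE t in \<nu>. norm ((1 + \<bar>t\<bar>) ^ 4) \<le> norm (8 + 8 * t ^ 4)"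
    by (intro always_eventually allI) (simp add: order_trans[OF _ abs_ge_self])
qed simp

definition weight_moment :: real where "weight_moment = (\<integral>t. (1 + \<bar>t\<bar>) ^ 4 \<partial>\<nu>)"

lemma weight_moment_nonneg: "0 \<le> weight_moment" unfolding weight_moment_def by simp

lemma linear_growth_integrable:
  fixes f g :: "real \<Rightarrow> real"
  assumes [measurable]: "f \<in> borel_measurable borel" "g \<in> borel_measurable borel"
    and f: "\<And>t. \<bar>f t\<bar> \<le> a * (1 + \<bar>t\<bar>)" and g: "\<And>t. \<bar>g t\<bar> \<le> b * (1 + \<bar>t\<bar>)"
  shows "integrable \<nu> (\<lambda>t. f t * g t)"
proof (rule Bochner_Integration.integrable_bound)
  show "integrable \<nu> (\<lambda>t. (a * b) * (1 + \<bar>t\<bar>) ^ 4)" using \<nu>_T4 by simp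
  have ab: "0 \<le> a" "0 \<le> b" using f[of 0] g[of 0] by auto
  have "\<bar>f t * g t\<bar> \<le> (a * b) * (1 + \<bar>t\<bar>) ^ 4" for t
  proof -
    have "\<bar>f t * g t\<bar> \<le> (a * (1 + \<bar>t\<bar>)) * (b * (1 + \<bar>t\<bar>))" by (rule abs_mult_mono[OF f g])
    also have "\<dots> = (a * b) * (1 + \<bar>t\<bar>)\<^sup>2" by (simp add: power2_eq_square)
    also have "\<dots> \<le> (a * b) * (1 + \<bar>t\<bar>) ^ 4"
      using power_increasing[of 2 4 "1 + \<bar>t\<bar>"] ab by (intro mult_left_mono) auto
    finally show ?thesis .
  qed
  then show "AE t in \<nu>. norm (f t * g t) \<le> norm ((a * b) * (1 + \<bar>t\<bar>) ^ 4)"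
    by (intro always_eventually allI) (auto intro: order_trans[OF _ abs_ge_self])
qed simp

lemma linear_growth_sq_integrable:
  fixes f :: "real \<Rightarrow> real"
  assumes "f \<in> borel_measurable borel" and "\<And>t. \<bar>f t\<bar> \<le> a * (1 + \<bar>t\<bar>)"
  shows "integrable \<nu> (\<lambda>t. (f t)\<^sup>2)"
  unfolding power2_eq_square by (rule linear_growth_integrable[OF assms(1) assms(1) assms(2) assms(2)])

lemma Fm_measurable [measurable]: "Fm \<in> borel_measurable borel"
  unfolding Fm_def[abs_def] by (rule borel_measurable_lebesgue_integral) measurable

lemma Bm_measurable [measurable]: "Bm \<in> borel_measurable borel"
  unfolding Bm_def[abs_def] by (rule borel_measurable_lebesgue_integral) measurable

lemma zb_density_measurable [measurable]: "zb_density M X \<in> borel_measurable borel"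
  unfolding zb_density_eq[abs_def]
  by (intro borel_measurable_uminus borel_measurable_lebesgue_integral) measurable

lemma c1_measurable [measurable]: "(\<lambda>(t, y). c1 t y) \<in> borel_measurable (borel \<Otimes>\<^sub>M borel)"
proof -
  have [measurable]: "(\<lambda>t. expectation (\<lambda>x. (X x - t) * ind t (X x))) \<in> borel_measurable borel"
    by (rule borel_measurable_lebesgue_integral) measurable
  show ?thesis unfolding c1_def by measurable
qed

definition Dm :: "real \<Rightarrow> real" where "Dm t = Bm t - Fm t"

lemma Dm_measurable [measurable]: "Dm \<in> borel_measurable borel"
  unfolding Dm_def[abs_def] by measurable

lemma Dm_le: "\<bar>Dm t\<bar> \<le> 2 * (1 + \<bar>t\<bar>)"
  using Bm_le[of t] Fm_le[of t] unfolding Dm_def by simp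

text \<open>The first five summands of \<open>c1\<close> contribute
  \<open>2 + 1 + 1 + 1 + 1\<close>, the last one \<open>2 * (1 + P)\<close>.\<close>

definition c1_const :: real where "c1_const = 8 + 2 * P"

lemma c1_const_nonneg: "0 \<le> c1_const" using P_nonneg by (simp add: c1_const_def)

lemma c1_growth: "\<bar>c1 t y\<bar> \<le> c1_const * (1 + y\<^sup>2) * (1 + \<bar>t\<bar>)"
proof -
  let ?T = "1 + \<bar>t\<bar>" let ?Y = "1 + y\<^sup>2"
  have "0 \<le> (\<bar>y\<bar> - 1)\<^sup>2" by simp
  then have y: "\<bar>y\<bar> \<le> ?Y" unfolding power2_diff by simp
  have E: "expectation (\<lambda>x. (X x - t) * ind t (X x)) = - Im t"
    unfolding Im_def integral_minus[symmetric] by (simp add: algebra_simps)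
  have YT: "1 * 1 \<le> ?Y * ?T" by (rule mult_mono) auto
  have 1: "\<bar>y * (y - t) * ind t y\<bar> \<le> 2 * (?Y * ?T)"
    by (rule order_trans[OF zb_kernel_growth]) (simp add: algebra_simps)
  have 2: "\<bar>y * - Im t\<bar> \<le> ?Y * ?T" by (intro abs_mult_mono y) (simp add: Im_le)
  have 3: "\<bar>y\<^sup>2 * Bm t\<bar> \<le> ?Y * ?T" by (intro abs_mult_mono Bm_le) simp
  have 4: "\<bar>ind t y\<bar> \<le> ?Y * ?T" using YT by (simp add: ind_def)
  have 5: "\<bar>Fm t\<bar> \<le> ?Y * ?T" using YT Fm_le[of t] by simp
  have "\<bar>1/2 * (1 - y\<^sup>2)\<bar> \<le> ?Y" by (simp add: abs_le_iff)
  then have "\<bar>1/2 * (1 - y\<^sup>2) * t - y\<bar> \<le> ?Y * ?T + ?Y * ?T"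
    by (intro abs_diff_mono abs_mult_mono) (use mult_mono[OF y, of 1 ?T] in auto)
  moreover have "\<bar>zb_density M X t - p t\<bar> \<le> 1 + P"
    by (intro abs_diff_mono zb_density_le) (use p_le p_nonneg in auto)
  ultimately have 6: "\<bar>(1/2 * (1 - y\<^sup>2) * t - y) * (zb_density M X t - p t)\<bar>
      \<le> (?Y * ?T + ?Y * ?T) * (1 + P)" by (rule abs_mult_mono)
  have "\<bar>c1 t y\<bar> \<le> 2 * (?Y * ?T) + ?Y * ?T + ?Y * ?T + ?Y * ?T + ?Y * ?T + (?Y * ?T + ?Y * ?T) * (1 + P)"
    unfolding c1_def E by (intro abs_diff_mono abs_add_mono 1 2 3 4 5 6)
  also have "\<dots> = c1_const * ?Y * ?T" by (simp add: c1_const_def algebra_simps)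
  finally show ?thesis .
qed

lemma c1_growth_t: "\<bar>c1 t y\<bar> \<le> (c1_const * (1 + y\<^sup>2)) * (1 + \<bar>t\<bar>)"
  using c1_growth by simp

lemma c1_growth_y: "\<bar>c1 t y\<bar> \<le> (c1_const * (1 + \<bar>t\<bar>)) * (1 + y\<^sup>2)"
  using c1_growth[of t y] by (simp add: mult.assoc mult.commute mult.left_commute)

lemma c1_sq_int: "integrable M (\<lambda>x. (c1 t (X x))\<^sup>2)"
  by (rule square_integrable_quadratic_growth[OF _ c1_growth_y]) simp

text \<open>The means of the kernel and of the indicator cancel against \<open>Bm t\<close> and
  \<open>Fm t\<close> because \<open>E X^2 = 1\<close>; the remaining terms are multiples of
  \<open>X\<close> and \<open>1 - X^2\<close>, both centred by the standardisation.\<close>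

lemma c1_mean: "expectation (\<lambda>x. c1 t (X x)) = 0"
proof -
  let ?g = "zb_density M X t - p t" and ?E = "expectation (\<lambda>x. (X x - t) * ind t (X x))"
  have "expectation (\<lambda>x. c1 t (X x)) = expectation (\<lambda>x. X x * (X x - t) * ind t (X x) - ?E * X x - Bm t * (X x)\<^sup>2
      - ind t (X x) + Fm t - (?g * t / 2 - ?g * t / 2 * (X x)\<^sup>2 - ?g * X x))"
    by (rule Bochner_Integration.integral_cong) (auto simp: c1_def algebra_simps diff_divide_distrib)
  also have "\<dots> = Bm t - Bm t - Fm t + Fm t"
    using zb_kernel_int X_int X2_int ind_int
    by (simp add: X_mean X_sq prob_space Bm_def[symmetric] Fm_def[symmetric])
  finally show ?thesis by simp
qed

lemma c1_second_moment: "expectation (\<lambda>x. (c1 t (X x))\<^sup>2) \<le> c1_const\<^sup>2 * (3 + fourth_moment) * (1 + \<bar>t\<bar>)\<^sup>2"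
proof -
  have "\<bar>expectation (\<lambda>x. (c1 t (X x))\<^sup>2)\<bar>
      \<le> expectation (\<lambda>x. c1_const\<^sup>2 * (1 + \<bar>t\<bar>)\<^sup>2 * (1 + 2 * (X x)\<^sup>2 + (X x) ^ 4))"
  proof (rule abs_integral_le)
    fix x
    have "(c1 t (X x))\<^sup>2 \<le> (c1_const * (1 + \<bar>t\<bar>) * (1 + (X x)\<^sup>2))\<^sup>2"
      using power_mono[OF c1_growth_y abs_ge_zero, of t "X x" 2] by simp
    also have "\<dots> = c1_const\<^sup>2 * (1 + \<bar>t\<bar>)\<^sup>2 * (1 + 2 * (X x)\<^sup>2 + (X x) ^ 4)"
      by (simp add: power_mult_distrib power2_sum[of 1 "(X x)\<^sup>2"] power_mult[symmetric])
    finally show "\<bar>(c1 t (X x))\<^sup>2\<bar> \<le> c1_const\<^sup>2 * (1 + \<bar>t\<bar>)\<^sup>2 * (1 + 2 * (X x)\<^sup>2 + (X x) ^ 4)" by simp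
  qed (use X2_int X4_int in auto)
  also have "\<dots> = c1_const\<^sup>2 * (1 + \<bar>t\<bar>)\<^sup>2 * (3 + fourth_moment)"
    using X2_int X4_int by (simp add: X_sq fourth_moment_def prob_space)
  finally show ?thesis by (simp add: mult.commute mult.left_commute)
qed

abbreviation smp :: "'a \<Rightarrow> nat \<Rightarrow> real" where "smp x \<equiv> (\<lambda>j. Xs j x)"

lemma dn_measurable [measurable]: "(\<lambda>(x, t). dn n (smp x) t) \<in> borel_measurable (M \<Otimes>\<^sub>M borel)"
  unfolding dn_def scaled_residual_def sample_var_def sample_mean_def indicator_atMost_eq_ind
  by measurable

lemma dn_measurable_t [measurable]: "dn n xs \<in> borel_measurable borel"
  unfolding dn_def[abs_def] indicator_atMost_eq_ind by measurable

lemma avg_c1_measurable [measurable]: "(\<lambda>(x, t). avg n (c1 t) (smp x)) \<in> borel_measurable (M \<Otimes>\<^sub>M borel)"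
  unfolding avg_def by measurable

lemma avg_c1_measurable_t [measurable]: "(\<lambda>t. avg n (c1 t) xs) \<in> borel_measurable borel"
  unfolding avg_def by measurable

lemma avg_c1_growth: "\<exists>a. \<forall>t. \<bar>avg n (c1 t) xs\<bar> \<le> a * (1 + \<bar>t\<bar>)"
proof -
  have "\<bar>avg n (c1 t) xs\<bar> \<le> avg n (\<lambda>y. c1_const * (1 + y\<^sup>2)) xs * (1 + \<bar>t\<bar>)" for t
  proof -
    have "\<bar>avg n (c1 t) xs\<bar> \<le> avg n (\<lambda>y. (1 + \<bar>t\<bar>) * (c1_const * (1 + y\<^sup>2))) xs"
      by (rule abs_avg_le) (use c1_growth_t in \<open>simp add: mult.commute\<close>)
    then show ?thesis unfolding avg_cmult by (simp add: mult.commute)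
  qed
  then show ?thesis by blast
qed

text \<open>For \<open>k <= 1/4\<close> the sample variance is at least \<open>1/2\<close> here and
  \<open>remainder_pointwise\<close> applies.\<close>

definition moment_event :: "nat \<Rightarrow> real \<Rightarrow> 'a set" where
  "moment_event n k = {x \<in> space M. \<bar>avg n (\<lambda>y. y) (smp x)\<bar> \<le> k \<and> \<bar>avg n (\<lambda>y. y\<^sup>2) (smp x) - 1\<bar> \<le> k}"

lemma moment_event_events [measurable]: "moment_event n k \<in> events"
  unfolding moment_event_def avg_def by measurable

text \<open>Chebyshev's inequality, with the raw second moment in place of the variance.\<close>

lemma prob_dev_gt:
  assumes [measurable]: "f \<in> borel_measurable borel"
    and sq: "integrable M (\<lambda>x. (f (X x))\<^sup>2)" and n: "n > 0" and k: "k > 0"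
  shows "prob {x \<in> space M. k < \<bar>dev n f (smp x)\<bar>} \<le> expectation (\<lambda>x. (f (X x))\<^sup>2) / (n * k\<^sup>2)"
proof -
  define q where "q x = dev n f (smp x)" for x
  have [measurable]: "q \<in> borel_measurable M"
    unfolding q_def dev_def avg_def by measurable
  note d = dev_second_moment[OF assms(1-3), folded q_def]
  have "prob {x \<in> space M. k < \<bar>q x\<bar>} \<le> prob {x \<in> space M. k\<^sup>2 \<le> (q x)\<^sup>2}"
  proof (rule finite_measure_mono)
    have "k\<^sup>2 \<le> r\<^sup>2" if "k < \<bar>r\<bar>" for r :: real
    proof -
      have "k\<^sup>2 \<le> \<bar>r\<bar>\<^sup>2" by (rule power_mono) (use that k in linarith)+
      then show ?thesis by simp
    qed
    then show "{x \<in> space M. k < \<bar>q x\<bar>} \<subseteq> {x \<in> space M. k\<^sup>2 \<le> (q x)\<^sup>2}"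
      by (intro Collect_mono impI conjI) (auto dest: conjunct1)
    show "{x \<in> space M. k\<^sup>2 \<le> (q x)\<^sup>2} \<in> events" by measurable
  qed
  also have "\<dots> \<le> expectation (\<lambda>x. (q x)\<^sup>2) / k\<^sup>2"
    by (rule integral_Markov_inequality_measure[OF d(1) sets.empty_sets AE_I2[OF zero_le_power2] zero_less_power[OF k]])
  also have "\<dots> \<le> (expectation (\<lambda>x. (f (X x))\<^sup>2) / n) / k\<^sup>2"
    by (rule divide_right_mono[OF d(2) zero_le_power2])
  finally show ?thesis unfolding q_def by (simp only: divide_divide_eq_left)
qed

lemma prob_moment_event_compl:
  assumes n: "n > 0" and k: "k > 0"
  shows "prob (space M - moment_event n k) \<le> (1 + fourth_moment) / (n * k\<^sup>2)"
proof -
  have 1: "dev n (\<lambda>y. y) xs = avg n (\<lambda>y. y) xs" for xs by (simp add: dev_def X_mean)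
  have 2: "dev n (\<lambda>y. y\<^sup>2) xs = avg n (\<lambda>y. y\<^sup>2) xs - 1" for xs by (simp add: dev_def X_sq)
  let ?A = "\<lambda>f. {x \<in> space M. k < \<bar>dev n f (smp x)\<bar>}"
  have m: "?A (\<lambda>y. y) \<in> events" "?A (\<lambda>y. y\<^sup>2) \<in> events"
    unfolding dev_def avg_def by measurable
  have "prob (space M - moment_event n k) \<le> prob (?A (\<lambda>y. y) \<union> ?A (\<lambda>y. y\<^sup>2))"
    by (rule finite_measure_mono) (use m in \<open>auto simp: moment_event_def 1 2 not_le\<close>)
  also have "\<dots> \<le> prob (?A (\<lambda>y. y)) + prob (?A (\<lambda>y. y\<^sup>2))"
    by (rule measure_Un_le[OF m])
  also have "\<dots> \<le> expectation (\<lambda>x. (X x)\<^sup>2) / (n * k\<^sup>2) + expectation (\<lambda>x. ((X x)\<^sup>2)\<^sup>2) / (n * k\<^sup>2)"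
    by (intro add_mono prob_dev_gt n k) (use X2_int X4_int in auto)
  also have "\<dots> = (1 + fourth_moment) / (n * k\<^sup>2)" by (simp add: X_sq fourth_moment_def add_divide_distrib)
  finally show ?thesis .
qed

definition remainder :: "nat \<Rightarrow> (nat \<Rightarrow> real) \<Rightarrow> real \<Rightarrow> real" where
  "remainder n xs t = dn n xs t - Dm t - avg n (c1 t) xs"

lemma remainder_measurable [measurable]: "(\<lambda>(x, t). remainder n (smp x) t) \<in> borel_measurable (M \<Otimes>\<^sub>M borel)"
  unfolding remainder_def by measurable

lemma remainder_measurable_t [measurable]: "remainder n xs \<in> borel_measurable borel"
  unfolding remainder_def[abs_def] by measurable

lemma remainder_growth: "\<exists>a. \<forall>t. \<bar>remainder n xs t\<bar> \<le> a * (1 + \<bar>t\<bar>)"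
proof -
  obtain a where a: "\<And>t. \<bar>dn n xs t\<bar> \<le> a * (1 + \<bar>t\<bar>)" using dn_linear_growth by blast
  obtain b where b: "\<And>t. \<bar>avg n (c1 t) xs\<bar> \<le> b * (1 + \<bar>t\<bar>)" using avg_c1_growth by blast
  have "\<bar>remainder n xs t\<bar> \<le> (a + 2 + b) * (1 + \<bar>t\<bar>)" for t
  proof -
    have "\<bar>remainder n xs t\<bar> \<le> a * (1 + \<bar>t\<bar>) + 2 * (1 + \<bar>t\<bar>) + b * (1 + \<bar>t\<bar>)"
      unfolding remainder_def by (intro abs_diff_mono a b Dm_le)
    then show ?thesis by (simp add: algebra_simps)
  qed
  then show ?thesis by blast
qed

text \<open>On the event the squared error lies below the majorant, whose mean is known for each
  \<open>t\<close>. Nonnegative integrals let Tonelli's theorem exchange the order before any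
  integrability on the product is available; integrability then follows from the finite
  bound.\<close>

lemma remainder_L2:
  assumes n: "n > 0" and N: "N > 0" and k: "0 \<le> k" "k \<le> 1/4"
  shows "integrable M (\<lambda>x. indicator (moment_event n k) x * (\<integral>t. (remainder n (smp x) t)\<^sup>2 \<partial>\<nu>))"
    and "expectation (\<lambda>x. indicator (moment_event n k) x * (\<integral>t. (remainder n (smp x) t)\<^sup>2 \<partial>\<nu>)) \<le> majorant_rate n N k * weight_moment"
proof -
  interpret p\<nu>: pair_sigma_finite M \<nu> by (rule pair_sigma_finite_M_\<nu>)
  have fourth_moment: "fourth_moment \<ge> 0" unfolding fourth_moment_def by simp
  have r0: "0 \<le> majorant_rate n N k" unfolding majorant_rate_def using fourth_moment P_nonneg k by simp
  have [measurable]: "(\<lambda>x. \<integral>t. (remainder n (smp x) t)\<^sup>2 \<partial>\<nu>) \<in> borel_measurable M"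
    by (rule p\<nu>.M2.borel_measurable_lebesgue_integral) measurable
  have ZM [measurable]: "(\<lambda>(x, t). majorant n N k t (smp x)) \<in> borel_measurable (M \<Otimes>\<^sub>M \<nu>)"
    using majorant_measurable by measurable
  have Z0: "0 \<le> majorant n N k t xs" for t xs
    unfolding majorant_def by (intro mult_nonneg_nonneg add_nonneg_nonneg sum_nonneg) auto
  have "(\<integral>\<^sup>+x. ennreal (indicator (moment_event n k) x * (\<integral>t. (remainder n (smp x) t)\<^sup>2 \<partial>\<nu>)) \<partial>M)
      \<le> (\<integral>\<^sup>+x. (\<integral>\<^sup>+t. ennreal (majorant n N k t (smp x)) \<partial>\<nu>) \<partial>M)"
  proof (rule nn_integral_mono)
    fix x assume x: "x \<in> space M"
    show "ennreal (indicator (moment_event n k) x * (\<integral>t. (remainder n (smp x) t)\<^sup>2 \<partial>\<nu>)) \<le> (\<integral>\<^sup>+t. ennreal (majorant n N k t (smp x)) \<partial>\<nu>)"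
    proof (cases "x \<in> moment_event n k")
      case True
      obtain a where a: "\<And>t. \<bar>remainder n (smp x) t\<bar> \<le> a * (1 + \<bar>t\<bar>)" using remainder_growth by blast
      have "ennreal (\<integral>t. (remainder n (smp x) t)\<^sup>2 \<partial>\<nu>) = (\<integral>\<^sup>+t. ennreal ((remainder n (smp x) t)\<^sup>2) \<partial>\<nu>)"
        by (intro nn_integral_eq_integral[symmetric] linear_growth_sq_integrable[OF _ a]) auto
      also have "\<dots> \<le> (\<integral>\<^sup>+t. ennreal (majorant n N k t (smp x)) \<partial>\<nu>)"
        by (intro nn_integral_mono ennreal_leI)
          (unfold remainder_def Dm_def, rule remainder_sq_le_majorant[OF n N k], use True in \<open>auto simp: moment_event_def\<close>)
      finally show ?thesis using True by simp
    qed simp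
  qed
  also have "\<dots> = (\<integral>\<^sup>+t. (\<integral>\<^sup>+x. ennreal (majorant n N k t (smp x)) \<partial>M) \<partial>\<nu>)"
    by (rule p\<nu>.Fubini'[symmetric]) measurable
  also have "\<dots> \<le> (\<integral>\<^sup>+t. ennreal (majorant_rate n N k * (1 + \<bar>t\<bar>) ^ 4) \<partial>\<nu>)"
  proof (rule nn_integral_mono)
    fix t
    have "(\<integral>\<^sup>+x. ennreal (majorant n N k t (smp x)) \<partial>M) = ennreal (expectation (\<lambda>x. majorant n N k t (smp x)))"
      by (rule nn_integral_eq_integral[OF expectation_majorant(1)[OF n N k(1)]]) (simp add: Z0)
    also have "\<dots> \<le> ennreal (majorant_rate n N k * (1 + \<bar>t\<bar>) ^ 4)"
      by (rule ennreal_leI[OF expectation_majorant(2)[OF n N k(1)]])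
    finally show "(\<integral>\<^sup>+x. ennreal (majorant n N k t (smp x)) \<partial>M) \<le> ennreal (majorant_rate n N k * (1 + \<bar>t\<bar>) ^ 4)" .
  qed
  also have "\<dots> = ennreal (\<integral>t. majorant_rate n N k * (1 + \<bar>t\<bar>) ^ 4 \<partial>\<nu>)"
    by (rule nn_integral_eq_integral) (use \<nu>_T4 r0 in auto)
  also have "\<dots> = ennreal (majorant_rate n N k * weight_moment)" by (simp add: weight_moment_def)
  finally have b: "(\<integral>\<^sup>+x. ennreal (indicator (moment_event n k) x * (\<integral>t. (remainder n (smp x) t)\<^sup>2 \<partial>\<nu>)) \<partial>M) \<le> ennreal (majorant_rate n N k * weight_moment)" .
  show "integrable M (\<lambda>x. indicator (moment_event n k) x * (\<integral>t. (remainder n (smp x) t)\<^sup>2 \<partial>\<nu>))"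
    "expectation (\<lambda>x. indicator (moment_event n k) x * (\<integral>t. (remainder n (smp x) t)\<^sup>2 \<partial>\<nu>)) \<le> majorant_rate n N k * weight_moment"
    by (rule integrable_nn_bound[OF _ _ b], use r0 weight_moment_nonneg in \<open>auto\<close>)+
qed

text \<open>The average of the centred kernel has mean square of order \<open>1 / n\<close> at each
  \<open>t\<close>. The square of the linear part therefore contributes only order
  \<open>1 / sqrt n\<close> after scaling.\<close>

lemma linear_part_L2:
  assumes n: "n > 0"
  shows "integrable M (\<lambda>x. \<integral>t. (avg n (c1 t) (smp x))\<^sup>2 \<partial>\<nu>)"
    and "expectation (\<lambda>x. \<integral>t. (avg n (c1 t) (smp x))\<^sup>2 \<partial>\<nu>) \<le> c1_const\<^sup>2 * (3 + fourth_moment) * weight_moment / n"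
proof -
  interpret p\<nu>: pair_sigma_finite M \<nu> by (rule pair_sigma_finite_M_\<nu>)
  have fourth_moment: "fourth_moment \<ge> 0" unfolding fourth_moment_def by simp
  have [measurable]: "(\<lambda>x. \<integral>t. (avg n (c1 t) (smp x))\<^sup>2 \<partial>\<nu>) \<in> borel_measurable M"
    by (rule p\<nu>.M2.borel_measurable_lebesgue_integral) measurable
  have "(\<integral>\<^sup>+x. ennreal (\<integral>t. (avg n (c1 t) (smp x))\<^sup>2 \<partial>\<nu>) \<partial>M)
      = (\<integral>\<^sup>+x. (\<integral>\<^sup>+t. ennreal ((avg n (c1 t) (smp x))\<^sup>2) \<partial>\<nu>) \<partial>M)"
  proof (rule nn_integral_cong)
    fix x
    obtain a where a: "\<And>t. \<bar>avg n (c1 t) (smp x)\<bar> \<le> a * (1 + \<bar>t\<bar>)" using avg_c1_growth by blast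
    show "ennreal (\<integral>t. (avg n (c1 t) (smp x))\<^sup>2 \<partial>\<nu>) = (\<integral>\<^sup>+t. ennreal ((avg n (c1 t) (smp x))\<^sup>2) \<partial>\<nu>)"
      by (intro nn_integral_eq_integral[symmetric] linear_growth_sq_integrable[OF _ a]) auto
  qed
  also have "\<dots> = (\<integral>\<^sup>+t. (\<integral>\<^sup>+x. ennreal ((avg n (c1 t) (smp x))\<^sup>2) \<partial>M) \<partial>\<nu>)"
    by (rule p\<nu>.Fubini'[symmetric]) measurable
  also have "\<dots> \<le> (\<integral>\<^sup>+t. ennreal (c1_const\<^sup>2 * (3 + fourth_moment) / n * (1 + \<bar>t\<bar>) ^ 4) \<partial>\<nu>)"
  proof (rule nn_integral_mono)
    fix t
    have "(\<integral>\<^sup>+x. ennreal ((dev n (c1 t) (smp x))\<^sup>2) \<partial>M) \<le> ennreal (c1_const\<^sup>2 * (3 + fourth_moment) * (1 + \<bar>t\<bar>) ^ 4 / n)"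
    proof (rule nn_dev_second_moment[OF _ c1_sq_int n])
      have "expectation (\<lambda>x. (c1 t (X x))\<^sup>2) \<le> c1_const\<^sup>2 * (3 + fourth_moment) * (1 + \<bar>t\<bar>)\<^sup>2" by (rule c1_second_moment)
      also have "\<dots> \<le> c1_const\<^sup>2 * (3 + fourth_moment) * (1 + \<bar>t\<bar>) ^ 4"
        using power_increasing[of 2 4 "1 + \<bar>t\<bar>"] fourth_moment by (intro mult_left_mono) auto
      finally show "expectation (\<lambda>x. (c1 t (X x))\<^sup>2) \<le> c1_const\<^sup>2 * (3 + fourth_moment) * (1 + \<bar>t\<bar>) ^ 4" .
    qed simp
    then show "(\<integral>\<^sup>+x. ennreal ((avg n (c1 t) (smp x))\<^sup>2) \<partial>M) \<le> ennreal (c1_const\<^sup>2 * (3 + fourth_moment) / n * (1 + \<bar>t\<bar>) ^ 4)"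
      by (simp add: dev_def c1_mean)
  qed
  also have "\<dots> = ennreal (\<integral>t. c1_const\<^sup>2 * (3 + fourth_moment) / n * (1 + \<bar>t\<bar>) ^ 4 \<partial>\<nu>)"
    by (rule nn_integral_eq_integral) (use \<nu>_T4 fourth_moment in auto)
  also have "\<dots> = ennreal (c1_const\<^sup>2 * (3 + fourth_moment) * weight_moment / n)" by (simp add: weight_moment_def)
  finally have b: "(\<integral>\<^sup>+x. ennreal (\<integral>t. (avg n (c1 t) (smp x))\<^sup>2 \<partial>\<nu>) \<partial>M) \<le> ennreal (c1_const\<^sup>2 * (3 + fourth_moment) * weight_moment / n)" .
  show "integrable M (\<lambda>x. \<integral>t. (avg n (c1 t) (smp x))\<^sup>2 \<partial>\<nu>)"
    "expectation (\<lambda>x. \<integral>t. (avg n (c1 t) (smp x))\<^sup>2 \<partial>\<nu>) \<le> c1_const\<^sup>2 * (3 + fourth_moment) * weight_moment / n"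
    by (rule integrable_nn_bound[OF _ _ b], use fourth_moment weight_moment_nonneg in \<open>auto\<close>)+
qed

section \<open>The influence function\<close>

text \<open>The derivative of the squared norm in the space of square-integrable functions for
  \<open>\<nu>\<close>, at the point \<open>Dm\<close> and in the direction of the kernel at
  \<open>y\<close>.\<close>

definition xi :: "real \<Rightarrow> real" where "xi y = 2 * (\<integral>t. c1 t y * Dm t \<partial>\<nu>)"

definition stat :: "nat \<Rightarrow> 'a \<Rightarrow> real" where
  "stat n x = sqrt n * ((\<integral>t. (dn n (smp x) t)\<^sup>2 \<partial>\<nu>) - (\<integral>t. (Dm t)\<^sup>2 \<partial>\<nu>))"

lemma c1_Dm_integrable: "integrable \<nu> (\<lambda>t. c1 t y * Dm t)"
  by (rule linear_growth_integrable[OF _ _ c1_growth_t Dm_le]) simp_all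

lemma avg_xi: "avg n xi xs = 2 * (\<integral>t. avg n (c1 t) xs * Dm t \<partial>\<nu>)"
proof -
  have "(\<integral>t. avg n (c1 t) xs * Dm t \<partial>\<nu>) = (\<integral>t. (\<Sum>k=1..n. c1 t (xs k) * Dm t) / n \<partial>\<nu>)"
    by (rule Bochner_Integration.integral_cong) (auto simp: avg_def sum_distrib_right)
  also have "\<dots> = (\<Sum>k=1..n. \<integral>t. c1 t (xs k) * Dm t \<partial>\<nu>) / n"
    by (simp add: Bochner_Integration.integral_sum c1_Dm_integrable)
  finally have "(\<integral>t. avg n (c1 t) xs * Dm t \<partial>\<nu>) = (\<Sum>k=1..n. \<integral>t. c1 t (xs k) * Dm t \<partial>\<nu>) / n" .
  moreover have "avg n xi xs = 2 * ((\<Sum>k=1..n. \<integral>t. c1 t (xs k) * Dm t \<partial>\<nu>) / n)"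
    by (simp add: avg_def xi_def sum_distrib_left)
  ultimately show ?thesis by (simp only:)
qed

text \<open>With \<open>L\<close> the linear part and \<open>r\<close> the remainder,
  \<open>(D + L + r)^2 - D^2 - 2 * L * D = 2 * r * D + (L + r)^2\<close>. Young's inequality with
  the free parameter \<open>e\<close> separates \<open>r\<close> from \<open>D\<close>, so that only
  the integral of \<open>r^2\<close> occurs, linearly, and expectations can be taken
  directly.\<close>

lemma stat_decomposition:
  assumes e: "e > 0" and n: "n > 0"
  shows "\<bar>stat n x - sqrt n * avg n xi (smp x)\<bar>
    \<le> (n / e + 2 * sqrt n) * (\<integral>t. (remainder n (smp x) t)\<^sup>2 \<partial>\<nu>) + e * (\<integral>t. (Dm t)\<^sup>2 \<partial>\<nu>)
      + 2 * sqrt n * (\<integral>t. (avg n (c1 t) (smp x))\<^sup>2 \<partial>\<nu>)"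
proof -
  let ?l = "\<lambda>t. avg n (c1 t) (smp x)" and ?r = "remainder n (smp x)" and ?d = "dn n (smp x)"
  obtain b where b: "\<And>t. \<bar>?l t\<bar> \<le> b * (1 + \<bar>t\<bar>)" using avg_c1_growth by blast
  obtain a where a: "\<And>t. \<bar>?r t\<bar> \<le> a * (1 + \<bar>t\<bar>)" using remainder_growth by blast
  obtain c where c: "\<And>t. \<bar>?d t\<bar> \<le> c * (1 + \<bar>t\<bar>)" using dn_linear_growth by blast
  note i = linear_growth_sq_integrable[OF remainder_measurable_t a]
    linear_growth_sq_integrable[OF avg_c1_measurable_t b]
    linear_growth_sq_integrable[OF dn_measurable_t c] linear_growth_sq_integrable[OF Dm_measurable Dm_le]
    linear_growth_integrable[OF avg_c1_measurable_t Dm_measurable b Dm_le]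
  have eq: "stat n x - sqrt n * avg n xi (smp x) = (\<integral>t. sqrt n * ((?d t)\<^sup>2 - (Dm t)\<^sup>2 - 2 * (?l t * Dm t)) \<partial>\<nu>)"
    using i by (simp add: stat_def avg_xi algebra_simps)
  have "\<bar>stat n x - sqrt n * avg n xi (smp x)\<bar> \<le> (\<integral>t. (n / e + 2 * sqrt n) * (?r t)\<^sup>2 + e * (Dm t)\<^sup>2 + 2 * sqrt n * (?l t)\<^sup>2 \<partial>\<nu>)"
    unfolding eq
  proof (rule abs_integral_le)
    fix t
    have d: "?d t = Dm t + ?l t + ?r t" by (simp add: remainder_def)
    have e1: "sqrt n * ((?d t)\<^sup>2 - (Dm t)\<^sup>2 - 2 * (?l t * Dm t))
       = 2 * (sqrt n * ?r t) * Dm t + sqrt n * (?l t + ?r t)\<^sup>2"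
      unfolding d by (simp add: power2_eq_square algebra_simps)
    have "\<bar>2 * (sqrt n * ?r t) * Dm t\<bar> \<le> n / e * (?r t)\<^sup>2 + e * (Dm t)\<^sup>2"
    proof -
      have "\<bar>2 * u * w\<bar> \<le> u\<^sup>2 / e + e * w\<^sup>2" for u w :: real
      proof -
        have "0 \<le> (\<bar>u\<bar> - e * \<bar>w\<bar>)\<^sup>2 / e" using e by simp
        also have "\<dots> = u\<^sup>2 / e + e * w\<^sup>2 - \<bar>2 * u * w\<bar>"
          using e by (simp add: power2_eq_square field_simps abs_mult)
        finally show ?thesis by simp
      qed
      from this[of "sqrt n * ?r t" "Dm t"] show ?thesis
        by (simp add: power_mult_distrib)
    qed
    moreover have "\<bar>sqrt n * (?l t + ?r t)\<^sup>2\<bar> \<le> sqrt n * (2 * (?l t)\<^sup>2 + 2 * (?r t)\<^sup>2)"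
    proof -
      have "(?l t + ?r t)\<^sup>2 \<le> 2 * (?l t)\<^sup>2 + 2 * (?r t)\<^sup>2"
        using zero_le_power2[of "?l t - ?r t"] by (simp add: power2_eq_square algebra_simps)
      then show ?thesis by (simp add: abs_mult mult_left_mono)
    qed
    ultimately have "\<bar>2 * (sqrt n * ?r t) * Dm t + sqrt n * (?l t + ?r t)\<^sup>2\<bar>
      \<le> (n / e * (?r t)\<^sup>2 + e * (Dm t)\<^sup>2) + sqrt n * (2 * (?l t)\<^sup>2 + 2 * (?r t)\<^sup>2)"
      by (rule abs_add_mono)
    then show "\<bar>sqrt n * ((?d t)\<^sup>2 - (Dm t)\<^sup>2 - 2 * (?l t * Dm t))\<bar>
       \<le> (n / e + 2 * sqrt n) * (?r t)\<^sup>2 + e * (Dm t)\<^sup>2 + 2 * sqrt n * (?l t)\<^sup>2"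
      unfolding e1 by (simp add: algebra_simps)
  next
    show "integrable \<nu> (\<lambda>t. (n / e + 2 * sqrt n) * (?r t)\<^sup>2 + e * (Dm t)\<^sup>2 + 2 * sqrt n * (?l t)\<^sup>2)"
      by (intro Bochner_Integration.integrable_add integrable_mult_right i)
    show "(\<lambda>t. sqrt n * ((?d t)\<^sup>2 - (Dm t)\<^sup>2 - 2 * (?l t * Dm t))) \<in> borel_measurable \<nu>"
      by (intro borel_measurable_integrable integrable_mult_right Bochner_Integration.integrable_diff i)
  qed
  also have "\<dots> = (n / e + 2 * sqrt n) * (\<integral>t. (?r t)\<^sup>2 \<partial>\<nu>) + e * (\<integral>t. (Dm t)\<^sup>2 \<partial>\<nu>)
      + 2 * sqrt n * (\<integral>t. (?l t)\<^sup>2 \<partial>\<nu>)"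
    by (simp only: Bochner_Integration.integral_add Bochner_Integration.integrable_add
        integrable_mult_right integral_mult_right_zero i)
  finally show ?thesis .
qed

lemma xi_measurable [measurable]: "xi \<in> borel_measurable borel"
proof -
  interpret \<nu>: finite_measure \<nu> by (rule \<nu>_finite)
  have "(\<lambda>y. \<integral>t. c1 t y * Dm t \<partial>\<nu>) \<in> borel_measurable borel"
    by (rule \<nu>.borel_measurable_lebesgue_integral) measurable
  then show ?thesis unfolding xi_def[abs_def] by measurable
qed

lemma stat_measurable [measurable]: "stat n \<in> borel_measurable M"
proof -
  interpret \<nu>: finite_measure \<nu> by (rule \<nu>_finite)
  have "(\<lambda>x. \<integral>t. (dn n (smp x) t)\<^sup>2 \<partial>\<nu>) \<in> borel_measurable M"
    by (rule \<nu>.borel_measurable_lebesgue_integral) measurable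
  then show ?thesis unfolding stat_def[abs_def] by measurable
qed

lemma xi_growth: "\<bar>xi y\<bar> \<le> (4 * c1_const * weight_moment) * (1 + y\<^sup>2)"
proof -
  have "\<bar>\<integral>t. c1 t y * Dm t \<partial>\<nu>\<bar> \<le> (\<integral>t. (c1_const * (1 + y\<^sup>2) * 2) * (1 + \<bar>t\<bar>) ^ 4 \<partial>\<nu>)"
  proof (rule abs_integral_le)
    fix t
    have "\<bar>c1 t y * Dm t\<bar> \<le> (c1_const * (1 + y\<^sup>2) * (1 + \<bar>t\<bar>)) * (2 * (1 + \<bar>t\<bar>))"
      by (rule abs_mult_mono[OF c1_growth Dm_le])
    also have "\<dots> = (c1_const * (1 + y\<^sup>2) * 2) * (1 + \<bar>t\<bar>)\<^sup>2" by (simp add: power2_eq_square)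
    also have "\<dots> \<le> (c1_const * (1 + y\<^sup>2) * 2) * (1 + \<bar>t\<bar>) ^ 4"
      using power_increasing[of 2 4 "1 + \<bar>t\<bar>"] c1_const_nonneg by (intro mult_left_mono) auto
    finally show "\<bar>c1 t y * Dm t\<bar> \<le> (c1_const * (1 + y\<^sup>2) * 2) * (1 + \<bar>t\<bar>) ^ 4" .
  qed (use \<nu>_T4 in auto)
  then show ?thesis by (simp add: xi_def weight_moment_def abs_mult)
qed

lemma xi_sq_int: "integrable M (\<lambda>x. (xi (X x))\<^sup>2)"
  by (rule square_integrable_quadratic_growth[OF _ xi_growth]) simp

text \<open>The dominating function is a product of a function integrable over \<open>M\<close> and
  one integrable over \<open>\<nu>\<close>, hence the integrand is integrable on the product
  space.\<close>

lemma fubini_dominated: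
  fixes f :: "'a \<Rightarrow> real \<Rightarrow> real"
  assumes [measurable]: "(\<lambda>(x, t). f x t) \<in> borel_measurable (M \<Otimes>\<^sub>M \<nu>)"
    and h: "integrable M h" and le: "\<And>x t. \<bar>f x t\<bar> \<le> h x * (1 + \<bar>t\<bar>) ^ 4"
  shows "expectation (\<lambda>x. \<integral>t. f x t \<partial>\<nu>) = (\<integral>t. expectation (\<lambda>x. f x t) \<partial>\<nu>)"
proof -
  interpret p\<nu>: pair_sigma_finite M \<nu> by (rule pair_sigma_finite_M_\<nu>)
  have i: "integrable \<nu> (\<lambda>t. f x t)" if x: "x \<in> space M" for x
  proof (rule Bochner_Integration.integrable_bound)
    show "integrable \<nu> (\<lambda>t. h x * (1 + \<bar>t\<bar>) ^ 4)" using \<nu>_T4 by simp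
    show "(\<lambda>t. f x t) \<in> borel_measurable \<nu>" using x by measurable
    show "AE t in \<nu>. norm (f x t) \<le> norm (h x * (1 + \<bar>t\<bar>) ^ 4)"
      using le[of x] by (intro always_eventually allI) (auto intro: order_trans[OF _ abs_ge_self])
  qed
  have "integrable (M \<Otimes>\<^sub>M \<nu>) (\<lambda>(x, t). f x t)"
  proof (rule p\<nu>.Fubini_integrable)
    show "integrable M (\<lambda>x. \<integral>t. norm (case (x, t) of (x, t) \<Rightarrow> f x t) \<partial>\<nu>)"
    proof (rule Bochner_Integration.integrable_bound)
      show "integrable M (\<lambda>x. h x * weight_moment)" using h by simp
      show "(\<lambda>x. \<integral>t. norm (case (x, t) of (x, t) \<Rightarrow> f x t) \<partial>\<nu>) \<in> borel_measurable M"
        by (rule p\<nu>.M2.borel_measurable_lebesgue_integral) measurable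
      have "(\<integral>t. \<bar>f x t\<bar> \<partial>\<nu>) \<le> h x * weight_moment" if x: "x \<in> space M" for x
      proof -
        have "(\<integral>t. \<bar>f x t\<bar> \<partial>\<nu>) \<le> (\<integral>t. h x * (1 + \<bar>t\<bar>) ^ 4 \<partial>\<nu>)"
          by (intro integral_mono integrable_abs i x le) (use \<nu>_T4 in simp)
        then show ?thesis by (simp add: weight_moment_def)
      qed
      then show "AE x in M. norm (\<integral>t. norm (case (x, t) of (x, t) \<Rightarrow> f x t) \<partial>\<nu>) \<le> norm (h x * weight_moment)"
        by (intro AE_I2) (auto intro: order_trans[OF _ abs_ge_self])
    qed
    show "AE x in M. integrable \<nu> (\<lambda>t. case (x, t) of (x, t) \<Rightarrow> f x t)"
      using i by (intro AE_I2) simp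
  qed simp
  then show ?thesis using p\<nu>.Fubini_integral[of f] by simp
qed

lemma quartic_growth_int: "integrable M (\<lambda>x. a * (1 + (X x)\<^sup>2)\<^sup>2)"
  using square_integrable_quadratic_growth[of "\<lambda>y. 1 + y\<^sup>2" 1] by simp

lemma one_plus_abs_power_le: "(1 + \<bar>t\<bar>) * (1 + \<bar>t\<bar>) \<le> (1 + \<bar>t\<bar>) ^ 4" for t :: real
  using power_increasing[of 2 4 "1 + \<bar>t\<bar>"] by (simp add: power2_eq_square)

lemma xi_mean: "expectation (\<lambda>x. xi (X x)) = 0"
proof -
  have "expectation (\<lambda>x. \<integral>t. c1 t (X x) * Dm t \<partial>\<nu>) = (\<integral>t. expectation (\<lambda>x. c1 t (X x) * Dm t) \<partial>\<nu>)"
  proof (rule fubini_dominated)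
    show "integrable M (\<lambda>x. c1_const * (1 + (X x)\<^sup>2) * 2)" using X2_int by simp
    fix x t
    have "\<bar>c1 t (X x) * Dm t\<bar> \<le> (c1_const * (1 + (X x)\<^sup>2) * (1 + \<bar>t\<bar>)) * (2 * (1 + \<bar>t\<bar>))"
      by (rule abs_mult_mono[OF c1_growth Dm_le])
    also have "\<dots> = (c1_const * (1 + (X x)\<^sup>2) * 2) * ((1 + \<bar>t\<bar>) * (1 + \<bar>t\<bar>))" by simp
    also have "\<dots> \<le> c1_const * (1 + (X x)\<^sup>2) * 2 * (1 + \<bar>t\<bar>) ^ 4"
      by (intro mult_left_mono one_plus_abs_power_le) (use c1_const_nonneg in auto)
    finally show "\<bar>c1 t (X x) * Dm t\<bar> \<le> c1_const * (1 + (X x)\<^sup>2) * 2 * (1 + \<bar>t\<bar>) ^ 4" .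
  qed measurable
  also have "\<dots> = 0" by (simp add: c1_mean)
  finally show ?thesis by (simp add: xi_def)
qed

text \<open>One factor of the square is opened as an integral over \<open>s\<close> while the other
  stays intact; after the first exchange the second is opened over \<open>t\<close> and exchanged
  for each fixed \<open>s\<close>.\<close>

lemma xi_variance:
  "expectation (\<lambda>x. (xi (X x))\<^sup>2)
    = 4 * (\<integral>s. (\<integral>t. expectation (\<lambda>x. c1 s (X x) * c1 t (X x)) * Dm s * Dm t \<partial>\<nu>) \<partial>\<nu>)"
proof -
  define z where "z y = (\<integral>t. c1 t y * Dm t \<partial>\<nu>)" for y
  have xz: "xi y = 2 * z y" for y by (simp add: xi_def z_def)
  then have z_eq: "z = (\<lambda>y. xi y / 2)" by auto
  have [measurable]: "z \<in> borel_measurable borel" unfolding z_eq by measurable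
  have zg: "\<bar>z y\<bar> \<le> (2 * c1_const * weight_moment) * (1 + y\<^sup>2)" for y using xi_growth[of y] by (simp add: xz abs_mult)
  have 0: "0 \<le> c1_const * c1_const * weight_moment * 4" using c1_const_nonneg weight_moment_nonneg by simp
  have inner: "expectation (\<lambda>x. z (X x) * (c1 s (X x) * Dm s))
     = (\<integral>t. expectation (\<lambda>x. c1 s (X x) * c1 t (X x)) * Dm s * Dm t \<partial>\<nu>)" for s
  proof -
    have "expectation (\<lambda>x. z (X x) * (c1 s (X x) * Dm s))
      = expectation (\<lambda>x. \<integral>t. c1 s (X x) * c1 t (X x) * Dm s * Dm t \<partial>\<nu>)"
    proof (rule Bochner_Integration.integral_cong[OF refl])
      fix x
      have "(\<integral>t. c1 s (X x) * c1 t (X x) * Dm s * Dm t \<partial>\<nu>) = (\<integral>t. (c1 s (X x) * Dm s) * (c1 t (X x) * Dm t) \<partial>\<nu>)"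
        by (simp add: mult.assoc mult.left_commute)
      then show "z (X x) * (c1 s (X x) * Dm s) = (\<integral>t. c1 s (X x) * c1 t (X x) * Dm s * Dm t \<partial>\<nu>)"
        by (simp add: z_def)
    qed
    also have "\<dots> = (\<integral>t. expectation (\<lambda>x. c1 s (X x) * c1 t (X x) * Dm s * Dm t) \<partial>\<nu>)"
    proof (rule fubini_dominated)
      show "integrable M (\<lambda>x. (c1_const * (1 + \<bar>s\<bar>) * c1_const * \<bar>Dm s\<bar> * 2) * (1 + (X x)\<^sup>2)\<^sup>2)" by (rule quartic_growth_int)
      fix x t
      have "\<bar>c1 s (X x) * c1 t (X x) * Dm s * Dm t\<bar>
        \<le> ((c1_const * (1 + \<bar>s\<bar>) * (1 + (X x)\<^sup>2)) * (c1_const * (1 + (X x)\<^sup>2) * (1 + \<bar>t\<bar>))) * \<bar>Dm s\<bar> * (2 * (1 + \<bar>t\<bar>))"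
        by (intro abs_mult_mono c1_growth c1_growth_y Dm_le order_refl)
      also have "\<dots> = (c1_const * (1 + \<bar>s\<bar>) * c1_const * \<bar>Dm s\<bar> * 2) * (1 + (X x)\<^sup>2)\<^sup>2 * ((1 + \<bar>t\<bar>) * (1 + \<bar>t\<bar>))"
        by (simp add: power2_eq_square)
      also have "\<dots> \<le> (c1_const * (1 + \<bar>s\<bar>) * c1_const * \<bar>Dm s\<bar> * 2) * (1 + (X x)\<^sup>2)\<^sup>2 * (1 + \<bar>t\<bar>) ^ 4"
        by (intro mult_left_mono one_plus_abs_power_le mult_nonneg_nonneg) (use c1_const_nonneg in auto)
      finally show "\<bar>c1 s (X x) * c1 t (X x) * Dm s * Dm t\<bar>
        \<le> (c1_const * (1 + \<bar>s\<bar>) * c1_const * \<bar>Dm s\<bar> * 2) * (1 + (X x)\<^sup>2)\<^sup>2 * (1 + \<bar>t\<bar>) ^ 4" .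
    qed measurable
    finally show ?thesis by simp
  qed
  have "expectation (\<lambda>x. (xi (X x))\<^sup>2) = 4 * expectation (\<lambda>x. \<integral>s. z (X x) * (c1 s (X x) * Dm s) \<partial>\<nu>)"
    by (simp add: xz power_mult_distrib power2_eq_square z_def)
  also have "expectation (\<lambda>x. \<integral>s. z (X x) * (c1 s (X x) * Dm s) \<partial>\<nu>)
     = (\<integral>s. expectation (\<lambda>x. z (X x) * (c1 s (X x) * Dm s)) \<partial>\<nu>)"
  proof (rule fubini_dominated)
    show "integrable M (\<lambda>x. (c1_const * c1_const * weight_moment * 4) * (1 + (X x)\<^sup>2)\<^sup>2)" by (rule quartic_growth_int)
    fix x t
    have "\<bar>z (X x) * (c1 t (X x) * Dm t)\<bar>
      \<le> ((2 * c1_const * weight_moment) * (1 + (X x)\<^sup>2)) * ((c1_const * (1 + (X x)\<^sup>2) * (1 + \<bar>t\<bar>)) * (2 * (1 + \<bar>t\<bar>)))"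
      by (intro abs_mult_mono zg c1_growth Dm_le)
    also have "\<dots> = (c1_const * c1_const * weight_moment * 4) * (1 + (X x)\<^sup>2)\<^sup>2 * ((1 + \<bar>t\<bar>) * (1 + \<bar>t\<bar>))"
      by (simp add: power2_eq_square)
    also have "\<dots> \<le> (c1_const * c1_const * weight_moment * 4) * (1 + (X x)\<^sup>2)\<^sup>2 * (1 + \<bar>t\<bar>) ^ 4"
      by (intro mult_left_mono one_plus_abs_power_le mult_nonneg_nonneg 0) auto
    finally show "\<bar>z (X x) * (c1 t (X x) * Dm t)\<bar> \<le> (c1_const * c1_const * weight_moment * 4) * (1 + (X x)\<^sup>2)\<^sup>2 * (1 + \<bar>t\<bar>) ^ 4" .
  qed measurable
  finally show ?thesis by (simp only: inner)
qed

section \<open>Convergence of the statistic\<close>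

text \<open>The mean of \<open>stat_decomposition\<close> on the event. Only the remainder needs the
  truncation; the other two terms are nonnegative and are kept on the whole space.\<close>

lemma stat_remainder:
  assumes n: "n > 0" and N: "N > 0" and k: "0 \<le> k" "k \<le> 1/4" and e: "e > 0"
  defines "b \<equiv> (n / e + 2 * sqrt n) * (majorant_rate n N k * weight_moment) + e * (\<integral>t. (Dm t)\<^sup>2 \<partial>\<nu>)
      + 2 * sqrt n * (c1_const\<^sup>2 * (3 + fourth_moment) * weight_moment / n)"
  shows "integrable M (\<lambda>x. indicator (moment_event n k) x * \<bar>stat n x - sqrt n * avg n xi (smp x)\<bar>)"
    and "expectation (\<lambda>x. indicator (moment_event n k) x * \<bar>stat n x - sqrt n * avg n xi (smp x)\<bar>) \<le> b"
proof -
  let ?q = "\<lambda>x. indicator (moment_event n k) x * (\<integral>t. (remainder n (smp x) t)\<^sup>2 \<partial>\<nu>)"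
  let ?D = "\<integral>t. (Dm t)\<^sup>2 \<partial>\<nu>"
  let ?L = "\<lambda>x. \<integral>t. (avg n (c1 t) (smp x))\<^sup>2 \<partial>\<nu>"
  let ?w = "\<lambda>x. indicator (moment_event n k) x * \<bar>stat n x - sqrt n * avg n xi (smp x)\<bar>"
  let ?g = "\<lambda>x. (n / e + 2 * sqrt n) * ?q x + e * ?D + 2 * sqrt n * ?L x"
  note q = remainder_L2[OF n N k] and L = linear_part_L2[OF n]
  have D: "0 \<le> ?D" by simp
  have le: "?w x \<le> ?g x" for x
  proof (cases "x \<in> moment_event n k")
    case True
    then show ?thesis using stat_decomposition[OF e n, of x] by simp
  next
    case False
    have "0 \<le> ?L x" by simp
    then show ?thesis using False D e by simp
  qed
  have gi: "integrable M ?g"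
    by (intro Bochner_Integration.integrable_add integrable_mult_right q(1) L(1)) simp
  have wm: "?w \<in> borel_measurable M"
    unfolding avg_def by measurable
  show wi: "integrable M ?w"
    by (rule Bochner_Integration.integrable_bound[OF gi wm])
      (use le in \<open>auto intro!: AE_I2 order_trans[OF le abs_ge_self]\<close>)
  have "expectation ?w \<le> expectation ?g" by (rule integral_mono[OF wi gi le])
  also have "\<dots> = (n / e + 2 * sqrt n) * expectation ?q + e * ?D + 2 * sqrt n * expectation ?L"
  proof -
    have i1: "integrable M (\<lambda>x. (n / e + 2 * sqrt n) * ?q x)" by (intro integrable_mult_right q)
    have i2: "integrable M (\<lambda>x. 2 * sqrt n * ?L x)" by (intro integrable_mult_right L)
    have i3: "integrable M (\<lambda>x. e * ?D)" by simp
    show ?thesis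
      unfolding Bochner_Integration.integral_add[OF Bochner_Integration.integrable_add[OF i1 i3] i2]
        Bochner_Integration.integral_add[OF i1 i3] integral_mult_right_zero by (simp add: prob_space)
  qed
  also have "\<dots> \<le> b"
    unfolding b_def by (intro add_mono mult_left_mono q(2) L(2) order_refl) (use e in auto)
  finally show "expectation ?w \<le> b" .
qed

text \<open>The cut-off may decay slightly slower than \<open>n powr (-1/2)\<close>, so that the truncation event is
  negligible, and the number of grid points has to grow faster than \<open>n powr (1/2) * cutoff n\<close> but
  slower than \<open>cutoff n powr (-1/2)\<close>.\<close>

definition cutoff :: "nat \<Rightarrow> real" where "cutoff n = real n powr (-7/16)"
definition grid_size :: "nat \<Rightarrow> nat" where "grid_size n = nat \<lceil>real n powr (1/8)\<rceil>"
definition rate_bound :: "nat \<Rightarrow> real" where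
  "rate_bound n = 4 * (64 * (2 * fourth_moment + 5) * (cutoff n)\<^sup>2 + remainder_const\<^sup>2 * (n * cutoff n ^ 4)
     + 2 * P * ((real n powr (1/8) + 2)\<^sup>2 * cutoff n) + 16 * P\<^sup>2 * real n powr (-1/8))"

lemma grid_size_bounds:
  assumes "n > 0"
  shows "real n powr (1/8) \<le> real (grid_size n)" "real (grid_size n) + 1 \<le> real n powr (1/8) + 2" "grid_size n > 0"
proof -
  have "real n powr (1/8) > 0" using assms by simp
  then show "real n powr (1/8) \<le> real (grid_size n)" "real (grid_size n) + 1 \<le> real n powr (1/8) + 2" "grid_size n > 0"
    unfolding grid_size_def by linarith+
qed

text \<open>The factor \<open>n\<close> comes from the Young term \<open>n / e\<close>. The mesh
  term becomes \<open>n powr (1 - 7/8 - 1/4)\<close>, which is \<open>n powr (-1/8)\<close>.\<close>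

lemma majorant_rate_le:
  assumes n: "n > 0"
  shows "real n * majorant_rate n (grid_size n) (cutoff n) \<le> rate_bound n"
proof -
  note N = grid_size_bounds[OF n]
  have k: "0 \<le> cutoff n" by (simp add: cutoff_def)
  have p: "real n powr (1/8) > 0" using n by simp
  have "(real (grid_size n) + 1)\<^sup>2 \<le> (real n powr (1/8) + 2)\<^sup>2" by (rule power_mono[OF N(2)]) simp
  then have 1: "(real (grid_size n) + 1)\<^sup>2 * cutoff n \<le> (real n powr (1/8) + 2)\<^sup>2 * cutoff n"
    by (rule mult_right_mono[OF _ k])
  have "n * (cutoff n)\<^sup>2 / (real (grid_size n))\<^sup>2 \<le> n * (cutoff n)\<^sup>2 / (real n powr (1/8))\<^sup>2"
    by (intro divide_left_mono power_mono N mult_pos_pos zero_less_power) (use p n N in auto)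
  also have "\<dots> = real n powr (-1/8)"
  proof -
    have "n * (cutoff n)\<^sup>2 / (real n powr (1/8))\<^sup>2
      = real n powr 1 * (real n powr (-7/16) * real n powr (-7/16)) / (real n powr (1/8) * real n powr (1/8))"
      using n by (simp add: cutoff_def power2_eq_square)
    also have "\<dots> = real n powr (-1/8)"
      unfolding powr_add[symmetric] powr_diff[symmetric] by simp
    finally show ?thesis .
  qed
  finally have 2: "n * (cutoff n)\<^sup>2 / (real (grid_size n))\<^sup>2 \<le> real n powr (-1/8)" .
  have "real n * majorant_rate n (grid_size n) (cutoff n) = 4 * (64 * (2 * fourth_moment + 5) * (cutoff n)\<^sup>2 + remainder_const\<^sup>2 * (n * cutoff n ^ 4)
     + 2 * P * ((real (grid_size n) + 1)\<^sup>2 * cutoff n) + 16 * P\<^sup>2 * (n * (cutoff n)\<^sup>2 / (real (grid_size n))\<^sup>2))"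
    using n by (simp add: majorant_rate_def field_simps)
  also have "\<dots> \<le> rate_bound n"
    unfolding rate_bound_def using P_nonneg by (intro mult_left_mono add_mono order_refl 1 2) auto
  finally show ?thesis .
qed

text \<open>The orders of the four summands are \<open>n\<close> to the powers \<open>-7/8\<close>,
  \<open>-3/4\<close>, \<open>-3/16\<close> and \<open>-1/8\<close>.\<close>

lemma rate_bound_tendsto: "rate_bound \<longlonglongrightarrow> 0"
proof -
  have "(\<lambda>n. (cutoff n)\<^sup>2) \<longlonglongrightarrow> 0" "(\<lambda>n. n * cutoff n ^ 4) \<longlonglongrightarrow> 0"
    "(\<lambda>n. (real n powr (1/8) + 2)\<^sup>2 * cutoff n) \<longlonglongrightarrow> 0" "(\<lambda>n. real n powr (-1/8)) \<longlonglongrightarrow> 0"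
    unfolding cutoff_def by real_asymp+
  then have "(\<lambda>n. 4 * (64 * (2 * fourth_moment + 5) * (cutoff n)\<^sup>2 + remainder_const\<^sup>2 * (n * cutoff n ^ 4)
     + 2 * P * ((real n powr (1/8) + 2)\<^sup>2 * cutoff n) + 16 * P\<^sup>2 * real n powr (-1/8)))
     \<longlonglongrightarrow> 4 * (64 * (2 * fourth_moment + 5) * 0 + remainder_const\<^sup>2 * 0 + 2 * P * 0 + 16 * P\<^sup>2 * 0)"
    by (intro tendsto_intros)
  then show ?thesis unfolding rate_bound_def[abs_def] by simp
qed

lemma rate_bound_nonneg: "0 \<le> rate_bound n"
proof -
  have "fourth_moment \<ge> 0" unfolding fourth_moment_def by simp
  then show ?thesis unfolding rate_bound_def using P_nonneg
    by (intro mult_nonneg_nonneg add_nonneg_nonneg) (auto simp: cutoff_def)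
qed

theorem stat_weak_conv:
  "weak_conv_m (\<lambda>n. distr M borel (stat n)) (normal_law 0 (expectation (\<lambda>x. (xi (X x))\<^sup>2)))"
proof (rule weak_conv_m_perturb)
  \<comment> \<open>\<open>(s n)^2\<close> bounds \<open>n\<close> times the mean integrated squared
    remainder on the event.\<close>
  define s where "s n = sqrt (rate_bound n * weight_moment)" for n
  \<comment> \<open>The parameter of Young's inequality: of the size of \<open>s n\<close>, so that
    \<open>(s n)^2 / e n <= s n\<close> while \<open>e n\<close> still tends to \<open>0\<close>.
    The term \<open>1 / n\<close> keeps it positive when \<open>s n = 0\<close>.\<close>
  define e where "e n = s n + 1 / real n" for n
  define D where "D = (\<integral>t. (Dm t)\<^sup>2 \<partial>\<nu>)"
  define C where "C = c1_const\<^sup>2 * (3 + fourth_moment) * weight_moment"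
  \<comment> \<open>The four summands bound, in order, the Young term of the remainder, its square,
    the Young term of \<open>Dm\<close>, and the square of the linear part.\<close>
  define w where "w n = s n + 2 * ((s n)\<^sup>2 / sqrt n) + e n * D + 2 * C / sqrt n" for n
  have s0: "0 \<le> s n" for n using rate_bound_nonneg weight_moment_nonneg by (simp add: s_def)
  have s2: "(s n)\<^sup>2 = rate_bound n * weight_moment" for n using rate_bound_nonneg weight_moment_nonneg by (simp add: s_def)
  have st: "s \<longlonglongrightarrow> 0"
    unfolding s_def[abs_def] using tendsto_real_sqrt[OF tendsto_mult[OF rate_bound_tendsto tendsto_const[of weight_moment]]] by simp
  show "weak_conv_m (\<lambda>n. distr M borel (\<lambda>x. sqrt n * avg n xi (smp x)))
      (normal_law 0 (expectation (\<lambda>x. (xi (X x))\<^sup>2)))"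
    by (rule clt_normal_law[OF xi_measurable xi_sq_int xi_mean])
  show "real_distribution (normal_law 0 (expectation (\<lambda>x. (xi (X x))\<^sup>2)))"
    by (rule real_distribution_normal_law) simp
  show "moment_event n (cutoff n) \<in> events" for n by (rule moment_event_events)
  show "stat n \<in> borel_measurable M" for n by (rule stat_measurable)
  show "(\<lambda>x. sqrt n * avg n xi (smp x)) \<in> borel_measurable M" for n
    unfolding avg_def by measurable
  have small: "\<forall>\<^sub>F n in sequentially. cutoff n \<le> 1/4" unfolding cutoff_def by real_asymp
  show "\<forall>\<^sub>F n in sequentially.
      integrable M (\<lambda>x. indicator (moment_event n (cutoff n)) x * \<bar>stat n x - sqrt n * avg n xi (smp x)\<bar>) \<and>
      expectation (\<lambda>x. indicator (moment_event n (cutoff n)) x * \<bar>stat n x - sqrt n * avg n xi (smp x)\<bar>) \<le> w n"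
    using small eventually_gt_at_top[of 0]
  proof eventually_elim
    case (elim n)
    then have n: "n > 0" by simp
    have k: "0 \<le> cutoff n" by (simp add: cutoff_def)
    have e: "e n > 0" using s0[of n] n by (simp add: e_def add_nonneg_pos)
    note sr = stat_remainder[OF n grid_size_bounds(3)[OF n] k elim(1) e]
    let ?r = "majorant_rate n (grid_size n) (cutoff n) * weight_moment"
    have q: "sqrt (real n) > 0" "sqrt (real n) * sqrt (real n) = n" using n by auto
    have nr: "n * ?r \<le> (s n)\<^sup>2"
      unfolding s2 using mult_right_mono[OF majorant_rate_le[OF n] weight_moment_nonneg] by (simp add: mult.assoc)
    have 1: "n / e n * ?r \<le> s n"
    proof -
      have "n / e n * ?r = n * ?r / e n" by simp
      also have "\<dots> \<le> (s n)\<^sup>2 / e n" by (rule divide_right_mono[OF nr]) (use e in simp)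
      also have "\<dots> \<le> s n"
        using s0[of n] e n by (simp add: divide_le_eq e_def power2_eq_square algebra_simps)
      finally show ?thesis .
    qed
    have "(sqrt n * ?r) * sqrt n = (sqrt n * sqrt n) * ?r" by (simp only: ac_simps)
    then have 2: "sqrt n * ?r \<le> (s n)\<^sup>2 / sqrt n"
      unfolding pos_le_divide_eq[OF q(1)] using nr by (simp only: q)
    have 3: "sqrt n * (C / n) = C / sqrt n"
    proof -
      have "(sqrt n * (C / n)) * sqrt n = (sqrt n * sqrt n) * (C / n)" by (simp only: ac_simps)
      also have "\<dots> = C" unfolding q(2) using n by simp
      finally show ?thesis using q(1) by (simp only: eq_divide_eq) simp
    qed
    have "(n / e n + 2 * sqrt n) * ?r + e n * D + 2 * sqrt n * (C / n)
      = n / e n * ?r + 2 * (sqrt n * ?r) + e n * D + 2 * (sqrt n * (C / n))"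
      by (simp add: algebra_simps)
    also have "\<dots> \<le> w n" unfolding w_def 3 using 1 2 by simp
    finally show ?case using sr unfolding C_def D_def by simp
  qed
  have "(\<lambda>n. 1 / real n) \<longlonglongrightarrow> 0" by real_asymp
  then have et: "e \<longlonglongrightarrow> 0" unfolding e_def[abs_def] using tendsto_add[OF st] by fastforce
  have "(\<lambda>n. 1 / sqrt (real n)) \<longlonglongrightarrow> 0" by real_asymp
  then have "(\<lambda>n. s n + 2 * ((s n)\<^sup>2 * (1 / sqrt n)) + e n * D + 2 * C * (1 / sqrt n))
      \<longlonglongrightarrow> 0 + 2 * (0\<^sup>2 * 0) + 0 * D + 2 * C * 0"
    by (intro tendsto_intros st et)
  then show "w \<longlonglongrightarrow> 0" unfolding w_def[abs_def] by simp
  show "(\<lambda>n. prob (space M - moment_event n (cutoff n))) \<longlonglongrightarrow> 0"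
  proof (rule tendsto_sandwich[OF _ _ tendsto_const])
    show "\<forall>\<^sub>F n in sequentially. 0 \<le> prob (space M - moment_event n (cutoff n))" by simp
    show "\<forall>\<^sub>F n in sequentially. prob (space M - moment_event n (cutoff n)) \<le> (1 + fourth_moment) * (1 / (n * (cutoff n)\<^sup>2))"
      using eventually_gt_at_top[of 0]
    proof eventually_elim
      case (elim n)
      then show ?case using prob_moment_event_compl[of n "cutoff n"] by (simp add: cutoff_def)
    qed
    \<comment> \<open>The denominator is of order \<open>n powr (1/8)\<close>.\<close>
    have "(\<lambda>n. 1 / (real n * (cutoff n)\<^sup>2)) \<longlonglongrightarrow> 0" unfolding cutoff_def by real_asymp
    from tendsto_mult[OF tendsto_const this, of "1 + fourth_moment"]
    show "(\<lambda>n. (1 + fourth_moment) * (1 / (n * (cutoff n)\<^sup>2))) \<longlonglongrightarrow> 0" by simp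
  qed
qed

end

section \<open>Transfer to the given weight, density and sample\<close>

lemma dn_cong:
  assumes "\<And>j. 1 \<le> j \<Longrightarrow> xs j = ys j"
  shows "dn n xs t = dn n ys t"
proof -
  have 1: "sample_mean n xs = sample_mean n ys"
    unfolding sample_mean_def using assms by (intro arg_cong2[where f="(/)"] sum.cong) auto
  have 2: "sample_var n xs = sample_var n ys"
    unfolding sample_var_def 1 using assms by (intro arg_cong2[where f="(/)"] sum.cong) auto
  have 3: "scaled_residual n xs j = scaled_residual n ys j" if "1 \<le> j" for j
    unfolding scaled_residual_def 1 2 using assms[OF that] by simp
  show ?thesis unfolding dn_def
    using 3 by (intro arg_cong2[where f="(-)"] arg_cong2[where f="(/)"] sum.cong) auto
qed

theorem theorem3p2:
  fixes M :: "'a measure"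
    and X :: "'a \<Rightarrow> real"
    and Xs :: "nat \<Rightarrow> 'a \<Rightarrow> real"
    and p \<omega> :: "real \<Rightarrow> real"
    and K1 K2 :: real
  assumes "prob_space M"
    and weight_pos: "\<And>t. 0 < \<omega> t"
    and weight_cont: "continuous_on UNIV \<omega>"
    and weight_int: "integrable lborel (\<lambda>t. t ^ 4 * \<omega> t)"
    and indep: "prob_space.indep_vars M (\<lambda>_. borel) (Xs(0 := X)) UNIV"
    and ident: "\<And>k. k \<ge> 1 \<Longrightarrow> distr M borel (Xs k) = distr M borel X"
    and non_normal:
      "\<not> (\<exists>\<mu> \<sigma>. 0 < \<sigma> \<and> distributed M lborel X (normal_density \<mu> \<sigma>))"
    and moment4: "integrable M (\<lambda>x. (X x) ^ 4)"
    and density: "distributed M lborel X p"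
    and density_nonneg: "\<And>s. 0 \<le> p s"
    and density_C1: "p C1_differentiable_on UNIV"
    and K1: "0 < K1" "\<And>s. \<bar>s * p s\<bar> \<le> K1"
    and K2: "0 < K2" "\<And>s. \<bar>deriv p s\<bar> \<le> K2"
    and mean: "prob_space.expectation M X = 0"
    and var: "prob_space.variance M X = 1"
  shows "weak_conv_m
           (\<lambda>n. distr M borel
              (\<lambda>x. sqrt (real n) * (G1 \<omega> n (\<lambda>k. Xs k x) / real n - Delta1 \<omega> M X)))
           (normal_law 0 (tau1_sq \<omega> M X p))"
proof -
  note p_nn = density_nonneg
  interpret prob_space M by fact
  define \<nu> where "\<nu> = density lborel (\<lambda>t. ennreal (\<omega> t))"
  \<comment> \<open>Independence is assumed for the sequence with \<open>X\<close> placed at index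
    \<open>0\<close>, and this sequence is identically distributed at every index.\<close>
  define Ys where "Ys = Xs(0 := X)"
  have wm [measurable]: "\<omega> \<in> borel_measurable borel"
    by (rule borel_measurable_continuous_onI[OF weight_cont])
  have w0: "0 \<le> \<omega> t" for t using weight_pos[of t] by simp
  have p_deriv: "(p has_field_derivative deriv p s) (at s)" for s
  proof -
    have "p differentiable at s"
      using density_C1 unfolding C1_differentiable_on_def
      by (auto intro: differentiableI_vector)
    then show ?thesis by (simp add: DERIV_deriv_iff_real_differentiable)
  qed
  have p_cont: "continuous_on UNIV p"
    using p_deriv by (intro continuous_at_imp_continuous_on) (auto intro: DERIV_isCont)
  have pm [measurable]: "p \<in> borel_measurable borel"
    by (rule borel_measurable_continuous_onI[OF p_cont])
  have lip: "\<bar>p s - p t\<bar> \<le> K2 * \<bar>s - t\<bar>" for s t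
    using field_differentiable_bound[of UNIV p "deriv p" K2 s t] p_deriv K2(2) by simp
  \<comment> \<open>For \<open>|s| >= 1\<close> the bound on \<open>s * p s\<close> applies
    directly. Otherwise \<open>s\<close> is within \<open>2\<close> of the point \<open>1\<close>,
    where \<open>p\<close> is at most \<open>K1\<close>, and the Lipschitz bound adds
    \<open>2 * K2\<close>.\<close>
  have p_le: "p s \<le> K1 + 2 * K2" for s
  proof (cases "\<bar>s\<bar> \<ge> 1")
    case True
    have "1 * p s \<le> \<bar>s\<bar> * p s" by (rule mult_right_mono[OF True p_nn])
    then show ?thesis using K1(2)[of s] K2(1) p_nn[of s] by (simp add: abs_mult)
  next
    case False
    then have "K2 * \<bar>s - 1\<bar> \<le> K2 * 2" by (intro mult_left_mono) (use K2 in auto)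
    then show ?thesis using lip[of s 1] K1(2)[of 1] p_nn[of 1] by simp
  qed
  have X_rv [measurable]: "random_variable borel X"
    using distributed_measurable[OF density] by simp
  have sq_one: "expectation (\<lambda>x. (X x)\<^sup>2) = 1" using var mean by simp
  \<comment> \<open>Continuity bounds the weight on \<open>[-1, 1]\<close>; outside,
    \<open>t^4\<close> is at least \<open>1\<close> and the assumed moment dominates.\<close>
  have w_int: "integrable lborel \<omega>"
  proof -
    have "compact (\<omega> ` {-1..1})"
      by (intro compact_continuous_image continuous_on_subset[OF weight_cont]) auto
    then obtain B where B: "\<And>t. t \<in> {-1..1} \<Longrightarrow> \<omega> t \<le> B"
      using bounded_has_Sup(1)[OF compact_imp_bounded] by (meson image_eqI bounded_real compact_imp_bounded abs_le_D1)
    have i: "integrable lborel (\<lambda>t. B * indicator {-1..1} t + t ^ 4 * \<omega> t)"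
      by (intro Bochner_Integration.integrable_add weight_int integrable_mult_right integrable_real_indicator)
        (auto simp: emeasure_lborel_Icc_eq)
    have le: "\<omega> t \<le> B * indicator {-1..1} t + t ^ 4 * \<omega> t" for t
    proof (cases "t \<in> {-1..1}")
      case True
      then show ?thesis using B[OF True] w0[of t] by (simp add: add_increasing2)
    next
      case False
      then have "1 \<le> \<bar>t\<bar>" by auto
      then have "1 \<le> \<bar>t\<bar> ^ 4" by (rule one_le_power)
      then have "1 * \<omega> t \<le> t ^ 4 * \<omega> t" by (intro mult_right_mono w0) simp
      then show ?thesis using False by simp
    qed
    show ?thesis
      by (rule Bochner_Integration.integrable_bound[OF i])
        (use w0 in \<open>auto intro!: AE_I2 order_trans[OF le abs_ge_self]\<close>)
  qed
  have fin: "finite_measure \<nu>"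
  proof (rule finite_measureI)
    have "emeasure \<nu> (space \<nu>) = (\<integral>\<^sup>+t. ennreal (\<omega> t) \<partial>lborel)"
      by (simp add: \<nu>_def emeasure_density)
    also have "\<dots> = ennreal (LBINT t. \<omega> t)" by (rule nn_integral_eq_integral[OF w_int]) (simp add: w0)
    finally show "emeasure \<nu> (space \<nu>) \<noteq> \<infinity>" by simp
  qed
  have t4: "integrable \<nu> (\<lambda>t. t ^ 4)"
    unfolding \<nu>_def using weight_int w0 by (subst integrable_density) (auto simp: mult.commute)
  have int_\<nu>: "(\<integral>t. f t \<partial>\<nu>) = (LBINT t. f t * \<omega> t)" if "f \<in> borel_measurable borel" for f :: "real \<Rightarrow> real"
    unfolding \<nu>_def using that w0 by (subst integral_density) (auto simp: mult.commute)
  interpret zero_bias_sample M X Ys p "K1 + 2 * K2" K1 K2 \<nu>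
  proof (intro zero_bias_sample.intro zero_bias_sample_axioms.intro iid_sample.intro iid_sample_axioms.intro)
    show "indep_vars (\<lambda>_. borel) Ys UNIV" unfolding Ys_def by (rule indep)
    show "distr M borel (Ys k) = distr M borel X" for k
      using ident[of k] by (cases "k = 0") (auto simp: Ys_def)
    show "sets \<nu> = sets borel" by (simp add: \<nu>_def)
  qed (fact prob_space_axioms X_rv density p_nn pm p_le K1(2) lip mean sq_one moment4 fin t4)+
  have D: "zb_cdf M X s - cdf (distr M borel X) s = Dm s" for s
    by (simp add: zb_cdf_eq cdf_eq Dm_def)
  have tau: "tau1_sq \<omega> M X p = expectation (\<lambda>x. (xi (X x))\<^sup>2)"
  proof -
    have cov: "cov_kernel1 M X p s t = expectation (\<lambda>x. c1 s (X x) * c1 t (X x))" for s t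
      by (simp add: cov_kernel1_def C1_eq)
    have [measurable]: "(\<lambda>(s, t). expectation (\<lambda>x. c1 s (X x) * c1 t (X x))) \<in> borel_measurable (borel \<Otimes>\<^sub>M borel)"
      unfolding case_prod_beta' by (rule borel_measurable_lebesgue_integral) measurable
    interpret \<nu>: finite_measure \<nu> by (rule fin)
    have m: "(\<lambda>s. \<integral>t. expectation (\<lambda>x. c1 s (X x) * c1 t (X x)) * Dm s * Dm t \<partial>\<nu>) \<in> borel_measurable borel"
      by (rule \<nu>.borel_measurable_lebesgue_integral) measurable
    have inner: "(\<integral>t. expectation (\<lambda>x. c1 s (X x) * c1 t (X x)) * Dm s * Dm t \<partial>\<nu>)
       = (LBINT t. expectation (\<lambda>x. c1 s (X x) * c1 t (X x)) * Dm s * Dm t * \<omega> t)" for s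
      by (rule int_\<nu>) measurable
    have "expectation (\<lambda>x. (xi (X x))\<^sup>2) = 4 * (LBINT s. (LBINT t. expectation (\<lambda>x. c1 s (X x) * c1 t (X x)) * Dm s * Dm t * \<omega> t) * \<omega> s)"
      unfolding xi_variance inner int_\<nu>[OF m[unfolded inner]] ..
    also have "\<dots> = tau1_sq \<omega> M X p"
    proof -
      \<comment> \<open>\<open>tau1_sq\<close> carries both weights in the inner integral, so the
        constant \<open>\<omega> s\<close> is moved inside.\<close>
      have "(LBINT t. expectation (\<lambda>x. c1 s (X x) * c1 t (X x)) * Dm s * Dm t * \<omega> t) * \<omega> s
         = (LBINT t. expectation (\<lambda>x. c1 s (X x) * c1 t (X x)) * Dm s * Dm t * \<omega> s * \<omega> t)" for s
        unfolding integral_mult_left_zero[symmetric] by (simp only: ac_simps)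
      then show ?thesis unfolding tau1_sq_def cov D by simp
    qed
    finally show ?thesis by simp
  qed
  have "sqrt (real n) * (G1 \<omega> n (\<lambda>k. Xs k x) / real n - Delta1 \<omega> M X) = stat n x" for n x
  proof (cases "n = 0")
    case False
    have "G1 \<omega> n (\<lambda>k. Xs k x) / real n = (LBINT t. (dn n (\<lambda>k. Xs k x) t)\<^sup>2 * \<omega> t)"
      using False by (simp add: G1_def dn_def)
    also have "\<dots> = (LBINT t. (dn n (smp x) t)\<^sup>2 * \<omega> t)"
      \<comment> \<open>\<open>Xs\<close> and \<open>Ys\<close> differ only at index
        \<open>0\<close>, which the statistic never reads.\<close>
      using dn_cong[of "\<lambda>k. Xs k x" "smp x" n] by (simp add: Ys_def)
    also have "\<dots> = (\<integral>t. (dn n (smp x) t)\<^sup>2 \<partial>\<nu>)" by (rule int_\<nu>[symmetric]) measurable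
    finally have G: "G1 \<omega> n (\<lambda>k. Xs k x) / real n = (\<integral>t. (dn n (smp x) t)\<^sup>2 \<partial>\<nu>)" .
    have "Delta1 \<omega> M X = (\<integral>t. (Dm t)\<^sup>2 \<partial>\<nu>)"
      unfolding Delta1_def D by (rule int_\<nu>[symmetric]) measurable
    then show ?thesis by (simp add: G stat_def)
  qed (simp add: stat_def)
  then show ?thesis using stat_weak_conv by (simp add: tau fun_eq_iff cong: distr_cong)
qed

end
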